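(* Let $n\ge 1$, $1<r\le 2$, $0<\rho<1$, and let $m\in\mathbb{R}$ satisfy $m\le -\frac{n}{r}(1-\rho)$. Let $\sigma\in S^{m}_{\rho,\rho}(\mathbb{R}^n)$. Then there is a constant $C>0$ such that for all $f\in\mathscr{S}(\mathbb{R}^n)$ and all $x\in\mathbb{R}^n$, $$\mathcal{M}^{\sharp}_r\big(T_\sigma f\big)(x)\le C\,\mathrm{M}_r f(x).$$
   Context: For $m\in\mathbb{R}$ and $0\le\delta\le\rho\le1$, $S^m_{\rho,\delta}(\mathbb{R}^n)$ is the set of smooth $\sigma(x,\xi)$ on $\mathbb{R}^n\times\mathbb{R}^n$ such that for all multi-indices $\alpha,\beta$ there is $C_{\alpha,\beta}$ with $|\partial_x^\alpha\partial_\xi^\beta\sigma(x,\xi)|\le C_{\alpha,\beta}(1+|\xi|)^{m+\delta|\alpha|-\rho|\beta|}$. For $f\in\mathscr{S}(\mathbb{R}^n)$, $T_\sigma f(x)=\int_{\mathbb{R}^n}\sigma(x,\xi)\widehat f(\xi)e^{2\pi i\langle x,\xi\rangle}d\xi$, where $\widehat f(\xi)=\int f(x)e^{-2\pi i\langle x,\xi\rangle}dx$. For $0<r<\infty$, $\mathrm{M}_r f(x)=\sup_{Q\ni x}\big(\frac1{|Q|}\int_Q|f|^r\big)^{1/r}$ (supremum over cubes with sides parallel to the axes containing $x$), and the inhomogeneous $L^r$ sharp maximal function is $$\mathcal{M}^\sharp_r f(x)=\sup_{Q\ni x,\,\ell(Q)\ge1}\Big(\frac1{|Q|}\int_Q|f(y)|^rdy\Big)^{1/r}+\sup_{Q\ni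 x,\,\ell(Q)<1}\inf_{c_Q\in\mathbb{C}}\Big(\frac1{|Q|}\int_Q|f(y)-c_Q|^rdy\Big)^{1/r},$$ where $\ell(Q)$ is the side-length of $Q$. *)

theory Defs
  imports "HOL-Analysis.Analysis"
begin

definition ddir :: "'a::real_normed_vector \<Rightarrow> ('a \<Rightarrow> 'b::real_normed_vector) \<Rightarrow> 'a \<Rightarrow> 'b" where
  "ddir v g z = vector_derivative (\<lambda>t::real. g (z + t *\<^sub>R v)) (at 0)"

fun ddlist :: "'a::real_normed_vector list \<Rightarrow> ('a \<Rightarrow> 'b::real_normed_vector) \<Rightarrow> 'a \<Rightarrow> 'b" where
  "ddlist [] g = g"
| "ddlist (v # vs) g = ddir v (ddlist vs g)"

definition smooth_dirs :: "'a::real_normed_vector set \<Rightarrow> ('a \<Rightarrow> 'b::real_normed_vector) \<Rightarrow> bool" where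
  "smooth_dirs V g \<longleftrightarrow>
     (\<forall>vs \<in> lists V. continuous_on UNIV (ddlist vs g) \<and>
        (\<forall>v\<in>V. \<forall>z. (\<lambda>t::real. ddlist vs g (z + t *\<^sub>R v)) differentiable (at 0)))"

definition coord_dirs :: "(real^'n) set" where
  "coord_dirs = range (\<lambda>i. axis i 1)"

text \<open>Directions in phase space: Inl i = d/dx_i, Inr i = d/dxi_i\<close>
definition pdir :: "'n + 'n \<Rightarrow> (real^'n) \<times> (real^'n)" where
  "pdir d = (case d of Inl i \<Rightarrow> (axis i 1, 0) | Inr i \<Rightarrow> (0, axis i 1))"

definition symbol_class :: "real \<Rightarrow> real \<Rightarrow> real \<Rightarrow> (real^'n \<Rightarrow> real^'n \<Rightarrow> complex) \<Rightarrow> bool" where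
  "symbol_class m \<rho> \<delta> \<sigma> \<longleftrightarrow>
     smooth_dirs (range pdir) (\<lambda>z. \<sigma> (fst z) (snd z)) \<and>
     (\<forall>ds :: ('n + 'n) list. \<exists>C. \<forall>x \<xi>.
        norm (ddlist (map pdir ds) (\<lambda>z. \<sigma> (fst z) (snd z)) (x, \<xi>))
          \<le> C * (1 + norm \<xi>) powr (m + \<delta> * real (length (filter isl ds))
                                   - \<rho> * real (length (filter (\<lambda>d. \<not> isl d) ds))))"

definition schwartz :: "(real^'n \<Rightarrow> complex) \<Rightarrow> bool" where
  "schwartz f \<longleftrightarrow> smooth_dirs coord_dirs f \<and>
     (\<forall>k::nat. \<forall>vs \<in> lists coord_dirs. \<exists>C. \<forall>x. (1 + norm x) ^ k * norm (ddlist vs f x) \<le> C)"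

definition fourier :: "(real^'n \<Rightarrow> complex) \<Rightarrow> real^'n \<Rightarrow> complex" where
  "fourier f \<xi> = integral UNIV (\<lambda>x. f x * exp (- 2 * pi * \<i> * complex_of_real (x \<bullet> \<xi>)))"

definition psido :: "(real^'n \<Rightarrow> real^'n \<Rightarrow> complex) \<Rightarrow> (real^'n \<Rightarrow> complex) \<Rightarrow> real^'n \<Rightarrow> complex" where
  "psido \<sigma> f x = integral UNIV (\<lambda>\<xi>. \<sigma> x \<xi> * fourier f \<xi> * exp (2 * pi * \<i> * complex_of_real (x \<bullet> \<xi>)))"

definition cube :: "real^'n \<Rightarrow> real \<Rightarrow> (real^'n) set" where
  "cube a l = cbox a (a + l *\<^sub>R One)"

definition avg_r :: "real \<Rightarrow> (real^'n \<Rightarrow> complex) \<Rightarrow> real^'n \<Rightarrow> real \<Rightarrow> real" where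
  "avg_r r f a l = (integral (cube a l) (\<lambda>y. norm (f y) powr r) / l ^ CARD('n)) powr (1 / r)"

definition max_r :: "real \<Rightarrow> (real^'n \<Rightarrow> complex) \<Rightarrow> real^'n \<Rightarrow> ereal" where
  "max_r r f x = (SUP al \<in> {(a, l). 0 < l \<and> x \<in> cube a l}. ereal (avg_r r f (fst al) (snd al)))"

definition sharp_r :: "real \<Rightarrow> (real^'n \<Rightarrow> complex) \<Rightarrow> real^'n \<Rightarrow> ereal" where
  "sharp_r r f x =
     (SUP al \<in> {(a, l). 1 \<le> l \<and> x \<in> cube a l}. ereal (avg_r r f (fst al) (snd al)))
   + (SUP al \<in> {(a, l). 0 < l \<and> l < 1 \<and> x \<in> cube a l}.
        ereal (INF c::complex. avg_r r (\<lambda>y. f y - c) (fst al) (snd al)))"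

end

theory Submission
  imports Defs "HOL-Probability.Sinc_Integral"
begin

text \<open>
  Split the symbol dyadically in frequency, \<open>\<sigma> = \<Sum>\<^sub>p \<sigma> \<psi>\<^sub>p\<close>, with pieces \<open>T\<^sub>p\<close> living at frequency \<open>2\<^sup>p\<close>
  and spatial scale \<open>s = 2\<^bsup>-\<rho>p\<^esup>\<close>. At the critical order every piece is bounded by the maximal function
  without any gain in \<open>p\<close>; summability over \<open>p\<close> on a cube of side \<open>h\<close> comes from two sources.
  If \<open>2\<^sup>p h < 1\<close>, then \<open>T\<^sub>p f\<close> oscillates by at most \<open>2\<^sup>p h\<close> times the maximal function. Otherwise the \<open>L\<^sup>r\<close>
  average of \<open>T\<^sub>p f\<close> over the cube gains \<open>(2\<^sup>p min h s)\<^bsup>-n/2\<^esup>\<close>: on boxes of side \<open>s\<close> a \<open>TT\<^sup>*\<close> argument bounds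
  \<open>T\<^sub>p\<close> from \<open>L\<^sup>2\<close> to \<open>L\<^sup>2\<close> by the size of its symbol, and Bernstein's inequality passes from \<open>L\<^sup>r\<close> to \<open>L\<^sup>2\<close> at
  frequency \<open>2\<^sup>p\<close>. The same \<open>TT\<^sup>*\<close> estimate, applied to the symbol \<open>1\<close> at arbitrarily large scale, gives the
  Plancherel inequality. Integration by parts in frequency localises the argument to \<open>|y - c| \<lesssim> s\<close> by a polynomial
  weight, and averaging over the centre \<open>c\<close> turns the weighted norm into the maximal function.
\<close>

section \<open>Integration on Euclidean space\<close>

text \<open>With \<delta> = \<rho>, an x-derivative of the piece at frequency 2^p costs 1/s and a
  \<xi>-derivative gains s. On a box at scale s the cost is harmless: integrating by parts in x
  makes frequencies further apart than 1/s almost orthogonal. The gain confines the kernel to |x -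
  y| of size s. Both effects are used one axis at a time, with at most 4n derivatives in each
  variable, and the same weight \<open>wt\<close> measures both decays. The order m enters through
  2^(m p r) (2^p s)^n = 1: the size of the symbol exactly offsets the Bernstein loss and the
  volumes, leaving only the powers of 2^p h and 2^p s that are summed at the end. For a cube of side
  h the subtracted constant is the sum of the values at x0 of the pieces with 2^p h < 1. There are
  none when h >= 1, which is why large cubes need no constant. Averaging over the centre c takes the
  place of covering a cube by boxes, and treats h <= s and h > s together. Elementary pointwise
  inequalities with a tuned parameter stand in for Hoelder, Hausdorff-Young and Minkowski.\<close>

lemma nn_integral_lborel_affine:
  fixes f :: "'a::euclidean_space \<Rightarrow> ennreal" and c :: real
  assumes [measurable]: "f \<in> borel_measurable borel" and c: "c \<noteq> 0"
  shows "(\<integral>\<^sup>+x. f x \<partial>lborel) = ennreal (\<bar>c\<bar> ^ DIM('a)) * (\<integral>\<^sup>+x. f (t + c *\<^sub>R x) \<partial>lborel)"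
  by (subst lborel_affine[OF c, of t])
     (simp add: nn_integral_density nn_integral_distr nn_integral_cmult)

lemma lborel_translate:
  fixes f :: "'a::euclidean_space \<Rightarrow> 'b::{banach, second_countable_topology}"
  assumes "f \<in> borel_measurable borel"
  shows lborel_integral_translate: "(\<integral>x. f (x + t) \<partial>lborel) = (\<integral>x. f x \<partial>lborel)"
    and lborel_integrable_translate: "integrable lborel (\<lambda>x. f (x + t)) \<longleftrightarrow> integrable lborel f"
proof -
  have "(\<integral>x. f x \<partial>lborel) = (\<integral>x. f x \<partial>(distr lborel borel ((+) t)))"
    by (simp add: lborel_distr_plus)
  also have "\<dots> = (\<integral>x. f (t + x) \<partial>lborel)"
    using assms by (subst integral_distr) auto
  finally show "(\<integral>x. f (x + t) \<partial>lborel) = (\<integral>x. f x \<partial>lborel)" by (simp add: add.commute)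
  have "integrable lborel f \<longleftrightarrow> integrable (distr lborel borel ((+) t)) f"
    by (simp add: lborel_distr_plus)
  also have "\<dots> \<longleftrightarrow> integrable lborel (\<lambda>x. f (t + x))"
    using assms by (subst integrable_distr_eq) auto
  finally show "integrable lborel (\<lambda>x. f (x + t)) \<longleftrightarrow> integrable lborel f"
    by (simp add: add.commute)
qed

lemma directional_derivative_shift:
  fixes p :: "'a::real_normed_vector \<Rightarrow> complex"
  assumes der: "\<And>x. ((\<lambda>t. p (x + t *\<^sub>R v)) has_vector_derivative p' x) (at 0)"
  shows "((\<lambda>u. p (x + u *\<^sub>R v)) has_vector_derivative p' (x + u0 *\<^sub>R v)) (at u0)"
proof -
  have "((\<lambda>u. p ((x + u0 *\<^sub>R v) + u *\<^sub>R v)) has_vector_derivative p' (x + u0 *\<^sub>R v)) (at (u0 - u0))"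
    using der[of "x + u0 *\<^sub>R v"] by simp
  then have "((\<lambda>u. p ((x + u0 *\<^sub>R v) + u *\<^sub>R v)) \<circ> (\<lambda>u. u - u0) has_vector_derivative 1 *\<^sub>R p' (x + u0 *\<^sub>R v)) (at u0)"
    by (intro vector_diff_chain_at) (auto intro!: derivative_eq_intros)
  then show ?thesis by (simp add: o_def algebra_simps)
qed

text \<open>Translation invariance makes the difference quotients integrate to zero.\<close>
lemma integral_directional_derivative_eq_0:
  fixes p p' :: "'a::euclidean_space \<Rightarrow> complex" and H :: "'a \<Rightarrow> real"
  assumes der: "\<And>x. ((\<lambda>t. p (x + t *\<^sub>R v)) has_vector_derivative p' x) (at 0)"
    and p: "integrable lborel p" and [measurable]: "p' \<in> borel_measurable borel"
    and H: "integrable lborel H" "\<And>x t. \<bar>t\<bar> \<le> 1 \<Longrightarrow> norm (p' (x + t *\<^sub>R v)) \<le> H x"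
  shows "(\<integral>x. p' x \<partial>lborel) = 0"
proof -
  have [measurable]: "p \<in> borel_measurable borel" using borel_measurable_integrable[OF p] by simp
  \<comment> \<open>Steps of length at most 1, so that \<open>H\<close> dominates the derivative
    along the whole segment and hence, by the mean value inequality, every difference
    quotient.\<close>
  define t where "t n = 1 / real (Suc n)" for n
  have t: "0 < t n" "t n \<le> 1" for n by (auto simp: t_def divide_simps)
  define D where "D n x = (p (x + t n *\<^sub>R v) - p x) / complex_of_real (t n)" for n x
  note der' = directional_derivative_shift[OF der]
  have D_bound: "norm (D n x) \<le> H x" for n x
  proof -
    have "norm (p (x + t n *\<^sub>R v) - p (x + 0 *\<^sub>R v)) \<le> H x * norm (t n - 0)"
    proof (rule differentiable_bound[of "{0..t n}"])
      fix u assume u: "u \<in> {0..t n}"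
      show "((\<lambda>u. p (x + u *\<^sub>R v)) has_derivative (\<lambda>h. h *\<^sub>R p' (x + u *\<^sub>R v))) (at u within {0..t n})"
        using der'[of x u] by (auto simp: has_vector_derivative_def intro: has_derivative_at_withinI)
      have "norm (p' (x + u *\<^sub>R v)) \<le> H x" using u t[of n] by (intro H) auto
      then show "onorm (\<lambda>h. h *\<^sub>R p' (x + u *\<^sub>R v)) \<le> H x"
        by (intro onorm_le) (auto simp: mult.commute intro!: mult_left_mono)
    qed (use t[of n] in auto)
    then show ?thesis using t[of n] by (simp add: D_def norm_divide divide_simps)
  qed
  have t0: "t \<longlonglongrightarrow> 0"
    unfolding t_def by (rule LIMSEQ_inverse_real_of_nat[unfolded inverse_eq_divide])
  have lim: "(\<lambda>n. D n x) \<longlonglongrightarrow> p' x" for x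
  proof -
    have "((\<lambda>h. (p (x + h *\<^sub>R v) - p x) /\<^sub>R h) \<longlongrightarrow> p' x) (at 0)"
    proof -
      have "((\<lambda>h. norm (p (x + h *\<^sub>R v) - p x - h *\<^sub>R p' x) / norm h) \<longlongrightarrow> 0) (at 0)"
        using der[of x] by (simp add: has_vector_derivative_def has_derivative_at)
      then have "((\<lambda>h. norm ((p (x + h *\<^sub>R v) - p x) /\<^sub>R h - p' x)) \<longlongrightarrow> 0) (at 0)"
      proof (rule Lim_transform_eventually)
        have "norm (p (x + h *\<^sub>R v) - p x - h *\<^sub>R p' x) / norm h
            = norm ((p (x + h *\<^sub>R v) - p x) /\<^sub>R h - p' x)" if "h \<noteq> 0" for h
        proof -
          have "(p (x + h *\<^sub>R v) - p x) /\<^sub>R h - p' x = (p (x + h *\<^sub>R v) - p x - h *\<^sub>R p' x) /\<^sub>R h"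
            using that by (simp add: scaleR_diff_right)
          then show ?thesis by (simp add: divide_inverse mult.commute)
        qed
        then show "\<forall>\<^sub>F h in at 0. norm (p (x + h *\<^sub>R v) - p x - h *\<^sub>R p' x) / norm h
            = norm ((p (x + h *\<^sub>R v) - p x) /\<^sub>R h - p' x)"
          by (auto simp: eventually_at intro!: exI[of _ 1])
      qed
      then show ?thesis by (rule LIM_zero_cancel[OF tendsto_norm_zero_cancel])
    qed
    then have "(\<lambda>n. (p (x + t n *\<^sub>R v) - p x) /\<^sub>R t n) \<longlonglongrightarrow> p' x"
      by (rule filterlim_compose)
         (use t0 less_imp_neq[OF t(1), symmetric] in \<open>simp add: filterlim_at\<close>)
    then show ?thesis by (simp add: D_def scaleR_conv_of_real divide_inverse mult.commute)
  qed
  have D0: "(\<integral>x. D n x \<partial>lborel) = 0" for n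
  proof -
    have "integrable lborel (\<lambda>x. p (x + t n *\<^sub>R v))" using p by (simp add: lborel_integrable_translate)
    then show ?thesis using p unfolding D_def by (simp add: lborel_integral_translate)
  qed
  have "(\<lambda>n. \<integral>x. D n x \<partial>lborel) \<longlonglongrightarrow> (\<integral>x. p' x \<partial>lborel)"
    by (rule integral_dominated_convergence[where w=H])
       (use H lim D_bound in \<open>auto simp: D_def[abs_def]\<close>)
  then show ?thesis using D0 by (simp add: LIMSEQ_const_iff)
qed


section \<open>Derivative towers and integration by parts\<close>

definition ch :: "real^'n \<Rightarrow> real^'n \<Rightarrow> complex" where
  "ch x \<xi> = cis (2 * pi * (x \<bullet> \<xi>))"

text \<open>The derivatives of a function along v, up to order K, carried as a sequence. Leibniz'
  rule and integration by parts can then be stated once for cutoffs, symbols and Schwartz functions,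
  and scaling factors such as s^l can be absorbed into the entries.\<close>

definition tower :: "nat \<Rightarrow> 'a::real_normed_vector \<Rightarrow> (nat \<Rightarrow> 'a \<Rightarrow> complex) \<Rightarrow> bool" where
  "tower K v p \<longleftrightarrow>
     (\<forall>k<K. \<forall>x. ((\<lambda>t. p k (x + t *\<^sub>R v)) has_vector_derivative p (Suc k) x) (at 0))"

text \<open>Leibniz' formula for the k-th derivative of a product.\<close>

definition tmult :: "(nat \<Rightarrow> 'a \<Rightarrow> complex) \<Rightarrow> (nat \<Rightarrow> 'a \<Rightarrow> complex) \<Rightarrow> nat \<Rightarrow> 'a \<Rightarrow> complex" where
  "tmult p q k x = (\<Sum>l\<le>k. of_nat (k choose l) * p l x * q (k - l) x)"

lemma norm_ch [simp]: "norm (ch x \<xi>) = 1"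
  by (simp add: ch_def)

lemma ch_add_right: "ch x (\<xi> + \<zeta>) = ch x \<xi> * ch x \<zeta>"
  by (simp add: ch_def inner_simps cis_mult ring_distribs)

lemma ch_uminus: "ch (- x) \<xi> = cnj (ch x \<xi>)" "ch x (- \<xi>) = cnj (ch x \<xi>)"
  by (simp_all add: ch_def cis_cnj)

lemma ch_commute: "ch x \<xi> = ch \<xi> x"
  by (simp add: ch_def inner_commute)

lemma exp_eq_ch: "exp (2 * pi * \<i> * complex_of_real (x \<bullet> \<xi>)) = ch x \<xi>"
  "exp (- 2 * pi * \<i> * complex_of_real (x \<bullet> \<xi>)) = cnj (ch x \<xi>)"
  by (simp_all add: ch_def cis_conv_exp exp_cnj mult_ac)

lemma borel_measurable_ch [measurable]:
  assumes [measurable]: "f \<in> borel_measurable M" "g \<in> borel_measurable M"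
  shows "(\<lambda>z. ch (f z) (g z)) \<in> borel_measurable M"
  unfolding ch_def cis_conv_exp by measurable

lemma cis_has_vector_derivative: "(cis has_vector_derivative \<i> * cis u) (at u)"
proof -
  have "((\<lambda>z. exp (\<i> * z)) has_field_derivative \<i> * exp (\<i> * of_real u)) (at (of_real u))"
    by (auto intro!: derivative_eq_intros)
  then show ?thesis unfolding cis_conv_exp by (rule has_vector_derivative_real_field)
qed

lemma ch_has_vector_derivative:
  "((\<lambda>t. ch (x + t *\<^sub>R v) y) has_vector_derivative 2 * pi * \<i> * of_real (v \<bullet> y) * ch x y) (at 0)"
proof -
  have "((\<lambda>t. cis (2 * pi * ((x + t *\<^sub>R v) \<bullet> y))) has_vector_derivative
     (2 * pi * (v \<bullet> y)) *\<^sub>R (\<i> * cis (2 * pi * (x \<bullet> y)))) (at 0)"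
  proof -
    have 1: "((\<lambda>t. 2 * pi * ((x + t *\<^sub>R v) \<bullet> y)) has_vector_derivative 2 * pi * (v \<bullet> y)) (at 0)"
      by (auto intro!: derivative_eq_intros simp: inner_simps has_real_derivative_iff_has_vector_derivative[symmetric])
    show ?thesis using vector_diff_chain_at[OF 1 cis_has_vector_derivative] by (simp add: o_def)
  qed
  then show ?thesis by (simp add: ch_def scaleR_conv_of_real mult_ac)
qed

lemma tower_mult:
  assumes p: "tower K v p" and q: "tower K v q"
  shows "tower K v (tmult p q)"
  unfolding tower_def
proof (intro allI impI)
  fix k x assume k: "k < K"
  have "((\<lambda>t. tmult p q k (x + t *\<^sub>R v)) has_vector_derivative
     (\<Sum>l\<le>k. of_nat (k choose l) * (p l x * q (Suc (k - l)) x + p (Suc l) x * q (k - l) x))) (at 0)"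
  proof -
    have "((\<lambda>t. of_nat (k choose l) * (p l (x + t *\<^sub>R v) * q (k - l) (x + t *\<^sub>R v))) has_vector_derivative
       of_nat (k choose l) * (p l x * q (Suc (k - l)) x + p (Suc l) x * q (k - l) x)) (at 0)" if "l \<le> k" for l
    proof -
      have "((\<lambda>t. p l (x + t *\<^sub>R v)) has_vector_derivative p (Suc l) x) (at 0)"
        "((\<lambda>t. q (k - l) (x + t *\<^sub>R v)) has_vector_derivative q (Suc (k - l)) x) (at 0)"
        using that k p q by (auto simp: tower_def)
      from has_vector_derivative_mult_right[OF has_vector_derivative_mult[OF this]]
      show ?thesis by simp
    qed
    then show ?thesis unfolding tmult_def
      by (auto intro!: has_vector_derivative_sum simp: mult.assoc)
  qed
  also have "(\<Sum>l\<le>k. of_nat (k choose l) * (p l x * q (Suc (k - l)) x + p (Suc l) x * q (k - l) x))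
      = (\<Sum>l\<le>k. of_nat (k choose l) * (p l x * q (Suc k - l) x))
      + (\<Sum>l\<le>k. of_nat (k choose l) * (p (Suc l) x * q (k - l) x))"
    by (simp add: ring_distribs sum.distrib Suc_diff_le)
  also have "\<dots> = tmult p q (Suc k) x"
  proof -
    \<comment> \<open>Isolating the term l = 0 on both sides leaves Pascal's rule for the binomial
      coefficients.\<close>
    have "(\<Sum>l\<le>k. of_nat (k choose l) * (p l x * q (Suc k - l) x))
        = (\<Sum>l\<le>Suc k. of_nat (k choose l) * (p l x * q (Suc k - l) x))"
      by simp
    also have "\<dots> = p 0 x * q (Suc k) x + (\<Sum>l\<le>k. of_nat (k choose Suc l) * (p (Suc l) x * q (k - l) x))"
      by (subst sum.atMost_Suc_shift) simp
    finally have 1: "(\<Sum>l\<le>k. of_nat (k choose l) * (p l x * q (Suc k - l) x)) = \<dots>" .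
    have "tmult p q (Suc k) x = p 0 x * q (Suc k) x
        + (\<Sum>l\<le>k. of_nat (Suc k choose Suc l) * (p (Suc l) x * q (k - l) x))"
      unfolding tmult_def by (subst sum.atMost_Suc_shift) (simp add: mult.assoc)
    with 1 show ?thesis by (simp add: ring_distribs sum.distrib)
  qed
  finally show "((\<lambda>t. tmult p q k (x + t *\<^sub>R v)) has_vector_derivative tmult p q (Suc k) x) (at 0)" .
qed

text \<open>By the binomial theorem, geometric growth in the order of differentiation survives
  products: the rates add and the prefactors multiply. Derivative bounds are kept in this form
  below.\<close>

lemma norm_tmult_le:
  assumes "\<And>l. l \<le> k \<Longrightarrow> norm (p l x) \<le> A * a ^ l" "\<And>l. l \<le> k \<Longrightarrow> norm (q l x) \<le> B * b ^ l"
  shows "norm (tmult p q k x) \<le> A * B * (a + b) ^ k"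
proof -
  have "norm (tmult p q k x) \<le> (\<Sum>l\<le>k. norm (of_nat (k choose l) * p l x * q (k - l) x))"
    unfolding tmult_def by (rule norm_sum)
  also have "\<dots> \<le> (\<Sum>l\<le>k. real (k choose l) * (A * a ^ l) * (B * b ^ (k - l)))"
  proof (rule sum_mono)
    fix l assume l: "l \<in> {..k}"
    have "norm (p l x) * norm (q (k - l) x) \<le> (A * a ^ l) * (B * b ^ (k - l))"
      using l by (intro mult_mono assms order_trans[OF norm_ge_zero assms(1)]) auto
    then have "real (k choose l) * (norm (p l x) * norm (q (k - l) x))
        \<le> real (k choose l) * ((A * a ^ l) * (B * b ^ (k - l)))"
      by (intro mult_left_mono) auto
    then show "norm (of_nat (k choose l) * p l x * q (k - l) x)
        \<le> real (k choose l) * (A * a ^ l) * (B * b ^ (k - l))"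
      by (simp add: norm_mult mult.assoc)
  qed
  also have "\<dots> = A * B * (a + b) ^ k"
    by (simp add: binomial_ring sum_distrib_left mult_ac)
  finally show ?thesis .
qed

text \<open>The derivative of \<open>p k x * ch x y\<close> along v integrates to zero, so each
  derivative moved onto the character contributes one factor. \<open>H\<close> must dominate unit
  shifts along v in order to justify the limit of difference quotients.\<close>

lemma tower_integral_ch:
  fixes p :: "nat \<Rightarrow> real^'n \<Rightarrow> complex"
  assumes p: "tower K v p" and meas: "\<And>k. k \<le> K \<Longrightarrow> p k \<in> borel_measurable borel"
    and H: "integrable lborel H" "\<And>k x t. k \<le> K \<Longrightarrow> \<bar>t\<bar> \<le> 1 \<Longrightarrow> norm (p k (x + t *\<^sub>R v)) \<le> H x"
    and k: "k \<le> K"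
  shows "(\<integral>x. p k x * ch x y \<partial>lborel)
           = (- (2 * pi * \<i> * of_real (v \<bullet> y))) ^ k * (\<integral>x. p 0 x * ch x y \<partial>lborel)"
  using k
proof (induction k)
  case 0 show ?case by simp
next
  case (Suc k)
  let ?z = "2 * pi * \<i> * complex_of_real (v \<bullet> y)"
  have [measurable]: "p k \<in> borel_measurable borel" "p (Suc k) \<in> borel_measurable borel"
    using meas Suc.prems by auto
  have bd: "norm (p k x) \<le> H x" if "k \<le> K" for k x using H(2)[of k 0 x] that by simp
  have int: "integrable lborel (\<lambda>x. p k x * ch x y)" "integrable lborel (\<lambda>x. p (Suc k) x * ch x y)"
    using Suc.prems by (auto intro!: Bochner_Integration.integrable_bound[OF H(1)] AE_I2 order_trans[OF bd]
        simp: norm_mult)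
  have "(\<integral>x. p (Suc k) x * ch x y + ?z * (p k x * ch x y) \<partial>lborel) = 0"
  proof (rule integral_directional_derivative_eq_0[where v=v and p="\<lambda>x. p k x * ch x y"
        and H="\<lambda>x. H x + norm ?z * H x"])
    fix x
    have "((\<lambda>t. p k (x + t *\<^sub>R v)) has_vector_derivative p (Suc k) x) (at 0)"
      using p Suc.prems by (auto simp: tower_def)
    from has_vector_derivative_mult[OF this ch_has_vector_derivative[of x v y]]
    show "((\<lambda>t. p k (x + t *\<^sub>R v) * ch (x + t *\<^sub>R v) y) has_vector_derivative
        p (Suc k) x * ch x y + ?z * (p k x * ch x y)) (at 0)"
      by (simp add: algebra_simps)
  next
    fix x and t :: real assume t: "\<bar>t\<bar> \<le> 1"
    have "norm (p (Suc k) (x + t *\<^sub>R v) * ch (x + t *\<^sub>R v) y + ?z * (p k (x + t *\<^sub>R v) * ch (x + t *\<^sub>R v) y))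
       \<le> norm (p (Suc k) (x + t *\<^sub>R v)) + norm ?z * norm (p k (x + t *\<^sub>R v))"
      by (rule order_trans[OF norm_triangle_ineq]) (simp add: norm_mult)
    also have "\<dots> \<le> H x + norm ?z * H x"
      using Suc.prems t by (intro add_mono mult_left_mono H(2)) auto
    finally show "norm (p (Suc k) (x + t *\<^sub>R v) * ch (x + t *\<^sub>R v) y + ?z * (p k (x + t *\<^sub>R v) * ch (x + t *\<^sub>R v) y))
       \<le> H x + norm ?z * H x" .
  qed (use int H in \<open>auto\<close>)
  then have "(\<integral>x. p (Suc k) x * ch x y \<partial>lborel) + ?z * (\<integral>x. p k x * ch x y \<partial>lborel) = 0"
    using int by simp
  then show ?case using Suc by (simp add: add_eq_0_iff2)
qed

section \<open>The polynomial weight\<close>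

text \<open>The exponent \<open>4n\<close> is large enough for \<open>(1 + |z|)\<^sup>n wt z\<close> to be integrable.\<close>
definition wt :: "real^'n \<Rightarrow> real" where
  "wt z = 1 / (1 + (\<Sum>i\<in>UNIV. (z $ i) ^ (4 * CARD('n))))"

text \<open>The extra power n pays for the growth of a cube that must contain both a translate by a
  multiple of z and a fixed point; see \<open>maxbound_shift\<close>.\<close>

definition wt_mass :: "'n::finite itself \<Rightarrow> real" where
  "wt_mass _ = integral\<^sup>L lborel (\<lambda>z::real^'n. (1 + norm z) ^ CARD('n) * wt z)"

lemma wt_denom_ge_1: "1 \<le> 1 + (\<Sum>i\<in>UNIV. (z $ i) ^ (4 * CARD('n)))" for z :: "real^'n"
  by (simp add: sum_nonneg zero_le_even_power)

lemma wt_pos: "0 < wt z" and wt_le_1: "wt z \<le> 1"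
  using wt_denom_ge_1[of z] by (auto simp: wt_def)

lemma wt_inverse: "wt z * (1 + (\<Sum>i\<in>UNIV. (z $ i) ^ (4 * CARD('n)))) = 1" for z :: "real^'n"
  using wt_denom_ge_1[of z] by (auto simp: wt_def)

lemma continuous_on_wt [continuous_intros]:
  "continuous_on S f \<Longrightarrow> continuous_on S (\<lambda>x. wt (f x :: real^'n))"
  unfolding wt_def using wt_denom_ge_1[of "f _"]
  by (intro continuous_intros ballI) (assumption, metis not_one_le_zero)

lemma borel_measurable_wt [measurable]: "wt \<in> borel_measurable borel"
  by (intro borel_measurable_continuous_onI continuous_intros)

lemma prod_Basis_vec: "(\<Prod>b\<in>Basis. g (x \<bullet> b)) = (\<Prod>i\<in>UNIV. g (x $ i))" for x :: "real^'n"
proof -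
  have B: "(Basis :: (real^'n) set) = range (\<lambda>i. axis i 1)" by (auto simp: Basis_vec_def)
  have "inj (\<lambda>i::'n. axis i (1::real))" by (auto simp: inj_def axis_eq_axis)
  then show ?thesis unfolding B by (simp add: prod.reindex inner_axis)
qed

lemma nn_integral_prod_vec:
  fixes g :: "real \<Rightarrow> ennreal"
  assumes [measurable]: "g \<in> borel_measurable borel"
  shows "(\<integral>\<^sup>+(x::real^'n). (\<Prod>i\<in>UNIV. g (x $ i)) \<partial>lborel) = (\<integral>\<^sup>+t. g t \<partial>lborel) ^ CARD('n)"
  using nn_integral_lborel_prod[of "\<lambda>_::real^'n. g"] by (simp add: prod_Basis_vec)

text \<open>Both |z| and the sum in \<open>wt\<close> are compared with the largest coordinate in
  absolute value, or with 1 if that is larger.\<close>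

lemma wt_growth:
  fixes z :: "real^'n"
  shows "(1 + norm z) ^ (4 * CARD('n)) * wt z \<le> (2 * real CARD('n)) ^ (4 * CARD('n))"
proof -
  let ?n = "CARD('n)"
  define u where "u = Max (range (\<lambda>i. \<bar>z $ i\<bar>))"
  have u: "\<bar>z $ i\<bar> \<le> u" for i unfolding u_def by (intro Max_ge) auto
  obtain i0 where i0: "u = \<bar>z $ i0\<bar>" using Max_in[of "range (\<lambda>i. \<bar>z $ i\<bar>)"] unfolding u_def
    by (metis finite_imageI finite_class.finite_UNIV image_is_empty UNIV_not_empty imageE)
  have u0: "0 \<le> u" using i0 by simp
  have n1: "1 \<le> real ?n" by (simp add: Suc_leI)
  have "norm z \<le> (\<Sum>i\<in>UNIV. \<bar>z $ i\<bar>)" by (rule norm_le_l1_cart)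
  also have "\<dots> \<le> (\<Sum>i\<in>(UNIV::'n set). u)" by (intro sum_mono u)
  finally have "norm z \<le> real ?n * u" by simp
  also have "\<dots> \<le> real ?n * max 1 u" by (intro mult_left_mono) auto
  finally have "norm z \<le> real ?n * max 1 u" .
  moreover have "1 * 1 \<le> real ?n * max 1 u" using n1 by (intro mult_mono) auto
  ultimately have "1 + norm z \<le> 2 * real ?n * max 1 u" by linarith
  then have "(1 + norm z) ^ (4 * ?n) \<le> (2 * real ?n * max 1 u) ^ (4 * ?n)"
    by (intro power_mono) auto
  also have "\<dots> = (2 * real ?n) ^ (4 * ?n) * max 1 u ^ (4 * ?n)" by (simp add: power_mult_distrib)
  also have "\<dots> \<le> (2 * real ?n) ^ (4 * ?n) * (1 + (\<Sum>i\<in>UNIV. (z $ i) ^ (4 * ?n)))"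
  proof (intro mult_left_mono)
    have "max 1 u ^ (4 * ?n) \<le> 1 + u ^ (4 * ?n)" using u0 by (cases "u \<le> 1") (auto simp: max_def)
    also have "u ^ (4 * ?n) = (z $ i0) ^ (4 * ?n)" by (simp add: i0 power_even_abs)
    also have "\<dots> \<le> (\<Sum>i\<in>UNIV. (z $ i) ^ (4 * ?n))"
      by (rule member_le_sum) (auto simp: zero_le_even_power)
    finally show "max 1 u ^ (4 * ?n) \<le> 1 + (\<Sum>i\<in>UNIV. (z $ i) ^ (4 * ?n))" by simp
  qed auto
  finally have "(1 + norm z) ^ (4 * ?n) \<le> (2 * real ?n) ^ (4 * ?n) * (1 + (\<Sum>i\<in>UNIV. (z $ i) ^ (4 * ?n)))" .
  then have "(1 + norm z) ^ (4 * ?n) * wt z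
      \<le> (2 * real ?n) ^ (4 * ?n) * (1 + (\<Sum>i\<in>UNIV. (z $ i) ^ (4 * ?n))) * wt z"
    by (rule mult_right_mono) (rule less_imp_le[OF wt_pos])
  also have "\<dots> = (2 * real ?n) ^ (4 * ?n)"
    using wt_inverse[of z] by (simp add: mult.assoc mult.commute[of _ "wt z"])
  finally show ?thesis .
qed

text \<open>Comparison with a product of Cauchy densities 1/(1 + t^2): the factor (1 + |z|)^n and
  the n factors 1 + z_i^2 together cost at most (1 + |z|)^(3n), within the power 4n that
  \<open>wt\<close> absorbs.\<close>

lemma integrable_growth_wt: "integrable lborel (\<lambda>z::real^'n. (1 + norm z) ^ CARD('n) * wt z)"
proof -
  let ?n = "CARD('n)"
  let ?g = "\<lambda>t::real. ennreal (1 / (1 + t\<^sup>2))"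
  have "integrable lborel (\<lambda>x::real. inverse (1 + x\<^sup>2))"
    using integrable_inverse_1_plus_square by (simp add: set_integrable_def einterval_def)
  then have fin: "(\<integral>\<^sup>+t. ?g t \<partial>lborel) < \<infinity>"
    by (simp add: integrable_iff_bounded divide_inverse)
  have meas: "(\<lambda>z::real^'n. (1 + norm z) ^ CARD('n) * wt z) \<in> borel_measurable lborel" by simp
  have pt: "(1 + norm z) ^ ?n * wt z \<le> (2 * real ?n) ^ (4 * ?n) * (\<Prod>i\<in>UNIV. 1 / (1 + (z $ i)\<^sup>2))" for z :: "real^'n"
  proof -
    have "(\<Prod>i\<in>UNIV. 1 + (z $ i)\<^sup>2) \<le> (\<Prod>i\<in>(UNIV::'n set). (1 + norm z)\<^sup>2)"
    proof (rule prod_mono, intro conjI)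
      fix i :: 'n
      have "(z $ i)\<^sup>2 \<le> (norm z)\<^sup>2" using component_le_norm_cart[of z i] abs_le_square_iff[of "z $ i" "norm z"] by simp
      then show "1 + (z $ i)\<^sup>2 \<le> (1 + norm z)\<^sup>2"
        using norm_ge_zero[of z] unfolding power2_sum one_power2 by linarith
    qed (auto intro: add_nonneg_nonneg)
    also have "\<dots> = (1 + norm z) ^ (2 * ?n)" by (simp add: power_mult)
    finally have 1: "(\<Prod>i\<in>UNIV. 1 + (z $ i)\<^sup>2) \<le> (1 + norm z) ^ (2 * ?n)" .
    have P: "0 < (\<Prod>i\<in>UNIV. 1 + (z $ i)\<^sup>2)" by (intro prod_pos) (auto intro: add_pos_nonneg)
    have "(1 + norm z) ^ ?n * wt z * (\<Prod>i\<in>UNIV. 1 + (z $ i)\<^sup>2) \<le> (1 + norm z) ^ ?n * wt z * (1 + norm z) ^ (2 * ?n)"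
      using 1 wt_pos[of z] by (intro mult_left_mono) auto
    also have "\<dots> = (1 + norm z) ^ (?n + 2 * ?n) * wt z"
      by (simp only: power_add mult.assoc mult.commute[of "wt z"])
    also have "\<dots> \<le> (1 + norm z) ^ (4 * ?n) * wt z"
      using wt_pos[of z] by (intro mult_right_mono power_increasing) auto
    also have "\<dots> \<le> (2 * real ?n) ^ (4 * ?n)" by (rule wt_growth)
    finally have "(1 + norm z) ^ ?n * wt z \<le> (2 * real ?n) ^ (4 * ?n) / (\<Prod>i\<in>UNIV. 1 + (z $ i)\<^sup>2)"
      using P by (simp only: pos_le_divide_eq)
    then show ?thesis by (simp add: prod_dividef)
  qed
  define A where "A = (2 * real ?n) ^ (4 * ?n)"
  have A: "0 \<le> A" by (simp add: A_def)
  have "(\<integral>\<^sup>+(z::real^'n). ennreal (norm ((1 + norm z) ^ ?n * wt z)) \<partial>lborel)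
     \<le> (\<integral>\<^sup>+(z::real^'n). ennreal A * (\<Prod>i\<in>UNIV. ?g (z $ i)) \<partial>lborel)"
  proof (rule nn_integral_mono)
    fix z :: "real^'n"
    have "norm ((1 + norm z) ^ ?n * wt z) = (1 + norm z) ^ ?n * wt z" using wt_pos[of z] by (simp add: less_imp_le)
    moreover have "(\<Prod>i\<in>UNIV. ?g (z $ i)) = ennreal (\<Prod>i\<in>UNIV. 1 / (1 + (z $ i)\<^sup>2))"
      by (rule prod_ennreal) simp
    ultimately show "ennreal (norm ((1 + norm z) ^ ?n * wt z)) \<le> ennreal A * (\<Prod>i\<in>UNIV. ?g (z $ i))"
      using ennreal_leI[OF pt[of z]] A by (simp only: ennreal_mult' A_def)
  qed
  also have "\<dots> = ennreal A * (\<integral>\<^sup>+(z::real^'n). (\<Prod>i\<in>UNIV. ?g (z $ i)) \<partial>lborel)"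
    by (rule nn_integral_cmult) measurable
  also have "\<dots> = ennreal A * (\<integral>\<^sup>+t. ?g t \<partial>lborel) ^ ?n"
    by (subst nn_integral_prod_vec) auto
  also have "\<dots> < \<infinity>" using fin
    by (metis ennreal_mult_less_top ennreal_less_top infinity_ennreal_def power_less_top_ennreal)
  finally show ?thesis using meas by (simp only: integrable_iff_bounded simp_thms)
qed

lemma wt_le_growth_wt: "wt z \<le> (1 + norm z) ^ k * wt z"
proof -
  have "1 * wt z \<le> (1 + norm z) ^ k * wt z"
    by (intro mult_right_mono one_le_power) (auto simp: less_imp_le[OF wt_pos])
  then show ?thesis by simp
qed

lemma integrable_wt: "integrable lborel (wt :: real^'n \<Rightarrow> real)"
  by (rule Bochner_Integration.integrable_bound[OF integrable_growth_wt])
     (auto intro!: AE_I2 wt_le_growth_wt simp: less_imp_le[OF wt_pos])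

lemma nn_integral_growth_wt:
  "(\<integral>\<^sup>+(z::real^'n). ennreal ((1 + norm z) ^ CARD('n) * wt z) \<partial>lborel) = ennreal (wt_mass TYPE('n))"
  unfolding wt_mass_def
  by (rule nn_integral_eq_integral[OF integrable_growth_wt]) (auto simp: less_imp_le[OF wt_pos])

lemma nn_integral_wt_le: "(\<integral>\<^sup>+(z::real^'n). ennreal (wt z) \<partial>lborel) \<le> ennreal (wt_mass TYPE('n))"
  unfolding nn_integral_growth_wt[symmetric]
  by (intro nn_integral_mono ennreal_leI wt_le_growth_wt)

lemma wt_mass_nonneg: "0 \<le> wt_mass TYPE('n::finite)"
  unfolding wt_mass_def by (intro Bochner_Integration.integral_nonneg) (auto simp: less_imp_le[OF wt_pos])

section \<open>Boxes and cutoff functions\<close>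

definition sqbox :: "real^'n \<Rightarrow> real \<Rightarrow> (real^'n) set" where
  "sqbox c l = {x. \<forall>i. \<bar>x $ i - c $ i\<bar> \<le> l}"

lemma sqbox_eq_cbox: "sqbox c l = cbox (\<chi> i. c $ i - l) (\<chi> i. c $ i + l)"
  by (auto simp: sqbox_def mem_box_cart abs_le_iff algebra_simps)

lemma sets_sqbox [measurable]: "sqbox c l \<in> sets borel"
  by (simp add: sqbox_eq_cbox)

lemma emeasure_cbox_vec:
  fixes a b :: "real^'n"
  assumes "\<And>i. a $ i \<le> b $ i"
  shows "emeasure lborel (cbox a b) = ennreal (\<Prod>i\<in>UNIV. b $ i - a $ i)"
proof -
  have "\<forall>i\<in>Basis. a \<bullet> i \<le> b \<bullet> i" using assms by (auto simp: Basis_vec_def inner_axis)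
  then show ?thesis using prod_Basis_vec[of "\<lambda>t. t" "b - a"] by (simp add: emeasure_lborel_cbox_eq)
qed

lemma emeasure_sqbox: "0 \<le> l \<Longrightarrow> emeasure lborel (sqbox (c::real^'n) l) = ennreal ((2 * l) ^ CARD('n))"
  by (simp add: sqbox_eq_cbox emeasure_cbox_vec)

lemma integrable_indicator_sqbox: "integrable lborel (indicator (sqbox c l) :: _ \<Rightarrow> real)"
  by (intro integrable_real_indicator) (use emeasure_lborel_cbox_finite in \<open>auto simp: sqbox_eq_cbox\<close>)

lemma tower_integral_ch_box:
  fixes p :: "nat \<Rightarrow> real^'n \<Rightarrow> complex"
  assumes p: "tower K (axis i 1) p" and meas: "\<And>k. k \<le> K \<Longrightarrow> p k \<in> borel_measurable borel"
    and bd: "\<And>k x. k \<le> K \<Longrightarrow> norm (p k x) \<le> D"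
    and supp: "\<And>k x. k \<le> K \<Longrightarrow> x \<notin> sqbox c l \<Longrightarrow> p k x = 0"
    and k: "k \<le> K"
  shows "(\<integral>x. p k x * ch x y \<partial>lborel)
           = (- (2 * pi * \<i> * of_real (y $ i))) ^ k * (\<integral>x. p 0 x * ch x y \<partial>lborel)"
proof -
  have D0: "0 \<le> D" using bd[of 0 undefined] norm_ge_zero order_trans by blast
  have "axis i 1 \<bullet> y = y $ i" by (simp add: inner_axis')
  \<comment> \<open>A shift by at most 1 along an axis can reach the box only from the box enlarged
    by 1, whose indicator is the dominating function.\<close>
  moreover have "norm (p k (x + t *\<^sub>R axis i 1)) \<le> D * indicator (sqbox c (l + 1)) x"
    if "k \<le> K" "\<bar>t\<bar> \<le> 1" for k x t
  proof (cases "x \<in> sqbox c (l + 1)")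
    case False
    then obtain j where j: "\<bar>x $ j - c $ j\<bar> > l + 1" by (auto simp: sqbox_def not_le)
    have "\<bar>(t *\<^sub>R axis i 1 :: real^'n) $ j\<bar> \<le> 1" using that by (auto simp: axis_def)
    then have "\<bar>(x + t *\<^sub>R axis i 1) $ j - c $ j\<bar> > l" using j unfolding vector_add_component by linarith
    then have "x + t *\<^sub>R axis i 1 \<notin> sqbox c l" by (auto simp: sqbox_def not_le)
    then show ?thesis using supp that D0 by simp
  qed (use bd that in simp)
  ultimately show ?thesis
    using tower_integral_ch[OF p meas _ _ k, of "\<lambda>x. D * indicator (sqbox c (l + 1)) x" y]
      integrable_indicator_sqbox[of c "l + 1"] by simp
qed

text \<open>\<open>\<theta> k\<close> plays the role of the k-th derivative of
  \<open>\<theta> 0\<close>; K integrations by parts consume smoothness of order K. The vanishing of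
  the derivatives on the closed plateau is recorded because differences of dilated cutoffs must
  vanish there together with their derivatives.\<close>

definition is_cutoff :: "nat \<Rightarrow> real \<Rightarrow> real \<Rightarrow> (nat \<Rightarrow> real \<Rightarrow> real) \<Rightarrow> bool" where
  "is_cutoff K A L \<theta> \<longleftrightarrow>
     (\<forall>k<K. \<forall>x. (\<theta> k has_real_derivative \<theta> (Suc k) x) (at x)) \<and>
     (\<forall>k\<le>K. continuous_on UNIV (\<theta> k) \<and> (\<forall>x. \<bar>\<theta> k x\<bar> \<le> 2 ^ k \<and> (L \<le> \<bar>x\<bar> \<longrightarrow> \<theta> k x = 0))) \<and>
     (\<forall>x. 0 \<le> \<theta> 0 x \<and> \<theta> 0 x \<le> 1) \<and>
     (\<forall>x. \<bar>x\<bar> \<le> A \<longrightarrow> \<theta> 0 x = 1 \<and> (\<forall>k. 0 < k \<and> k \<le> K \<longrightarrow> \<theta> k x = 0))"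

text \<open>Averaging a cutoff over a unit interval gains one derivative and shrinks the plateau by one.\<close>
lemma is_cutoff_exists: "0 \<le> A \<Longrightarrow> \<exists>\<theta>. is_cutoff K A (A + 2 * real K + 1) \<theta>"
proof (induction K arbitrary: A)
  case 0
  \<comment> \<open>A trapezoid: continuity is all that order 0 asks for.\<close>
  have "is_cutoff 0 A (A + 1) (\<lambda>k x. max 0 (min 1 (A + 1 - \<bar>x\<bar>)))"
    unfolding is_cutoff_def by (auto intro!: continuous_intros)
  then show ?case by auto
next
  case (Suc K)
  \<comment> \<open>Averages over [x, x + 1] look one unit beyond x. The old plateau is therefore
    one unit longer, and the new support reaches one unit further than the old one: two units per
    derivative.\<close>
  obtain \<theta> where \<theta>: "is_cutoff K (A + 1) (A + 1 + 2 * real K + 1) \<theta>"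
    using Suc.IH[of "A + 1"] Suc.prems by auto
  define \<theta>' where "\<theta>' k x = (case k of 0 \<Rightarrow> integral {x..x+1} (\<theta> 0) | Suc k \<Rightarrow> \<theta> k (x + 1) - \<theta> k x)" for k x
  have cont: "continuous_on S (\<theta> k)" if "k \<le> K" for k S
    using \<theta> that by (auto simp: is_cutoff_def intro: continuous_on_subset)
  have int: "\<theta> 0 integrable_on {a..b}" for a b by (intro integrable_continuous_real cont) simp
  have der: "(\<theta>' k has_real_derivative \<theta>' (Suc k) x) (at x)" if "k < Suc K" for k x
  proof (cases k)
    case 0
    \<comment> \<open>The base point x - 2 keeps y and y + 1 interior for y near x, so that the
      primitive has a two-sided derivative at both.\<close>
    define F where "F y = integral {x-2..y} (\<theta> 0)" for y
    have F: "(F has_real_derivative \<theta> 0 y) (at y)" if "y > x - 2" for y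
    proof -
      have "(F has_real_derivative \<theta> 0 y) (at y within {x-2..y+1})"
        unfolding F_def by (rule integral_has_real_derivative) (use that cont in auto)
      then show ?thesis using that
        by (subst (asm) at_within_interior) (auto simp: interior_atLeastAtMost_real)
    qed
    have "((\<lambda>y. F (y + 1) - F y) has_real_derivative \<theta> 0 (x + 1) - \<theta> 0 x) (at x)"
      by (intro DERIV_diff F DERIV_shift[THEN iffD1] ) auto
    moreover have "\<forall>\<^sub>F y in nhds x. F (y + 1) - F y = \<theta>' 0 y"
    proof -
      have "\<forall>\<^sub>F y in nhds x. y \<in> {x-2<..}" by (intro eventually_nhds_in_open) auto
      then show ?thesis
      proof eventually_elim
        case (elim y)
        have "integral {x-2..y} (\<theta> 0) + integral {y..y+1} (\<theta> 0) = integral {x-2..y+1} (\<theta> 0)"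
          by (rule Henstock_Kurzweil_Integration.integral_combine) (use elim int in auto)
        then show ?case by (simp add: F_def \<theta>'_def)
      qed
    qed
    ultimately show ?thesis using 0 by (subst (asm) DERIV_cong_ev) (auto simp: \<theta>'_def)
  next
    case (Suc l)
    then have d: "(\<theta> l has_real_derivative \<theta> (Suc l) y) (at y)" for y using that \<theta> by (auto simp: is_cutoff_def)
    have "((\<lambda>y. \<theta> l (y + 1) - \<theta> l y) has_real_derivative \<theta> (Suc l) (x + 1) - \<theta> (Suc l) x) (at x)"
      by (intro DERIV_diff d DERIV_shift[THEN iffD1])
    then show ?thesis using Suc by (simp add: \<theta>'_def[abs_def])
  qed
  have b0: "0 \<le> \<theta>' 0 x" "\<theta>' 0 x \<le> 1" for x
  proof -
    show "0 \<le> \<theta>' 0 x" using \<theta> int by (auto simp: \<theta>'_def is_cutoff_def intro!: integral_nonneg)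
    have "integral {x..x+1} (\<theta> 0) \<le> integral {x..x+1} (\<lambda>_. 1)"
      by (intro integral_le) (use \<theta> int in \<open>auto simp: is_cutoff_def\<close>)
    then show "\<theta>' 0 x \<le> 1" by (simp add: \<theta>'_def)
  qed
  have cont': "continuous_on UNIV (\<theta>' k)" if "k \<le> Suc K" for k
  proof (cases "k < Suc K")
    case True then show ?thesis using der
      by (intro differentiable_imp_continuous_on)
         (auto simp: differentiable_on_def real_differentiable_def intro: differentiable_at_withinI)
  next
    case False
    then have "k = Suc K" using that by simp
    then have "\<theta>' k = (\<lambda>x. \<theta> K (x + 1) - \<theta> K x)" by (auto simp: \<theta>'_def)
    then show ?thesis
      by (simp only:) (intro continuous_intros continuous_on_compose2[OF cont[of K UNIV]] cont; auto)
  qed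
  have bd: "\<bar>\<theta>' k x\<bar> \<le> 2 ^ k" if "k \<le> Suc K" for k x
  proof (cases k)
    case 0 then show ?thesis using b0[of x] by auto
  next
    case (Suc l)
    have "\<bar>\<theta> l (x+1)\<bar> \<le> 2 ^ l" "\<bar>\<theta> l x\<bar> \<le> 2 ^ l" using Suc that \<theta> by (auto simp: is_cutoff_def)
    then show ?thesis using Suc by (simp add: \<theta>'_def)
  qed
  have supp: "\<theta>' k x = 0" if "k \<le> Suc K" "A + 2 * real (Suc K) + 1 \<le> \<bar>x\<bar>" for k x
  proof -
    have z: "\<theta> l y = 0" if "l \<le> K" "y \<in> {x..x+1}" for l y
    proof -
      have "A + 1 + 2 * real K + 1 \<le> \<bar>y\<bar>"
        using \<open>y \<in> _\<close> \<open>A + 2 * real (Suc K) + 1 \<le> \<bar>x\<bar>\<close> by auto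
      then show ?thesis using \<theta> \<open>l \<le> K\<close> unfolding is_cutoff_def by blast
    qed
    show ?thesis
    proof (cases k)
      case 0
      have "integral {x..x+1} (\<theta> 0) = integral {x..x+1} (\<lambda>_. 0)"
        by (intro integral_cong z) auto
      then show ?thesis using 0 by (simp add: \<theta>'_def)
    qed (use z that in \<open>auto simp: \<theta>'_def\<close>)
  qed
  have plat: "\<theta>' 0 x = 1 \<and> (\<forall>k. 0 < k \<and> k \<le> Suc K \<longrightarrow> \<theta>' k x = 0)" if "\<bar>x\<bar> \<le> A" for x
  proof -
    have one: "\<theta> 0 y = 1" if "y \<in> {x..x+1}" for y
      using \<theta> that \<open>\<bar>x\<bar> \<le> A\<close> unfolding is_cutoff_def by auto
    have zer: "\<theta> k y = 0" if "y \<in> {x..x+1}" "0 < k" "k \<le> K" for y k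
    proof -
      have "\<bar>y\<bar> \<le> A + 1" using that \<open>\<bar>x\<bar> \<le> A\<close> by auto
      then show ?thesis using \<theta> that unfolding is_cutoff_def by blast
    qed
    have "integral {x..x+1} (\<theta> 0) = integral {x..x+1} (\<lambda>_. 1)"
      by (intro integral_cong one) auto
    then have "\<theta>' 0 x = 1" by (simp add: \<theta>'_def)
    moreover have "\<theta>' k x = 0" if "0 < k" "k \<le> Suc K" for k
    proof -
      obtain l where l: "k = Suc l" using \<open>0 < k\<close> gr0_implies_Suc by blast
      show ?thesis using one[of x] one[of "x+1"] zer[of x l] zer[of "x+1" l] that
        by (cases l) (auto simp: l \<theta>'_def)
    qed
    ultimately show ?thesis by blast
  qed
  have "\<forall>k<Suc K. \<forall>x. (\<theta>' k has_real_derivative \<theta>' (Suc k) x) (at x)"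
    and "\<forall>k\<le>Suc K. continuous_on UNIV (\<theta>' k) \<and>
        (\<forall>x. \<bar>\<theta>' k x\<bar> \<le> 2 ^ k \<and> (A + 2 * real (Suc K) + 1 \<le> \<bar>x\<bar> \<longrightarrow> \<theta>' k x = 0))"
    and "\<forall>x. 0 \<le> \<theta>' 0 x \<and> \<theta>' 0 x \<le> 1"
    and "\<forall>x. \<bar>x\<bar> \<le> A \<longrightarrow> \<theta>' 0 x = 1 \<and> (\<forall>k. 0 < k \<and> k \<le> Suc K \<longrightarrow> \<theta>' k x = 0)"
    using der cont' bd supp b0 plat by simp_all
  then have "is_cutoff (Suc K) A (A + 2 * real (Suc K) + 1) \<theta>'"
    unfolding is_cutoff_def by (intro conjI)
  then show ?case by blast
qed

text \<open>The order 4n of differentiability matches the exponent in \<open>wt\<close>: 4n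
  integrations by parts along every axis produce one factor \<open>wt\<close>.\<close>

locale cutoff =
  fixes \<theta> :: "nat \<Rightarrow> real \<Rightarrow> real" and L :: real and N :: "'n::finite itself"
  assumes cutoff: "is_cutoff (4 * CARD('n)) 1 L \<theta>" and L_ge_1: "1 \<le> L"
begin

text \<open>The k-th derivative along axis i of the tensor product of copies of
  \<open>\<theta> 0\<close>; for k = 0 it does not depend on i.\<close>

definition \<Phi> :: "'n \<Rightarrow> nat \<Rightarrow> real^'n \<Rightarrow> complex" where
  "\<Phi> i k \<xi> = of_real (\<theta> k (\<xi> $ i) * (\<Prod>j\<in>UNIV - {i}. \<theta> 0 (\<xi> $ j)))"

text \<open>Dilation to scale 1/q about c; the factor q^k comes from the chain rule. The plateau
  contains the box of half-side 1/q, and the support lies in the box of half-side L/q.\<close>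

definition \<Phi>s :: "real \<Rightarrow> real^'n \<Rightarrow> 'n \<Rightarrow> nat \<Rightarrow> real^'n \<Rightarrow> complex" where
  "\<Phi>s q c i k \<xi> = of_real (q ^ k) * \<Phi> i k (q *\<^sub>R (\<xi> - c))"

lemma \<Phi>_0: "\<Phi> i 0 \<xi> = of_real (\<Prod>j\<in>UNIV. \<theta> 0 (\<xi> $ j))"
  unfolding \<Phi>_def by (subst prod.remove[of UNIV i]) auto

lemma norm_\<Phi>_le: "k \<le> 4 * CARD('n) \<Longrightarrow> norm (\<Phi> i k \<xi>) \<le> 2 ^ k"
proof -
  assume "k \<le> 4 * CARD('n)"
  then have 1: "\<bar>\<theta> k (\<xi> $ i)\<bar> \<le> 2 ^ k" using cutoff by (auto simp: is_cutoff_def)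
  have 2: "0 \<le> (\<Prod>j\<in>UNIV - {i}. \<theta> 0 (\<xi> $ j))" "(\<Prod>j\<in>UNIV - {i}. \<theta> 0 (\<xi> $ j)) \<le> 1"
    using cutoff by (auto simp: is_cutoff_def intro!: prod_nonneg prod_le_1)
  have "\<bar>\<theta> k (\<xi> $ i)\<bar> * \<bar>(\<Prod>j\<in>UNIV - {i}. \<theta> 0 (\<xi> $ j))\<bar> \<le> 2 ^ k * 1"
    using 1 2 by (intro mult_mono) auto
  then show ?thesis unfolding \<Phi>_def norm_of_real abs_mult by simp
qed

lemma \<Phi>_eq_0: "k \<le> 4 * CARD('n) \<Longrightarrow> L \<le> \<bar>\<xi> $ j\<bar> \<Longrightarrow> \<Phi> i k \<xi> = 0"
proof -
  assume k: "k \<le> 4 * CARD('n)" and L: "L \<le> \<bar>\<xi> $ j\<bar>"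
  have z: "\<theta> l (\<xi> $ j) = 0" if "l \<le> 4 * CARD('n)" for l
    using cutoff L that by (auto simp: is_cutoff_def)
  show ?thesis
  proof (cases "j = i")
    case True then show ?thesis using z[OF k] by (simp add: \<Phi>_def)
  next
    case False
    then have "(\<Prod>j\<in>UNIV - {i}. \<theta> 0 (\<xi> $ j)) = 0" using z[of 0] by (intro prod_zero) auto
    then show ?thesis by (simp add: \<Phi>_def)
  qed
qed

lemma \<Phi>_plateau:
  assumes "\<And>j. \<bar>\<xi> $ j\<bar> \<le> 1" "k \<le> 4 * CARD('n)"
  shows "\<Phi> i k \<xi> = (if k = 0 then 1 else 0)"
  using cutoff assms unfolding is_cutoff_def \<Phi>_def by auto

lemma continuous_on_\<Phi>: "k \<le> 4 * CARD('n) \<Longrightarrow> continuous_on UNIV (\<Phi> i k)"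
proof -
  assume k: "k \<le> 4 * CARD('n)"
  have c: "continuous_on UNIV (\<lambda>\<xi>::real^'n. \<theta> l (\<xi> $ j))" if "l \<le> 4 * CARD('n)" for l j
  proof (rule continuous_on_compose2[of UNIV "\<theta> l"])
    show "continuous_on UNIV (\<theta> l)" using cutoff that by (auto simp: is_cutoff_def)
  qed (auto intro!: continuous_intros)
  show ?thesis unfolding \<Phi>_def using k by (intro continuous_intros c) auto
qed

lemma tower_\<Phi>s: "tower (4 * CARD('n)) (axis i 1) (\<Phi>s q c i)"
  unfolding tower_def
proof (intro allI impI)
  fix k x assume k: "k < 4 * CARD('n)"
  have d: "(\<theta> k has_real_derivative \<theta> (Suc k) y) (at y)" for y
    using k cutoff by (auto simp: is_cutoff_def)
  let ?P = "\<Prod>j\<in>UNIV - {i}. \<theta> 0 (q * (x $ j - c $ j))"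
  have eq: "\<Phi>s q c i k (x + t *\<^sub>R axis i 1)
      = of_real (q ^ k * (\<theta> k (q * (x $ i + t - c $ i)) * ?P))" for t
    unfolding \<Phi>s_def \<Phi>_def by (auto simp: axis_def intro!: prod.cong arg_cong[of _ _ complex_of_real])
  have "((\<lambda>t. \<theta> k (q * (x $ i + t - c $ i))) has_real_derivative \<theta> (Suc k) (q * (x $ i + 0 - c $ i)) * q) (at 0)"
    by (rule DERIV_chain2[OF d]) (auto intro!: derivative_eq_intros)
  then have "((\<lambda>t. q ^ k * (\<theta> k (q * (x $ i + t - c $ i)) * ?P)) has_real_derivative
      q ^ k * (\<theta> (Suc k) (q * (x $ i + 0 - c $ i)) * q * ?P)) (at 0)"
    by (intro DERIV_cmult DERIV_cmult_right)
  then have "((\<lambda>t. of_real (q ^ k * (\<theta> k (q * (x $ i + t - c $ i)) * ?P)) :: complex) has_vector_derivative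
      of_real (q ^ k * (\<theta> (Suc k) (q * (x $ i + 0 - c $ i)) * q * ?P))) (at 0)"
    by (rule has_vector_derivative_of_real)
  also have "of_real (q ^ k * (\<theta> (Suc k) (q * (x $ i + 0 - c $ i)) * q * ?P)) = \<Phi>s q c i (Suc k) x"
    by (simp add: \<Phi>s_def \<Phi>_def)
  finally show "((\<lambda>t. \<Phi>s q c i k (x + t *\<^sub>R axis i 1)) has_vector_derivative \<Phi>s q c i (Suc k) x) (at 0)"
    by (simp only: eq)
qed

lemma continuous_on_\<Phi>s: "k \<le> 4 * CARD('n) \<Longrightarrow> continuous_on UNIV (\<Phi>s q c i k)"
  unfolding \<Phi>s_def by (intro continuous_intros continuous_on_compose2[OF continuous_on_\<Phi>]) auto

lemma norm_\<Phi>s_le: "k \<le> 4 * CARD('n) \<Longrightarrow> 0 \<le> q \<Longrightarrow> norm (\<Phi>s q c i k \<xi>) \<le> 1 * (2 * q) ^ k"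
proof -
  assume "k \<le> 4 * CARD('n)" "0 \<le> q"
  then have "q ^ k * norm (\<Phi> i k (q *\<^sub>R (\<xi> - c))) \<le> q ^ k * 2 ^ k"
    by (intro mult_left_mono norm_\<Phi>_le) auto
  then show ?thesis using \<open>0 \<le> q\<close>
    by (simp add: \<Phi>s_def norm_mult norm_power power_mult_distrib mult_ac)
qed

lemma \<Phi>s_eq_0:
  assumes "k \<le> 4 * CARD('n)" "0 < q" "\<xi> \<notin> sqbox c (L / q)"
  shows "\<Phi>s q c i k \<xi> = 0"
proof -
  obtain j where "L / q < \<bar>\<xi> $ j - c $ j\<bar>" using assms by (auto simp: sqbox_def not_le)
  then have "L \<le> \<bar>(q *\<^sub>R (\<xi> - c)) $ j\<bar>" using assms
    by (simp add: abs_mult pos_divide_less_eq mult.commute less_imp_le)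
  then show ?thesis using assms by (simp add: \<Phi>s_def \<Phi>_eq_0)
qed

lemma \<Phi>s_plateau:
  assumes "\<xi> \<in> sqbox c (1 / q)" "0 < q" "k \<le> 4 * CARD('n)"
  shows "\<Phi>s q c i k \<xi> = (if k = 0 then 1 else 0)"
proof -
  have "\<bar>(q *\<^sub>R (\<xi> - c)) $ j\<bar> \<le> 1" for j
    using assms by (auto simp: sqbox_def abs_mult pos_le_divide_eq mult.commute)
  then show ?thesis using assms \<Phi>_plateau by (auto simp: \<Phi>s_def)
qed

end

section \<open>A local almost-orthogonality estimate\<close>

lemma tower_cnj: "tower K v p \<Longrightarrow> tower K v (\<lambda>k x. cnj (p k x))"
  unfolding tower_def using has_vector_derivative_cnj by blast

lemma norm_integral_box_le:
  fixes p :: "real^'n \<Rightarrow> complex"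
  assumes [measurable]: "p \<in> borel_measurable borel"
    and bd: "\<And>x. norm (p x) \<le> D" and supp: "\<And>x. x \<notin> sqbox c l \<Longrightarrow> p x = 0" and l: "0 \<le> l"
  shows "norm (\<integral>x. p x * ch x y \<partial>lborel) \<le> D * (2 * l) ^ CARD('n)"
proof -
  have D0: "0 \<le> D" using bd[of undefined] norm_ge_zero order_trans by blast
  have int: "integrable lborel (\<lambda>x. D * indicator (sqbox c l) x)"
    using integrable_indicator_sqbox[of c l] by simp
  have le: "norm (p x * ch x y) \<le> D * indicator (sqbox c l) x" for x
    using bd[of x] supp[of x] D0 by (cases "x \<in> sqbox c l") (auto simp: norm_mult)
  have i: "integrable lborel (\<lambda>x. p x * ch x y)"
    by (rule Bochner_Integration.integrable_bound[OF int])
       (use le D0 in \<open>auto intro!: AE_I2 simp: abs_mult\<close>)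
  have "norm (\<integral>x. p x * ch x y \<partial>lborel) \<le> (\<integral>x. D * indicator (sqbox c l) x \<partial>lborel)"
    by (rule Bochner_Integration.integral_norm_bound_integral[OF i int le])
  also have "\<dots> = D * (2 * l) ^ CARD('n)"
    using emeasure_sqbox[of l c] l by (simp add: measure_def)
  finally show ?thesis .
qed

lemma ennreal_norm_integral_le: "ennreal (norm (integral\<^sup>L M f)) \<le> (\<integral>\<^sup>+x. ennreal (norm (f x)) \<partial>M)"
  by (cases "integrable M f") (auto intro: integral_norm_bound_ennreal simp: not_integrable_integral_eq)

lemma
  fixes f :: "'a::euclidean_space \<Rightarrow> complex" and g :: "'b::euclidean_space \<Rightarrow> complex"
  assumes f: "integrable lborel f" and g: "integrable lborel g"
  shows integrable_lborel_pair_mult: "integrable (lborel \<Otimes>\<^sub>M lborel) (\<lambda>(x, y). f x * g y)"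
    and integral_lborel_pair_mult:
      "(\<integral>p. f (fst p) * g (snd p) \<partial>(lborel \<Otimes>\<^sub>M lborel)) = (\<integral>x. f x \<partial>lborel) * (\<integral>y. g y \<partial>lborel)"
proof -
  have [measurable]: "f \<in> borel_measurable borel" "g \<in> borel_measurable borel"
    using f g by (auto dest: borel_measurable_integrable)
  show int: "integrable (lborel \<Otimes>\<^sub>M lborel) (\<lambda>(x, y). f x * g y)"
  proof (rule lborel_pair.Fubini_integrable)
    show "integrable lborel (\<lambda>x. \<integral>y. norm (case (x, y) of (x, y) \<Rightarrow> f x * g y) \<partial>lborel)"
      using f g by (simp add: norm_mult)
    show "AE x in lborel. integrable lborel (\<lambda>y. case (x, y) of (x, y) \<Rightarrow> f x * g y)"
      using g by simp
  qed simp
  have "(\<integral>p. f (fst p) * g (snd p) \<partial>(lborel \<Otimes>\<^sub>M lborel)) = (\<integral>x. \<integral>y. f x * g y \<partial>lborel \<partial>lborel)"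
    using lborel_pair.integral_fst'[OF int] by (simp add: split_beta')
  then show "(\<integral>p. f (fst p) * g (snd p) \<partial>(lborel \<Otimes>\<^sub>M lborel)) = (\<integral>x. f x \<partial>lborel) * (\<integral>y. g y \<partial>lborel)"
    by simp
qed

section \<open>The operator on a box at scale s, composed with its adjoint\<close>

context cutoff
begin

text \<open>Integration by parts in x, 4n times along each axis. One derivative of the product of
  cutoff, symbol and conjugate symbol costs (2 + 1 + 1)/s, and the support lies in a box of volume
  (2 L s)^n. Summing over the axes builds the denominator of \<open>wt\<close>.\<close>

lemma tt_kernel_bound:
  fixes \<gamma> :: "'n \<Rightarrow> nat \<Rightarrow> real^'n \<Rightarrow> real^'n \<Rightarrow> complex"
  assumes s: "0 < s" and B: "0 \<le> B"
    and tow: "\<And>i \<xi>. tower (4 * CARD('n)) (axis i 1) (\<lambda>k x. \<gamma> i k x \<xi>)"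
    and meas: "\<And>i k \<xi>. k \<le> 4 * CARD('n) \<Longrightarrow> (\<lambda>x. \<gamma> i k x \<xi>) \<in> borel_measurable borel"
    and \<gamma>0: "\<And>i x \<xi>. \<gamma> i 0 x \<xi> = b x \<xi>"
    and bd: "\<And>i k x \<xi>. k \<le> 4 * CARD('n) \<Longrightarrow> norm (\<gamma> i k x \<xi>) \<le> B * (1 / s) ^ k"
  shows "norm (\<integral>x. \<Phi>s (1 / s) c i0 0 x * (b x \<xi> * cnj (b x \<zeta>)) * ch x (\<xi> - \<zeta>) \<partial>lborel)
     \<le> (real CARD('n) + 1) * (2 * L) ^ CARD('n) * B\<^sup>2 * s ^ CARD('n) * wt (s *\<^sub>R (\<xi> - \<zeta>))"
proof -
  let ?n = "CARD('n)" and ?K = "4 * CARD('n)"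
  define Q where "Q i = tmult (\<Phi>s (1 / s) c i) (tmult (\<lambda>k x. \<gamma> i k x \<xi>) (\<lambda>k x. cnj (\<gamma> i k x \<zeta>)))" for i
  define I where "I = (\<integral>x. \<Phi>s (1 / s) c i0 0 x * (b x \<xi> * cnj (b x \<zeta>)) * ch x (\<xi> - \<zeta>) \<partial>lborel)"
  define V where "V = B\<^sup>2 * (2 * (L * s)) ^ ?n"
  have V0: "0 \<le> V" using L_ge_1 s by (simp add: V_def)
  have Q0: "Q i 0 x = \<Phi>s (1 / s) c i0 0 x * (b x \<xi> * cnj (b x \<zeta>))" for i x
    by (simp add: Q_def tmult_def \<gamma>0 \<Phi>s_def \<Phi>_0)
  have Qt: "tower ?K (axis i 1) (Q i)" for i
    unfolding Q_def by (intro tower_mult tower_\<Phi>s tow tower_cnj)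
  have Qm: "Q i k \<in> borel_measurable borel" if "k \<le> ?K" for i k
  proof -
    have [measurable]: "\<Phi>s (1 / s) c i l \<in> borel_measurable borel" if "l \<le> k" for l
      using that \<open>k \<le> ?K\<close> by (intro borel_measurable_continuous_onI continuous_on_\<Phi>s) auto
    have [measurable]: "(\<lambda>x. \<gamma> i l x \<eta>) \<in> borel_measurable borel" if "l \<le> k" for l \<eta>
      using that \<open>k \<le> ?K\<close> by (intro meas) auto
    have [measurable]: "(\<lambda>x. cnj (\<gamma> i l x \<eta>)) \<in> borel_measurable borel" if "l \<le> k" for l \<eta>
      using that \<open>k \<le> ?K\<close> by (intro borel_measurable_continuous_on[OF _ meas] continuous_intros) auto
    show ?thesis unfolding Q_def tmult_def[abs_def]
      by (intro borel_measurable_sum borel_measurable_times) (auto intro!: measurable_const)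
  qed
  have Qb: "norm (Q i k x) \<le> B\<^sup>2 * (4 / s) ^ k" if "k \<le> ?K" for i k x
  proof -
    have 1: "norm (tmult (\<lambda>k x. \<gamma> i k x \<xi>) (\<lambda>k x. cnj (\<gamma> i k x \<zeta>)) l x) \<le> B * B * (1 / s + 1 / s) ^ l"
      if "l \<le> k" for l
      using that \<open>k \<le> ?K\<close> by (intro norm_tmult_le) (auto intro!: bd)
    have 2: "norm (\<Phi>s (1 / s) c i l x) \<le> 1 * (2 * (1 / s)) ^ l" if "l \<le> k" for l
      using that \<open>k \<le> ?K\<close> s by (intro norm_\<Phi>s_le) auto
    have "norm (Q i k x) \<le> 1 * (B * B) * (2 * (1 / s) + (1 / s + 1 / s)) ^ k"
      unfolding Q_def by (rule norm_tmult_le) (fact 2, fact 1)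
    also have "2 * (1 / s) + (1 / s + 1 / s) = 4 / s" by simp
    finally show ?thesis by (simp add: power2_eq_square)
  qed
  have Qs: "Q i k x = 0" if "k \<le> ?K" "x \<notin> sqbox c (L * s)" for i k x
    using that s unfolding Q_def tmult_def by (intro sum.neutral) (auto intro!: \<Phi>s_eq_0)
  have I0: "norm I \<le> V"
  proof -
    have "norm (\<integral>x. Q i0 0 x * ch x (\<xi> - \<zeta>) \<partial>lborel) \<le> B\<^sup>2 * (2 * (L * s)) ^ ?n"
      by (rule norm_integral_box_le[OF Qm _ Qs]) (use Qb[of 0 i0] L_ge_1 s in auto)
    then show ?thesis by (simp add: Q0 I_def V_def)
  qed
  \<comment> \<open>Multiplication by (s/4)^K turns the derivative bound (4/s)^K into 1, and the
    factor 2 \<pi> of the character more than compensates the division by 4.\<close>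
  have Ii: "(s * (\<xi> - \<zeta>) $ i) ^ ?K * norm I \<le> V" for i
  proof -
    have "(\<integral>x. Q i ?K x * ch x (\<xi> - \<zeta>) \<partial>lborel)
        = (- (2 * pi * \<i> * of_real ((\<xi> - \<zeta>) $ i))) ^ ?K * (\<integral>x. Q i 0 x * ch x (\<xi> - \<zeta>) \<partial>lborel)"
    proof (rule tower_integral_ch_box[OF Qt Qm _ Qs, where D="B\<^sup>2 * max 1 (4 / s) ^ ?K"])
      fix k x assume k: "k \<le> ?K"
      have "(4 / s) ^ k \<le> max 1 (4 / s) ^ k" using s by (intro power_mono) auto
      also have "\<dots> \<le> max 1 (4 / s) ^ ?K" using k by (intro power_increasing) auto
      finally show "norm (Q i k x) \<le> B\<^sup>2 * max 1 (4 / s) ^ ?K"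
        by (intro order_trans[OF Qb[OF k]] mult_left_mono) auto
    qed auto
    moreover have "norm (\<integral>x. Q i ?K x * ch x (\<xi> - \<zeta>) \<partial>lborel) \<le> B\<^sup>2 * (4 / s) ^ ?K * (2 * (L * s)) ^ ?n"
      by (rule norm_integral_box_le[OF Qm _ Qs]) (use Qb L_ge_1 s in auto)
    ultimately have "norm ((- (2 * pi * \<i> * of_real ((\<xi> - \<zeta>) $ i))) ^ ?K * I) \<le> (4 / s) ^ ?K * V"
      by (simp only: Q0 I_def V_def mult_ac)
    then have "(2 * pi * \<bar>(\<xi> - \<zeta>) $ i\<bar>) ^ ?K * norm I \<le> (4 / s) ^ ?K * V"
      by (simp add: norm_mult norm_power del: of_real_diff vector_minus_component)
    then have "(s / 4) ^ ?K * ((2 * pi * \<bar>(\<xi> - \<zeta>) $ i\<bar>) ^ ?K * norm I) \<le> (s / 4) ^ ?K * ((4 / s) ^ ?K * V)"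
      using s by (intro mult_left_mono) auto
    also have "(s / 4) ^ ?K * ((4 / s) ^ ?K * V) = V"
      using s by (simp only: mult.assoc[symmetric] power_mult_distrib[symmetric]) simp
    finally have 1: "(s / 4 * (2 * pi * \<bar>(\<xi> - \<zeta>) $ i\<bar>)) ^ ?K * norm I \<le> V"
      by (simp only: mult.assoc[symmetric] power_mult_distrib)
    have "(s * (\<xi> - \<zeta>) $ i) ^ ?K = (s * \<bar>(\<xi> - \<zeta>) $ i\<bar>) ^ ?K"
      using s by (simp add: power_mult_distrib power_even_abs)
    also have "\<dots> \<le> (s / 4 * (2 * pi * \<bar>(\<xi> - \<zeta>) $ i\<bar>)) ^ ?K"
    proof (rule power_mono)
      have "s * \<bar>(\<xi> - \<zeta>) $ i\<bar> * 1 \<le> s * \<bar>(\<xi> - \<zeta>) $ i\<bar> * (pi / 2)"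
        using s pi_gt3 by (intro mult_left_mono) auto
      then show "s * \<bar>(\<xi> - \<zeta>) $ i\<bar> \<le> s / 4 * (2 * pi * \<bar>(\<xi> - \<zeta>) $ i\<bar>)" by (simp add: mult_ac)
    qed (use s in auto)
    finally show ?thesis using 1 by (meson mult_right_mono norm_ge_zero order_trans)
  qed
  let ?W = "1 + (\<Sum>i\<in>UNIV. ((s *\<^sub>R (\<xi> - \<zeta>)) $ i) ^ ?K)"
  have "?W * norm I = norm I + (\<Sum>i\<in>UNIV. (s * (\<xi> - \<zeta>) $ i) ^ ?K * norm I)"
    by (simp add: distrib_right sum_distrib_right)
  also have "\<dots> \<le> V + (\<Sum>i\<in>(UNIV::'n set). V)"
    by (intro add_mono sum_mono I0 Ii)
  also have "\<dots> = (real ?n + 1) * V" by (simp add: algebra_simps)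
  finally have "?W * norm I \<le> (real ?n + 1) * V" .
  then have "wt (s *\<^sub>R (\<xi> - \<zeta>)) * (?W * norm I) \<le> wt (s *\<^sub>R (\<xi> - \<zeta>)) * ((real ?n + 1) * V)"
    by (intro mult_left_mono less_imp_le[OF wt_pos])
  moreover have "wt (s *\<^sub>R (\<xi> - \<zeta>)) * (?W * norm I) = norm I"
    using wt_inverse[of "s *\<^sub>R (\<xi> - \<zeta>)"] by (simp only: mult.assoc[symmetric] mult_1)
  ultimately have "norm I \<le> wt (s *\<^sub>R (\<xi> - \<zeta>)) * ((real ?n + 1) * V)" by (simp only:)
  then show ?thesis by (simp only: I_def V_def power_mult_distrib mult_ac)
qed

definition CT :: real where
  "CT = (real CARD('n) + 1) * (2 * L) ^ CARD('n) * wt_mass TYPE('n)"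

lemma CT_nonneg: "0 \<le> CT"
  using L_ge_1 wt_mass_nonneg[where 'n='n] by (simp add: CT_def)

lemma nn_integral_wt_shift:
  fixes \<xi> :: "real^'n"
  assumes s: "0 < s"
  shows "ennreal (s ^ CARD('n)) * (\<integral>\<^sup>+\<zeta>. ennreal (wt (s *\<^sub>R (\<xi> - \<zeta>))) \<partial>lborel) \<le> ennreal (wt_mass TYPE('n))"
    and "ennreal (s ^ CARD('n)) * (\<integral>\<^sup>+\<zeta>. ennreal (wt (s *\<^sub>R (\<zeta> - \<xi>))) \<partial>lborel) \<le> ennreal (wt_mass TYPE('n))"
  using nn_integral_lborel_affine[of "\<lambda>z::real^'n. ennreal (wt z)" "-s" "s *\<^sub>R \<xi>"]
    nn_integral_lborel_affine[of "\<lambda>z::real^'n. ennreal (wt z)" s "- s *\<^sub>R \<xi>"] s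
    nn_integral_wt_le[where 'n='n]
  by (simp_all add: scaleR_diff_right)

text \<open>Schur's test for a convolution kernel: a b <= (a^2 + b^2)/2 decouples the two factors,
  and the remaining integral of the kernel over one variable is at most \<open>wt_mass\<close> by
  scaling, whatever s is.\<close>

lemma schur_wt:
  fixes g :: "real^'n \<Rightarrow> real"
  assumes s: "0 < s" and [measurable]: "g \<in> borel_measurable borel" and g: "\<And>x. 0 \<le> g x"
  shows "(\<integral>\<^sup>+p. ennreal (s ^ CARD('n) * wt (s *\<^sub>R (fst p - snd p)) * (g (fst p) * g (snd p)))
            \<partial>(lborel \<Otimes>\<^sub>M lborel))
     \<le> ennreal (wt_mass TYPE('n)) * (\<integral>\<^sup>+x. ennreal ((g x)\<^sup>2) \<partial>lborel)"
proof -
  let ?M = "ennreal (wt_mass TYPE('n))" and ?J = "\<integral>\<^sup>+x. ennreal ((g x)\<^sup>2) \<partial>lborel"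
  define u where "u p = ennreal (s ^ CARD('n)) * ennreal (wt (s *\<^sub>R (fst p - snd p))) * ennreal ((g (fst p))\<^sup>2)" for p
  define v where "v p = ennreal (s ^ CARD('n)) * ennreal (wt (s *\<^sub>R (fst p - snd p))) * ennreal ((g (snd p))\<^sup>2)" for p
  have [measurable]: "u \<in> borel_measurable (lborel \<Otimes>\<^sub>M lborel)" "v \<in> borel_measurable (lborel \<Otimes>\<^sub>M lborel)"
    unfolding u_def v_def by measurable
  have "integral\<^sup>N (lborel \<Otimes>\<^sub>M lborel) u = (\<integral>\<^sup>+x. \<integral>\<^sup>+y. u (x, y) \<partial>lborel \<partial>lborel)"
    by (rule lborel.nn_integral_fst[symmetric]) simp
  also have "\<dots> = (\<integral>\<^sup>+x. (ennreal (s ^ CARD('n)) * (\<integral>\<^sup>+y. ennreal (wt (s *\<^sub>R (x - y))) \<partial>lborel)) * ennreal ((g x)\<^sup>2) \<partial>lborel)"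
    unfolding u_def by (simp add: nn_integral_multc nn_integral_cmult)
  also have "\<dots> \<le> (\<integral>\<^sup>+x. ?M * ennreal ((g x)\<^sup>2) \<partial>lborel)"
    by (intro nn_integral_mono mult_right_mono nn_integral_wt_shift s) auto
  also have "\<dots> = ?M * ?J" by (rule nn_integral_cmult) simp
  finally have U: "integral\<^sup>N (lborel \<Otimes>\<^sub>M lborel) u \<le> ?M * ?J" .
  have "integral\<^sup>N (lborel \<Otimes>\<^sub>M lborel) v = (\<integral>\<^sup>+y. \<integral>\<^sup>+x. v (x, y) \<partial>lborel \<partial>lborel)"
    by (rule lborel_pair.nn_integral_snd[symmetric]) simp
  also have "\<dots> = (\<integral>\<^sup>+y. (ennreal (s ^ CARD('n)) * (\<integral>\<^sup>+x. ennreal (wt (s *\<^sub>R (x - y))) \<partial>lborel)) * ennreal ((g y)\<^sup>2) \<partial>lborel)"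
    unfolding v_def by (simp add: nn_integral_multc nn_integral_cmult)
  also have "\<dots> \<le> (\<integral>\<^sup>+x. ?M * ennreal ((g x)\<^sup>2) \<partial>lborel)"
    by (intro nn_integral_mono mult_right_mono nn_integral_wt_shift s) auto
  also have "\<dots> = ?M * ?J" by (rule nn_integral_cmult) simp
  finally have V: "integral\<^sup>N (lborel \<Otimes>\<^sub>M lborel) v \<le> ?M * ?J" .
  have "(\<integral>\<^sup>+p. ennreal (s ^ CARD('n) * wt (s *\<^sub>R (fst p - snd p)) * (g (fst p) * g (snd p))) \<partial>(lborel \<Otimes>\<^sub>M lborel))
      \<le> (\<integral>\<^sup>+p. ennreal (1/2) * (u p + v p) \<partial>(lborel \<Otimes>\<^sub>M lborel))"
  proof (rule nn_integral_mono)
    fix p :: "(real^'n) \<times> (real^'n)"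
    let ?a = "s ^ CARD('n) * wt (s *\<^sub>R (fst p - snd p))"
    have a: "0 \<le> ?a" using s wt_pos[of "s *\<^sub>R (fst p - snd p)"] by simp
    have "g (fst p) * g (snd p) \<le> 1/2 * ((g (fst p))\<^sup>2 + (g (snd p))\<^sup>2)"
      using sum_squares_bound[of "g (fst p)" "g (snd p)"] by simp
    then have "?a * (g (fst p) * g (snd p)) \<le> ?a * (1/2 * ((g (fst p))\<^sup>2 + (g (snd p))\<^sup>2))"
      using a by (rule mult_left_mono)
    also have "\<dots> = 1/2 * (?a * (g (fst p))\<^sup>2 + ?a * (g (snd p))\<^sup>2)" by (simp add: algebra_simps)
    finally have "ennreal (?a * (g (fst p) * g (snd p))) \<le> ennreal \<dots>" by (rule ennreal_leI)
    also have "\<dots> = ennreal (1/2) * (u p + v p)"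
    proof -
      have "ennreal (?a * y\<^sup>2) = ennreal (s ^ CARD('n)) * ennreal (wt (s *\<^sub>R (fst p - snd p))) * ennreal (y\<^sup>2)" for y
        using s wt_pos[of "s *\<^sub>R (fst p - snd p)"] by (simp add: ennreal_mult)
      moreover have "ennreal (1/2 * (?a * x\<^sup>2 + ?a * y\<^sup>2)) = ennreal (1/2) * (ennreal (?a * x\<^sup>2) + ennreal (?a * y\<^sup>2))" for x y
        using a by (subst ennreal_mult) auto
      ultimately show ?thesis unfolding u_def v_def by (simp only:)
    qed
    finally show "ennreal (?a * (g (fst p) * g (snd p))) \<le> ennreal (1/2) * (u p + v p)" .
  qed
  also have "\<dots> = ennreal (1/2) * (integral\<^sup>N (lborel \<Otimes>\<^sub>M lborel) u + integral\<^sup>N (lborel \<Otimes>\<^sub>M lborel) v)"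
    by (simp add: nn_integral_cmult nn_integral_add)
  also have "\<dots> \<le> ennreal (1/2) * (?M * ?J + ?M * ?J)"
    using U V by (intro mult_left_mono add_mono) auto
  also have "\<dots> = (ennreal (1/2) + ennreal (1/2)) * (?M * ?J)" by (simp only: distrib_left distrib_right)
  also have "ennreal (1/2) + ennreal (1/2) = ennreal (1/2 + 1/2)" by (rule ennreal_plus[symmetric]) auto
  finally show ?thesis by simp
qed

text \<open>The squared modulus is a double integral over two frequencies. Integrating first in x,
  against a smooth majorant of the indicator of the box, gives the kernel of
  \<open>tt_kernel_bound\<close>, to which Schur's test applies. The constant depends neither on s
  nor on c.\<close>

lemma tt_star:
  fixes \<gamma> :: "'n \<Rightarrow> nat \<Rightarrow> real^'n \<Rightarrow> real^'n \<Rightarrow> complex" and G :: "real^'n \<Rightarrow> complex"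
  assumes s: "0 < s" and B: "0 \<le> B"
    and tow: "\<And>i \<xi>. tower (4 * CARD('n)) (axis i 1) (\<lambda>k x. \<gamma> i k x \<xi>)"
    and meas: "\<And>i k \<xi>. k \<le> 4 * CARD('n) \<Longrightarrow> (\<lambda>x. \<gamma> i k x \<xi>) \<in> borel_measurable borel"
    and \<gamma>0: "\<And>i x \<xi>. \<gamma> i 0 x \<xi> = b x \<xi>"
    and bd: "\<And>i k x \<xi>. k \<le> 4 * CARD('n) \<Longrightarrow> norm (\<gamma> i k x \<xi>) \<le> B * (1 / s) ^ k"
    and bm: "(\<lambda>z. b (fst z) (snd z)) \<in> borel_measurable (borel \<Otimes>\<^sub>M borel)"
    and G: "integrable lborel G"
  shows "(\<integral>\<^sup>+x. ennreal ((norm (\<integral>\<xi>. b x \<xi> * G \<xi> * ch x \<xi> \<partial>lborel))\<^sup>2) * indicator (sqbox c s) x \<partial>lborel)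
     \<le> ennreal (CT * B\<^sup>2) * (\<integral>\<^sup>+\<xi>. ennreal ((norm (G \<xi>))\<^sup>2) \<partial>lborel)"
proof -
  let ?n = "CARD('n)" and ?P = "lborel \<Otimes>\<^sub>M lborel :: ((real^'n) \<times> (real^'n)) measure"
  obtain i0 :: 'n where True by simp
  define \<phi> where "\<phi> x = \<Phi>s (1 / s) c i0 0 x" for x
  \<comment> \<open>The same cutoff as a real number, so that positivity of the weight can be
    used.\<close>
  define \<psi> where "\<psi> x = (\<Prod>j\<in>UNIV. \<theta> 0 (((1 / s) *\<^sub>R (x - c)) $ j))" for x
  have \<phi>\<psi>: "\<phi> x = of_real (\<psi> x)" for x by (simp add: \<phi>_def \<psi>_def \<Phi>s_def \<Phi>_0)
  have \<psi>0: "0 \<le> \<psi> x" for x using cutoff unfolding \<psi>_def is_cutoff_def by (intro prod_nonneg) auto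
  have \<phi>1: "\<phi> x = 1" if "x \<in> sqbox c s" for x
    unfolding \<phi>_def using \<Phi>s_plateau[of x c "1 / s" 0 i0] that s by simp
  have \<phi>s: "\<phi> x = 0" if "x \<notin> sqbox c (L * s)" for x
    unfolding \<phi>_def using \<Phi>s_eq_0[of 0 "1 / s" x c i0] that s by simp
  have \<phi>b: "norm (\<phi> x) \<le> 1" for x using norm_\<Phi>s_le[of 0 "1 / s" c i0 x] s by (simp add: \<phi>_def)
  have [measurable]: "\<phi> \<in> borel_measurable borel"
    unfolding \<phi>_def by (intro borel_measurable_continuous_onI continuous_on_\<Phi>s) simp
  have [measurable]: "G \<in> borel_measurable borel" using borel_measurable_integrable[OF G] by simp
  have bcomp: "(\<lambda>z. b (f z) (g z)) \<in> borel_measurable M"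
    if "f \<in> borel_measurable M" "g \<in> borel_measurable M" for f g and M :: "'z measure"
    using measurable_compose[OF measurable_Pair[OF that] bm] by simp
  have b_bd: "norm (b x \<xi>) \<le> B" for x \<xi> using bd[of 0 undefined x \<xi>] \<gamma>0 by simp
  have [measurable]: "cnj \<in> borel_measurable borel"
    by (intro borel_measurable_continuous_onI continuous_intros)
  define F where "F x = (\<integral>\<xi>. b x \<xi> * G \<xi> * ch x \<xi> \<partial>lborel)" for x
  define a where "a x \<xi> = b x \<xi> * G \<xi> * ch x \<xi>" for x \<xi>
  define h where "h x p = \<phi> x * (a x (fst p) * cnj (a x (snd p)))" for x p
  have acomp [measurable]: "(\<lambda>z. a (f z) (g z)) \<in> borel_measurable M"
    if [measurable]: "f \<in> borel_measurable M" "g \<in> borel_measurable M" for f g and M :: "'z measure"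
    unfolding a_def using bcomp[OF that] by measurable
  have a_bd: "norm (a x \<xi>) \<le> B * norm (G \<xi>)" for x \<xi>
    unfolding a_def by (auto simp: norm_mult intro!: mult_right_mono b_bd)
  have a_int: "integrable lborel (a x)" for x
    by (rule Bochner_Integration.integrable_bound[where f="\<lambda>\<xi>. B * norm (G \<xi>)"])
       (use G B a_bd in \<open>auto intro!: AE_I2\<close>)
  have h_meas: "(\<lambda>(x, p). h x p) \<in> borel_measurable (lborel \<Otimes>\<^sub>M ?P)"
    unfolding h_def split_beta' by measurable
  \<comment> \<open>On the bounded support of the cutoff the integrand is dominated by a product of
    integrable functions of x and of the two frequencies, which licenses exchanging the x-integral
    with the frequency integrals.\<close>
  have h_int: "integrable (lborel \<Otimes>\<^sub>M lborel) (\<lambda>(x, p). h x p)"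
  proof -
    have "integrable (lborel \<Otimes>\<^sub>M lborel) (\<lambda>(\<xi>, \<zeta>). (of_real (norm (G \<xi>)) * of_real (norm (G \<zeta>)) :: complex))"
      using G by (intro integrable_lborel_pair_mult) auto
    then have 1: "integrable lborel (\<lambda>p. (of_real (norm (G (fst p))) * of_real (norm (G (snd p))) :: complex))"
      by (simp add: lborel_prod split_beta')
    have 2: "integrable lborel (\<lambda>x. of_real (B\<^sup>2 * indicator (sqbox c (L * s)) x) :: complex)"
      using integrable_indicator_sqbox[of c "L * s"] by (intro integrable_of_real) simp
    from integrable_lborel_pair_mult[OF 2 1]
    show ?thesis
    proof (rule Bochner_Integration.integrable_bound)
      show "(\<lambda>(x, p). h x p) \<in> borel_measurable (lborel \<Otimes>\<^sub>M lborel)" using h_meas by (simp add: lborel_prod)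
      have "norm (h x p) \<le> B\<^sup>2 * indicator (sqbox c (L * s)) x * (norm (G (fst p)) * norm (G (snd p)))" for x p
      proof (cases "x \<in> sqbox c (L * s)")
        case True
        have "norm (h x p) \<le> 1 * ((B * norm (G (fst p))) * (B * norm (G (snd p))))"
          unfolding h_def norm_mult complex_mod_cnj by (intro mult_mono \<phi>b a_bd) (use B in auto)
        then show ?thesis using True by (simp add: power2_eq_square mult_ac)
      qed (simp add: h_def \<phi>s)
      then show "AE z in lborel \<Otimes>\<^sub>M lborel. norm (case z of (x, p) \<Rightarrow> h x p) \<le>
         norm (case z of (x, p) \<Rightarrow> of_real (B\<^sup>2 * indicator (sqbox c (L * s)) x) *
            (of_real (norm (G (fst p))) * of_real (norm (G (snd p))) :: complex))"
        by (intro AE_I2) (auto simp: norm_mult norm_power abs_mult split: prod.split)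
    qed
  qed
  have hp: "(\<integral>p. h x p \<partial>lborel) = of_real (\<psi> x * (norm (F x))\<^sup>2)" for x
  proof -
    have ca: "integrable lborel (\<lambda>\<xi>. cnj (a x \<xi>))" using a_int[of x] by simp
    have "(\<integral>p. h x p \<partial>lborel) = \<phi> x * (\<integral>p. a x (fst p) * cnj (a x (snd p)) \<partial>?P)"
      by (simp add: h_def lborel_prod)
    also have "\<dots> = \<phi> x * ((\<integral>\<xi>. a x \<xi> \<partial>lborel) * (\<integral>\<xi>. cnj (a x \<xi>) \<partial>lborel))"
      by (subst integral_lborel_pair_mult[OF a_int ca]) simp
    also have "\<dots> = \<phi> x * (F x * cnj (F x))"
      unfolding F_def a_def[symmetric] by simp
    also have "\<dots> = of_real (\<psi> x * (norm (F x))\<^sup>2)" by (simp only: \<phi>\<psi> of_real_mult complex_norm_square)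
    finally show ?thesis .
  qed
  define \<kappa> where "\<kappa> = (real ?n + 1) * (2 * L) ^ ?n * B\<^sup>2"
  have \<kappa>: "0 \<le> \<kappa>" using L_ge_1 by (simp add: \<kappa>_def)
  have hx: "norm (\<integral>x. h x p \<partial>lborel)
     \<le> \<kappa> * (s ^ ?n * wt (s *\<^sub>R (fst p - snd p)) * (norm (G (fst p)) * norm (G (snd p))))" for p
  proof -
    have "h x p = (G (fst p) * cnj (G (snd p))) *
        (\<phi> x * (b x (fst p) * cnj (b x (snd p))) * ch x (fst p - snd p))" for x
      using ch_add_right[of x "fst p" "- snd p"] by (simp add: h_def a_def ch_uminus mult_ac)
    then have "norm (\<integral>x. h x p \<partial>lborel) = norm (G (fst p)) * norm (G (snd p)) *
       norm (\<integral>x. \<phi> x * (b x (fst p) * cnj (b x (snd p))) * ch x (fst p - snd p) \<partial>lborel)"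
      by (simp add: norm_mult)
    also have "\<dots> \<le> norm (G (fst p)) * norm (G (snd p)) * (\<kappa> * s ^ ?n * wt (s *\<^sub>R (fst p - snd p)))"
      unfolding \<phi>_def \<kappa>_def by (intro mult_left_mono tt_kernel_bound[OF s B tow meas \<gamma>0 bd]) auto
    finally show ?thesis by (simp add: mult_ac)
  qed
  have int\<psi>: "integrable lborel (\<lambda>x. \<psi> x * (norm (F x))\<^sup>2)"
  proof -
    have "integrable lborel (\<lambda>x. \<integral>p. h x p \<partial>lborel)"
      using lborel_pair.integrable_fst'[OF h_int] by simp
    then have "integrable lborel (\<lambda>x. Re (\<integral>p. h x p \<partial>lborel))" by (rule integrable_Re)
    then show ?thesis by (simp add: hp)
  qed
  have "(\<integral>\<^sup>+x. ennreal ((norm (F x))\<^sup>2) * indicator (sqbox c s) x \<partial>lborel)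
     \<le> (\<integral>\<^sup>+x. ennreal (\<psi> x * (norm (F x))\<^sup>2) \<partial>lborel)"
  proof (rule nn_integral_mono)
    fix x show "ennreal ((norm (F x))\<^sup>2) * indicator (sqbox c s) x \<le> ennreal (\<psi> x * (norm (F x))\<^sup>2)"
      using \<phi>1[of x] by (cases "x \<in> sqbox c s") (auto simp: \<phi>\<psi>)
  qed
  also have "\<dots> = ennreal (\<integral>x. \<psi> x * (norm (F x))\<^sup>2 \<partial>lborel)"
    by (rule nn_integral_eq_integral[OF int\<psi>]) (simp add: \<psi>0)
  also have "\<dots> = ennreal (norm (\<integral>x. \<integral>p. h x p \<partial>lborel \<partial>lborel))"
  proof -
    have "0 \<le> (\<integral>x. \<psi> x * (norm (F x))\<^sup>2 \<partial>lborel)" by (intro Bochner_Integration.integral_nonneg) (simp add: \<psi>0)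
    then show ?thesis unfolding hp by (simp del: of_real_mult of_real_power)
  qed
  also have "(\<integral>x. \<integral>p. h x p \<partial>lborel \<partial>lborel) = (\<integral>p. \<integral>x. h x p \<partial>lborel \<partial>lborel)"
    by (rule lborel_pair.Fubini_integral[OF h_int, symmetric])
  also have "ennreal (norm \<dots>) \<le> (\<integral>\<^sup>+p. ennreal (norm (\<integral>x. h x p \<partial>lborel)) \<partial>lborel)"
    by (rule ennreal_norm_integral_le)
  also have "\<dots> \<le> (\<integral>\<^sup>+p. ennreal \<kappa> * ennreal (s ^ ?n * wt (s *\<^sub>R (fst p - snd p)) * (norm (G (fst p)) * norm (G (snd p)))) \<partial>lborel)"
    using \<kappa> by (intro nn_integral_mono) (auto simp: ennreal_mult'[symmetric] intro!: ennreal_leI hx)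
  also have "\<dots> = (\<integral>\<^sup>+p. ennreal \<kappa> * ennreal (s ^ ?n * wt (s *\<^sub>R (fst p - snd p)) * (norm (G (fst p)) * norm (G (snd p)))) \<partial>?P)"
    by (simp only: lborel_prod)
  also have "\<dots> = ennreal \<kappa> * (\<integral>\<^sup>+p. ennreal (s ^ ?n * wt (s *\<^sub>R (fst p - snd p)) * (norm (G (fst p)) * norm (G (snd p)))) \<partial>?P)"
    by (rule nn_integral_cmult) measurable
  also have "\<dots> \<le> ennreal \<kappa> * (ennreal (wt_mass TYPE('n)) * (\<integral>\<^sup>+x. ennreal ((norm (G x))\<^sup>2) \<partial>lborel))"
    by (intro mult_left_mono schur_wt s) auto
  also have "\<dots> = ennreal (CT * B\<^sup>2) * (\<integral>\<^sup>+\<xi>. ennreal ((norm (G \<xi>))\<^sup>2) \<partial>lborel)"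
    using \<kappa> by (simp add: mult.assoc[symmetric] ennreal_mult'[symmetric])
      (simp add: \<kappa>_def CT_def mult_ac)
  finally show ?thesis by (simp add: F_def)
qed

end

section \<open>Plancherel and Bernstein inequalities\<close>

text \<open>Agrees with \<open>fourier\<close> on integrable functions, but is a Lebesgue integral,
  so that Fubini and dominated convergence apply to it.\<close>

definition ft :: "(real^'n \<Rightarrow> complex) \<Rightarrow> real^'n \<Rightarrow> complex" where
  "ft g \<xi> = (\<integral>y. g y * cnj (ch y \<xi>) \<partial>lborel)"

lemma borel_measurable_cnj [measurable]: "f \<in> borel_measurable M \<Longrightarrow> (\<lambda>x. cnj (f x)) \<in> borel_measurable M"
  by (rule borel_measurable_continuous_on[of cnj]) (auto intro: continuous_intros)

lemma borel_measurable_ft [measurable]: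
  assumes [measurable]: "g \<in> borel_measurable borel"
  shows "ft g \<in> borel_measurable borel"
  unfolding ft_def[abs_def] by measurable

lemma norm_ft_le: "norm (ft g \<xi>) \<le> (\<integral>y. norm (g y) \<partial>lborel)"
  unfolding ft_def by (rule order_trans[OF integral_norm_bound]) (simp add: norm_mult)

lemma ennreal_norm_ft_le: "ennreal (norm (ft g \<xi>)) \<le> (\<integral>\<^sup>+y. ennreal (norm (g y)) \<partial>lborel)"
  unfolding ft_def by (rule order_trans[OF ennreal_norm_integral_le]) (simp add: norm_mult)

lemma ft_add:
  assumes "integrable lborel g" "integrable lborel h"
  shows "ft (\<lambda>y. g y + h y) \<xi> = ft g \<xi> + ft h \<xi>"
proof -
  have "integrable lborel (\<lambda>y. u y * cnj (ch y \<xi>))" if "integrable lborel u" for u :: "real^'a \<Rightarrow> complex"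
    by (rule Bochner_Integration.integrable_bound[OF that])
       (use borel_measurable_integrable[OF that] in \<open>auto simp: norm_mult\<close>)
  then show ?thesis using assms by (simp add: ft_def distrib_right)
qed

context cutoff
begin

text \<open>The bound of \<open>tt_star\<close> is independent of the scale, so the boxes may
  exhaust the space by monotone convergence. Position and frequency exchange roles, and conjugation
  turns the kernel of \<open>ft\<close> into that of \<open>tt_star\<close>.\<close>

lemma plancherel_le:
  fixes g :: "real^'n \<Rightarrow> complex"
  assumes g: "integrable lborel g"
  shows "(\<integral>\<^sup>+\<xi>. ennreal ((norm (ft g \<xi>))\<^sup>2) \<partial>lborel) \<le> ennreal CT * (\<integral>\<^sup>+y. ennreal ((norm (g y))\<^sup>2) \<partial>lborel)"
proof -
  have [measurable]: "g \<in> borel_measurable borel" using borel_measurable_integrable[OF g] by simp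
  define u where "u \<xi> = ennreal ((norm (ft g \<xi>))\<^sup>2)" for \<xi>
  have [measurable]: "u \<in> borel_measurable borel" unfolding u_def by measurable
  define v where "v m \<xi> = u \<xi> * indicator (sqbox 0 (real (Suc m))) \<xi>" for m \<xi>
  have eq: "ft g \<xi> = cnj (\<integral>y. 1 * cnj (g y) * ch \<xi> y \<partial>lborel)" for \<xi>
    unfolding ft_def by (subst Bochner_Integration.integral_cnj[symmetric]) (simp add: ch_commute[of \<xi>])
  have le: "integral\<^sup>N lborel (v m) \<le> ennreal CT * (\<integral>\<^sup>+y. ennreal ((norm (g y))\<^sup>2) \<partial>lborel)" for m
  proof -
    have "(\<integral>\<^sup>+\<xi>. ennreal ((norm (\<integral>y. 1 * cnj (g y) * ch \<xi> y \<partial>lborel))\<^sup>2) * indicator (sqbox 0 (real (Suc m))) \<xi> \<partial>lborel)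
       \<le> ennreal (CT * 1\<^sup>2) * (\<integral>\<^sup>+y. ennreal ((norm (cnj (g y)))\<^sup>2) \<partial>lborel)"
      by (rule tt_star[where \<gamma>="\<lambda>i k x \<xi>. if k = 0 then 1 else 0"])
         (use g in \<open>auto simp: tower_def\<close>)
    then show ?thesis by (simp add: v_def[abs_def] u_def eq del: of_nat_Suc)
  qed
  have inc: "incseq v"
  proof (intro incseq_SucI le_funI)
    fix m \<xi>
    have "sqbox 0 (real (Suc m)) \<subseteq> sqbox (0::real^'n) (real (Suc (Suc m)))"
      unfolding sqbox_def using of_nat_le_iff[of "Suc m" "Suc (Suc m)"] by (auto intro: order_trans)
    then show "v m \<xi> \<le> v (Suc m) \<xi>" by (auto simp: v_def indicator_def)
  qed
  have "(SUP m. v m \<xi>) = u \<xi>" for \<xi>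
  proof (rule antisym)
    show "(SUP m. v m \<xi>) \<le> u \<xi>" by (rule SUP_least) (auto simp: v_def indicator_def)
    obtain m where m: "norm \<xi> \<le> real m" using real_arch_simple by blast
    have "\<bar>\<xi> $ i\<bar> \<le> real (Suc m)" for i using component_le_norm_cart[of \<xi> i] m by simp
    then have "v m \<xi> = u \<xi>" by (simp add: v_def sqbox_def)
    then show "u \<xi> \<le> (SUP m. v m \<xi>)" by (metis SUP_upper UNIV_I)
  qed
  then have "integral\<^sup>N lborel u = (\<integral>\<^sup>+\<xi>. (SUP m. v m \<xi>) \<partial>lborel)" by simp
  also have "\<dots> = (SUP m. integral\<^sup>N lborel (v m))"
    by (rule nn_integral_monotone_convergence_SUP[OF inc]) (simp add: v_def[abs_def])
  also have "\<dots> \<le> ennreal CT * (\<integral>\<^sup>+y. ennreal ((norm (g y))\<^sup>2) \<partial>lborel)" by (rule SUP_least[OF le])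
  finally show ?thesis by (simp add: u_def[abs_def])
qed

text \<open>Origin: (u + v)^2 <= 2 u^2 + 2 v^2, with \<open>CT\<close> from Plancherel on the
  bounded part of g and 2^n from the volume (2 R)^n of the frequency box.\<close>

definition CB :: real where "CB = 2 * CT + 2 * 2 ^ CARD('n)"

lemma CB_pos: "0 < CB"
  using CT_nonneg by (auto simp: CB_def intro!: add_nonneg_pos)

text \<open>Splitting at height \<open>(R\<^sup>n X)\<^bsup>1/r\<^esup>\<close> replaces the Hausdorff-Young inequality.\<close>
lemma bernstein_l2:
  fixes g :: "real^'n \<Rightarrow> complex"
  assumes g: "integrable lborel g" and r: "1 < r" "r \<le> 2" and R: "0 < R" and X: "0 < X"
    and gX: "(\<integral>\<^sup>+y. ennreal (norm (g y) powr r) \<partial>lborel) \<le> ennreal X"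
  shows "(\<integral>\<^sup>+\<xi>. ennreal ((norm (ft g \<xi>))\<^sup>2) * indicator (sqbox 0 R) \<xi> \<partial>lborel)
     \<le> ennreal (CB * (R ^ CARD('n)) powr (2 / r - 1) * X powr (2 / r))"
proof -
  let ?n = "CARD('n)"
  have [measurable]: "g \<in> borel_measurable borel" using borel_measurable_integrable[OF g] by simp
  define Y where "Y = R ^ ?n * X"
  have Y: "0 < Y" using R X by (simp add: Y_def)
  define l where "l = Y powr (1 / r)"
  have l: "0 < l" using Y by (simp add: l_def)
  define g1 where "g1 y = (if norm (g y) \<le> l then g y else 0)" for y
  define g2 where "g2 y = (if norm (g y) \<le> l then 0 else g y)" for y
  have [measurable]: "g1 \<in> borel_measurable borel" "g2 \<in> borel_measurable borel"
    unfolding g1_def g2_def by measurable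
  have i1: "integrable lborel g1" by (rule Bochner_Integration.integrable_bound[OF g]) (auto simp: g1_def)
  have i2: "integrable lborel g2" by (rule Bochner_Integration.integrable_bound[OF g]) (auto simp: g2_def)
  have split: "ft g \<xi> = ft g1 \<xi> + ft g2 \<xi>" for \<xi>
  proof -
    have "g = (\<lambda>y. g1 y + g2 y)" by (auto simp: g1_def g2_def)
    then show ?thesis using ft_add[OF i1 i2, of \<xi>] by simp
  qed
  have n1: "(norm (g1 y))\<^sup>2 \<le> l powr (2 - r) * norm (g y) powr r" for y
  proof (cases "norm (g y) \<le> l \<and> g y \<noteq> 0")
    case True
    then have "(norm (g1 y))\<^sup>2 = norm (g y) powr (2 - r) * norm (g y) powr r"
      by (simp add: g1_def powr_add[symmetric])
    also have "\<dots> \<le> l powr (2 - r) * norm (g y) powr r"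
      using True r by (intro mult_right_mono powr_mono2) auto
    finally show ?thesis .
  qed (auto simp: g1_def)
  have n2: "norm (g2 y) \<le> l powr (1 - r) * norm (g y) powr r" for y
  proof (cases "norm (g y) \<le> l")
    case False
    then have gy: "0 < norm (g y)" using l by linarith
    have "norm (g2 y) = norm (g y) powr (1 - r) * norm (g y) powr r"
      using False gy by (simp add: g2_def powr_add[symmetric])
    also have "\<dots> \<le> l powr (1 - r) * norm (g y) powr r"
      using False r l by (intro mult_right_mono powr_mono2') auto
    finally show ?thesis .
  qed (auto simp: g2_def)
  \<comment> \<open>The part of g below height l is square integrable, since |g1|^2 <= l^(2-r)
    |g|^r, and Plancherel applies to it.\<close>
  have A1: "(\<integral>\<^sup>+\<xi>. ennreal ((norm (ft g1 \<xi>))\<^sup>2) \<partial>lborel) \<le> ennreal (CT * (l powr (2 - r) * X))"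
  proof -
    have "(\<integral>\<^sup>+y. ennreal ((norm (g1 y))\<^sup>2) \<partial>lborel) \<le> (\<integral>\<^sup>+y. ennreal (l powr (2 - r)) * ennreal (norm (g y) powr r) \<partial>lborel)"
      by (intro nn_integral_mono) (auto simp: ennreal_mult'[symmetric] intro!: ennreal_leI n1)
    also have "\<dots> = ennreal (l powr (2 - r)) * (\<integral>\<^sup>+y. ennreal (norm (g y) powr r) \<partial>lborel)"
      by (rule nn_integral_cmult) simp
    also have "\<dots> \<le> ennreal (l powr (2 - r)) * ennreal X" using gX by (rule mult_left_mono) simp
    finally have "(\<integral>\<^sup>+y. ennreal ((norm (g1 y))\<^sup>2) \<partial>lborel) \<le> ennreal (l powr (2 - r) * X)"
      by (simp add: ennreal_mult')
    then have "ennreal CT * (\<integral>\<^sup>+y. ennreal ((norm (g1 y))\<^sup>2) \<partial>lborel) \<le> ennreal CT * ennreal (l powr (2 - r) * X)"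
      by (rule mult_left_mono) simp
    also have "\<dots> = ennreal (CT * (l powr (2 - r) * X))" using CT_nonneg by (simp add: ennreal_mult')
    finally show ?thesis using plancherel_le[OF i1] by (rule order_trans[rotated])
  qed
  \<comment> \<open>The part above height l has a controlled L^1 norm, which bounds its transform
    pointwise; the frequency box then contributes only its volume.\<close>
  have A2: "norm (ft g2 \<xi>) \<le> l powr (1 - r) * X" for \<xi>
  proof -
    have "ennreal (norm (ft g2 \<xi>)) \<le> (\<integral>\<^sup>+y. ennreal (norm (g2 y)) \<partial>lborel)" by (rule ennreal_norm_ft_le)
    also have "\<dots> \<le> (\<integral>\<^sup>+y. ennreal (l powr (1 - r)) * ennreal (norm (g y) powr r) \<partial>lborel)"
      by (intro nn_integral_mono) (auto simp: ennreal_mult'[symmetric] intro!: ennreal_leI n2)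
    also have "\<dots> = ennreal (l powr (1 - r)) * (\<integral>\<^sup>+y. ennreal (norm (g y) powr r) \<partial>lborel)"
      by (rule nn_integral_cmult) simp
    also have "\<dots> \<le> ennreal (l powr (1 - r)) * ennreal X" using gX by (rule mult_left_mono) simp
    also have "\<dots> = ennreal (l powr (1 - r) * X)" by (simp add: ennreal_mult')
    finally show ?thesis using X by (simp add: ennreal_le_iff)
  qed
  define e where "e = (l powr (1 - r) * X)\<^sup>2"
  have pt: "ennreal ((norm (ft g \<xi>))\<^sup>2) * indicator (sqbox 0 R) \<xi>
      \<le> 2 * ennreal ((norm (ft g1 \<xi>))\<^sup>2) + ennreal (2 * e) * indicator (sqbox 0 R) \<xi>" for \<xi>
  proof (cases "\<xi> \<in> sqbox 0 R")
    case True
    have "(norm (ft g \<xi>))\<^sup>2 \<le> (norm (ft g1 \<xi>) + norm (ft g2 \<xi>))\<^sup>2"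
      unfolding split by (intro power_mono norm_triangle_ineq) simp
    also have "\<dots> \<le> 2 * (norm (ft g1 \<xi>))\<^sup>2 + 2 * (norm (ft g2 \<xi>))\<^sup>2"
      using sum_squares_bound[of "norm (ft g1 \<xi>)" "norm (ft g2 \<xi>)"] by (simp add: power2_sum)
    also have "(norm (ft g2 \<xi>))\<^sup>2 \<le> e" unfolding e_def by (intro power_mono A2) simp
    finally have "ennreal ((norm (ft g \<xi>))\<^sup>2) \<le> ennreal (2 * (norm (ft g1 \<xi>))\<^sup>2 + 2 * e)"
      by (intro ennreal_leI) simp
    also have "\<dots> = 2 * ennreal ((norm (ft g1 \<xi>))\<^sup>2) + ennreal (2 * e)"
      by (simp add: ennreal_mult' e_def)
    finally show ?thesis using True by simp
  qed simp
  have "(\<integral>\<^sup>+\<xi>. ennreal ((norm (ft g \<xi>))\<^sup>2) * indicator (sqbox 0 R) \<xi> \<partial>lborel)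
     \<le> (\<integral>\<^sup>+\<xi>. 2 * ennreal ((norm (ft g1 \<xi>))\<^sup>2) + ennreal (2 * e) * indicator (sqbox 0 R) \<xi> \<partial>lborel)"
    by (rule nn_integral_mono[OF pt])
  also have "\<dots> = 2 * (\<integral>\<^sup>+\<xi>. ennreal ((norm (ft g1 \<xi>))\<^sup>2) \<partial>lborel) + ennreal (2 * e) * ennreal ((2 * R) ^ ?n)"
    using R by (simp add: nn_integral_add nn_integral_cmult nn_integral_cmult_indicator emeasure_sqbox)
  also have "\<dots> \<le> 2 * ennreal (CT * (l powr (2 - r) * X)) + ennreal (2 * e) * ennreal ((2 * R) ^ ?n)"
    by (intro add_right_mono mult_left_mono A1) simp
  also have "\<dots> = ennreal (2 * (CT * (l powr (2 - r) * X)) + 2 * e * (2 * R) ^ ?n)"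
    using CT_nonneg X R by (simp add: ennreal_mult' e_def)
  also have "2 * (CT * (l powr (2 - r) * X)) + 2 * e * (2 * R) ^ ?n = CB * (Y powr (2 / r - 1) * X)"
  proof -
    have "l powr (2 - r) = Y powr (2 / r - 1)"
      using r by (simp add: l_def powr_powr field_simps)
    moreover have "e * (2 * R) ^ ?n = 2 ^ ?n * (Y powr (2 / r - 1) * X)"
    proof -
      have "(l powr (1 - r))\<^sup>2 = Y powr (2 / r - 2)"
        using r Y by (simp add: l_def powr_powr power2_eq_square powr_add[symmetric] diff_divide_distrib add_divide_distrib[symmetric])
      then have "e * (2 * R) ^ ?n = 2 ^ ?n * (Y powr (2 / r - 2) * Y * X)"
        by (simp add: e_def power_mult_distrib Y_def power2_eq_square mult_ac)
      also have "Y powr (2 / r - 2) * Y = Y powr (2 / r - 1)"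
        using powr_add[of Y "2 / r - 2" 1] Y by simp
      finally show ?thesis .
    qed
    ultimately show ?thesis by (simp add: CB_def algebra_simps)
  qed
  also have "Y powr (2 / r - 1) * X = (R ^ ?n) powr (2 / r - 1) * X powr (2 / r)"
  proof -
    have "X powr (2 / r - 1) * X = X powr (2 / r)" using powr_add[of X "2 / r - 1" 1] X by simp
    then show ?thesis using R X by (simp add: Y_def powr_mult)
  qed
  finally show ?thesis by (simp add: mult_ac)
qed

text \<open>Cauchy-Schwarz on the box in the form t <= t^2/D + D. Up to constants, \<open>D\<close>
  is the root mean square over the box that \<open>bernstein_l2\<close> allows for the transform,
  which balances the two terms.\<close>

lemma bernstein_l1:
  fixes g :: "real^'n \<Rightarrow> complex"
  assumes g: "integrable lborel g" and r: "1 < r" "r \<le> 2" and R: "0 < R" and X: "0 < X"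
    and gX: "(\<integral>\<^sup>+y. ennreal (norm (g y) powr r) \<partial>lborel) \<le> ennreal X"
  shows "(\<integral>\<^sup>+\<xi>. ennreal (norm (ft g \<xi>)) * indicator (sqbox 0 R) \<xi> \<partial>lborel)
     \<le> ennreal ((CB + 2 ^ CARD('n)) * (R ^ CARD('n)) powr (1 / r) * X powr (1 / r))"
proof -
  let ?n = "CARD('n)"
  have [measurable]: "g \<in> borel_measurable borel" using borel_measurable_integrable[OF g] by simp
  define N where "N = R ^ ?n"
  have N: "0 < N" using R by (simp add: N_def)
  define D where "D = N powr (1 / r - 1) * X powr (1 / r)"
  have D: "0 < D" using N X by (simp add: D_def)
  define A where "A = CB * N powr (2 / r - 1) * X powr (2 / r)"
  have A0: "0 \<le> A" using CB_pos by (simp add: A_def)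
  have pt: "ennreal (norm (ft g \<xi>)) * indicator (sqbox 0 R) \<xi>
      \<le> ennreal (1 / D) * (ennreal ((norm (ft g \<xi>))\<^sup>2) * indicator (sqbox 0 R) \<xi>) + ennreal D * indicator (sqbox 0 R) \<xi>" for \<xi>
  proof (cases "\<xi> \<in> sqbox 0 R")
    case True
    define t where "t = norm (ft g \<xi>)"
    have "2 * t * D \<le> t\<^sup>2 + D\<^sup>2" using sum_squares_bound[of t D] by simp
    moreover have "0 \<le> t * D" using D by (simp add: t_def)
    ultimately have "t * D \<le> t\<^sup>2 + D\<^sup>2" by linarith
    then have "t \<le> 1 / D * t\<^sup>2 + D" using D by (simp add: field_simps power2_eq_square)
    then have "ennreal t \<le> ennreal (1 / D * t\<^sup>2 + D)" by (rule ennreal_leI)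
    also have "\<dots> = ennreal (1 / D) * ennreal (t\<^sup>2) + ennreal D"
      using D by (simp add: ennreal_mult'[symmetric])
    finally show ?thesis using True by (simp add: t_def)
  qed simp
  have "(\<integral>\<^sup>+\<xi>. ennreal (norm (ft g \<xi>)) * indicator (sqbox 0 R) \<xi> \<partial>lborel)
     \<le> (\<integral>\<^sup>+\<xi>. ennreal (1 / D) * (ennreal ((norm (ft g \<xi>))\<^sup>2) * indicator (sqbox 0 R) \<xi>) + ennreal D * indicator (sqbox 0 R) \<xi> \<partial>lborel)"
    by (rule nn_integral_mono[OF pt])
  also have "\<dots> = ennreal (1 / D) * (\<integral>\<^sup>+\<xi>. ennreal ((norm (ft g \<xi>))\<^sup>2) * indicator (sqbox 0 R) \<xi> \<partial>lborel) + ennreal D * ennreal ((2 * R) ^ ?n)"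
    using R by (simp add: nn_integral_add nn_integral_cmult nn_integral_cmult_indicator emeasure_sqbox)
  also have "\<dots> \<le> ennreal (1 / D) * ennreal A + ennreal D * ennreal ((2 * R) ^ ?n)"
    using bernstein_l2[OF assms] unfolding A_def N_def by (intro add_right_mono mult_left_mono) auto
  also have "\<dots> = ennreal (1 / D * A + D * (2 * R) ^ ?n)"
    using D A0 R by (simp add: ennreal_mult'[symmetric] ennreal_plus[symmetric] del: ennreal_plus)
  also have "1 / D * A + D * (2 * R) ^ ?n = (CB + 2 ^ ?n) * N powr (1 / r) * X powr (1 / r)"
  proof -
    have "N powr (2 / r - 1) = N powr (1 / r - 1) * N powr (1 / r)" "X powr (2 / r) = X powr (1 / r) * X powr (1 / r)"
      by (simp_all add: powr_add[symmetric])
    then have "A = D * (CB * N powr (1 / r) * X powr (1 / r))" by (simp add: A_def D_def mult_ac)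
    then have 1: "1 / D * A = CB * N powr (1 / r) * X powr (1 / r)" using D by simp
    have "N powr (1 / r - 1) * N = N powr (1 / r)" using powr_add[of N "1 / r - 1" 1] N by simp
    then have "D * (2 * R) ^ ?n = 2 ^ ?n * N powr (1 / r) * X powr (1 / r)"
      by (simp add: D_def power_mult_distrib N_def[symmetric] mult_ac)
    with 1 show ?thesis by (simp add: algebra_simps)
  qed
  finally show ?thesis by (simp add: N_def)
qed

end

section \<open>Kernels and localisation by the weight\<close>

text \<open>The symbol is frozen at one point: the operator with symbol a sends f to
  \<open>\<lambda>x. op (a x) f x\<close>. By \<open>op_eq_ker\<close> a frozen symbol acts by
  convolution with \<open>ker\<close>.\<close>

definition op :: "(real^'n \<Rightarrow> complex) \<Rightarrow> (real^'n \<Rightarrow> complex) \<Rightarrow> real^'n \<Rightarrow> complex" where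
  "op \<beta> g x = (\<integral>\<xi>. \<beta> \<xi> * ft g \<xi> * ch x \<xi> \<partial>lborel)"

definition ker :: "(real^'n \<Rightarrow> complex) \<Rightarrow> real^'n \<Rightarrow> complex" where
  "ker \<beta> z = (\<integral>\<xi>. \<beta> \<xi> * ch \<xi> z \<partial>lborel)"

lemma integrable_box:
  fixes \<beta> :: "real^'n \<Rightarrow> complex"
  assumes [measurable]: "\<beta> \<in> borel_measurable borel"
    and "\<And>\<xi>. norm (\<beta> \<xi>) \<le> D" "\<And>\<xi>. \<xi> \<notin> sqbox c R \<Longrightarrow> \<beta> \<xi> = 0"
  shows "integrable lborel \<beta>"
proof (rule Bochner_Integration.integrable_bound)
  show "integrable lborel (\<lambda>\<xi>. D * indicator (sqbox c R) \<xi>)"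
    using integrable_indicator_sqbox[of c R] by simp
  have "norm (\<beta> \<xi>) \<le> norm (D * indicator (sqbox c R) \<xi>)" for \<xi>
    using assms(2)[of \<xi>] assms(3)[of \<xi>] by (cases "\<xi> \<in> sqbox c R") auto
  then show "AE \<xi> in lborel. norm (\<beta> \<xi>) \<le> norm (D * indicator (sqbox c R) \<xi>)" by simp
qed simp

lemma borel_measurable_ker [measurable]:
  assumes [measurable]: "\<beta> \<in> borel_measurable borel"
  shows "ker \<beta> \<in> borel_measurable borel"
  unfolding ker_def[abs_def] by measurable

lemma norm_ker_le: "norm (ker \<beta> z) \<le> (\<integral>\<xi>. norm (\<beta> \<xi>) \<partial>lborel)"
  unfolding ker_def by (rule order_trans[OF integral_norm_bound]) (simp add: norm_mult)

lemma integrable_mult_ker: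
  fixes g :: "real^'n \<Rightarrow> complex"
  assumes g: "integrable lborel g" and [measurable]: "\<beta> \<in> borel_measurable borel"
  shows "integrable lborel (\<lambda>y. g y * ker \<beta> (x - y))"
proof (rule Bochner_Integration.integrable_bound)
  let ?I = "\<integral>\<xi>. norm (\<beta> \<xi>) \<partial>lborel"
  show "integrable lborel (\<lambda>y. norm (g y) * ?I)" using g by simp
  have [measurable]: "g \<in> borel_measurable borel" using borel_measurable_integrable[OF g] by simp
  show "(\<lambda>y. g y * ker \<beta> (x - y)) \<in> borel_measurable lborel" by measurable
  have "0 \<le> ?I" by simp
  then show "AE y in lborel. norm (g y * ker \<beta> (x - y)) \<le> norm (norm (g y) * ?I)"
    by (auto simp: norm_mult abs_mult intro!: mult_left_mono norm_ker_le)
qed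

lemma op_eq_ker:
  fixes g :: "real^'n \<Rightarrow> complex"
  assumes \<beta>: "integrable lborel \<beta>" and g: "integrable lborel g"
  shows "op \<beta> g x = (\<integral>y. g y * ker \<beta> (x - y) \<partial>lborel)"
proof -
  have [measurable]: "g \<in> borel_measurable borel" "\<beta> \<in> borel_measurable borel"
    using borel_measurable_integrable[OF g] borel_measurable_integrable[OF \<beta>] by simp_all
  define h where "h \<xi> y = \<beta> \<xi> * g y * ch \<xi> (x - y)" for \<xi> y
  have "integrable (lborel \<Otimes>\<^sub>M lborel) (\<lambda>(\<xi>, y). \<beta> \<xi> * g y)"
    by (rule integrable_lborel_pair_mult[OF \<beta> g])
  then have int: "integrable (lborel \<Otimes>\<^sub>M lborel) (\<lambda>(\<xi>, y). h \<xi> y)"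
    by (rule Bochner_Integration.integrable_bound) (auto simp: h_def norm_mult)
  have chd: "ch \<xi> (x - y) = cnj (ch y \<xi>) * ch x \<xi>" for \<xi> y
    using ch_add_right[of \<xi> x "- y"] by (simp add: ch_uminus ch_commute mult.commute)
  have "op \<beta> g x = (\<integral>\<xi>. \<integral>y. h \<xi> y \<partial>lborel \<partial>lborel)"
  proof -
    have "\<beta> \<xi> * ft g \<xi> * ch x \<xi> = (\<integral>y. h \<xi> y \<partial>lborel)" for \<xi>
    proof -
      have "h \<xi> y = \<beta> \<xi> * ch x \<xi> * (g y * cnj (ch y \<xi>))" for y by (simp add: h_def chd mult_ac)
      then have "(\<integral>y. h \<xi> y \<partial>lborel) = \<beta> \<xi> * ch x \<xi> * (\<integral>y. g y * cnj (ch y \<xi>) \<partial>lborel)"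
        by simp
      then show ?thesis by (simp add: ft_def mult_ac)
    qed
    then show ?thesis by (simp add: op_def)
  qed
  also have "\<dots> = (\<integral>y. \<integral>\<xi>. h \<xi> y \<partial>lborel \<partial>lborel)"
    by (rule lborel_pair.Fubini_integral[OF int, symmetric])
  also have "\<dots> = (\<integral>y. g y * ker \<beta> (x - y) \<partial>lborel)"
  proof -
    have "h \<xi> y = g y * (\<beta> \<xi> * ch \<xi> (x - y))" for \<xi> y by (simp add: h_def mult_ac)
    then show ?thesis by (simp add: ker_def)
  qed
  finally show ?thesis .
qed

definition loc :: "real \<Rightarrow> real^'n \<Rightarrow> (real^'n \<Rightarrow> complex) \<Rightarrow> real^'n \<Rightarrow> complex" where
  "loc s c f y = f y * of_real (wt ((1 / s) *\<^sub>R (y - c)))"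

lemma integrable_loc:
  assumes f: "integrable lborel f" shows "integrable lborel (loc s c f)"
proof (rule Bochner_Integration.integrable_bound[OF f])
  have [measurable]: "f \<in> borel_measurable borel" using borel_measurable_integrable[OF f] by simp
  show "loc s c f \<in> borel_measurable lborel" unfolding loc_def[abs_def] by measurable
  have "norm (loc s c f y) \<le> norm (f y) * 1" for y
    unfolding loc_def norm_mult 
    using wt_pos[of "(1 / s) *\<^sub>R (y - c)"] wt_le_1[of "(1 / s) *\<^sub>R (y - c)"] by (intro mult_left_mono) auto
  then show "AE y in lborel. norm (loc s c f y) \<le> norm (f y)" by simp
qed

text \<open>Since \<open>wt\<close> is at most 1, its r-th power is bounded by \<open>wt\<close>
  itself; the weighted norm thus becomes linear in the weight and can be averaged over c.\<close>

lemma norm_loc_powr_le: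
  assumes "1 \<le> r"
  shows "norm (loc s c f y) powr r \<le> norm (f y) powr r * wt ((1 / s) *\<^sub>R (y - c))"
proof -
  let ?w = "wt ((1 / s) *\<^sub>R (y - c))"
  have w: "0 < ?w" "?w \<le> 1" by (auto simp: wt_pos wt_le_1)
  have "?w powr r \<le> ?w powr 1" using w assms by (intro powr_mono') auto
  then have "norm (f y) powr r * ?w powr r \<le> norm (f y) powr r * ?w"
    using w by (intro mult_left_mono) auto
  then show ?thesis using w by (simp add: loc_def norm_mult powr_mult)
qed

text \<open>Expanding \<open>((y\<^sub>i - c\<^sub>i) / s)\<^sup>K\<close> around \<open>x\<^sub>i\<close> moves the weight onto frequency derivatives of the symbol.\<close>
lemma op_localise:
  fixes \<beta> :: "'n::finite \<Rightarrow> nat \<Rightarrow> real^'n \<Rightarrow> complex" and f :: "real^'n \<Rightarrow> complex"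
  defines "K \<equiv> 4 * CARD('n)"
  assumes s: "0 < s" and f: "integrable lborel f"
    and tow: "\<And>i. tower K (axis i 1) (\<lambda>l \<xi>. of_real (s ^ l) * \<beta> i l \<xi>)"
    and meas: "\<And>i l. l \<le> K \<Longrightarrow> \<beta> i l \<in> borel_measurable borel"
    and bd: "\<And>i l \<xi>. l \<le> K \<Longrightarrow> norm (\<beta> i l \<xi>) \<le> B"
    and supp: "\<And>i l \<xi>. l \<le> K \<Longrightarrow> \<xi> \<notin> sqbox 0 R \<Longrightarrow> \<beta> i l \<xi> = 0"
    and \<beta>0: "\<And>i \<xi>. \<beta> i 0 \<xi> = a \<xi>"
  shows "op a f x = op a (loc s c f) x + (\<Sum>i\<in>UNIV. \<Sum>l\<le>K. of_nat (K choose l) *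
      of_real (((x $ i - c $ i) / s) ^ (K - l)) * (1 / (2 * pi * \<i>)) ^ l * op (\<beta> i l) (loc s c f) x)"
proof -
  let ?g = "loc s c f"
  have g: "integrable lborel ?g" by (rule integrable_loc[OF f])
  have [measurable]: "\<beta> i l \<in> borel_measurable borel" if "l \<le> K" for i l by (rule meas[OF that])
  have B0: "0 \<le> B" using bd[of 0 undefined undefined] norm_ge_zero order_trans by blast
  have \<beta>i: "integrable lborel (\<beta> i l)" if "l \<le> K" for i l
    by (rule integrable_box[OF meas bd supp]) (use that in auto)
  have a_eq: "a = \<beta> i 0" for i by (auto simp: \<beta>0)
  have ai: "integrable lborel a" unfolding a_eq[of undefined] by (rule \<beta>i) simp
  have am: "a \<in> borel_measurable borel" unfolding a_eq[of undefined] by (rule meas) simp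
  \<comment> \<open>\<open>\<beta> i l\<close> is s^(-l) times the l-th derivative of a along axis
    i, so each integration by parts yields a power of z_i / s.\<close>
  have ker_\<beta>: "ker (\<beta> i l) z = (- (2 * pi * \<i> * of_real (z $ i / s))) ^ l * ker a z" if "l \<le> K" for i l z
  proof -
    have "(\<integral>\<xi>. of_real (s ^ l) * \<beta> i l \<xi> * ch \<xi> z \<partial>lborel)
       = (- (2 * pi * \<i> * of_real (z $ i))) ^ l * (\<integral>\<xi>. of_real (s ^ 0) * \<beta> i 0 \<xi> * ch \<xi> z \<partial>lborel)"
    proof (rule tower_integral_ch_box[OF tow, where D="max 1 s ^ K * B" and c=0 and l=R])
      fix l \<xi> assume l: "l \<le> K"
      have "s ^ l \<le> max 1 s ^ l" using s by (intro power_mono) auto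
      also have "\<dots> \<le> max 1 s ^ K" using l by (intro power_increasing) auto
      finally show "norm (of_real (s ^ l) * \<beta> i l \<xi>) \<le> max 1 s ^ K * B"
        unfolding norm_mult using bd[OF l, of i \<xi>] B0 s by (intro mult_mono) (auto simp: norm_power)
    qed (use supp that in auto)
    then have "of_real (s ^ l) * ker (\<beta> i l) z = (- (2 * pi * \<i> * of_real (z $ i))) ^ l * ker a z"
      by (simp add: ker_def \<beta>0 mult.assoc)
    moreover have "(- (2 * pi * \<i> * of_real (z $ i / s))) ^ l = (- (2 * pi * \<i> * of_real (z $ i))) ^ l / of_real (s ^ l)"
      by (simp add: power_divide[symmetric])
    moreover have "p \<noteq> 0 \<Longrightarrow> p * k = A * q \<Longrightarrow> k = A / p * q" for p k A q :: complex
      by (simp add: field_simps)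
    moreover have "complex_of_real (s ^ l) \<noteq> 0" using s by simp
    ultimately show ?thesis by (simp only:)
  qed
  \<comment> \<open>Coefficients in the expansion of ((y_i - c_i)/s)^K as ((x_i - c_i)/s - (x_i -
    y_i)/s)^K; the power of 1/(2 \<pi> i) undoes the constant produced by
    \<open>ker_\<beta>\<close>.\<close>
  define co where "co i l = of_nat (K choose l) * of_real (((x $ i - c $ i) / s) ^ (K - l)) * (1 / (2 * pi * \<i>)) ^ l" for i l
  have pt: "f y * ker a (x - y) = ?g y * ker a (x - y) + (\<Sum>i\<in>UNIV. \<Sum>l\<le>K. co i l * (?g y * ker (\<beta> i l) (x - y)))" for y
  proof -
    have "(\<Sum>l\<le>K. co i l * ker (\<beta> i l) (x - y)) = of_real (((y $ i - c $ i) / s) ^ K) * ker a (x - y)" for i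
    proof -
      have "co i l * ker (\<beta> i l) (x - y) = of_real (of_nat (K choose l) * ((- ((x - y) $ i) / s) ^ l) * (((x $ i - c $ i) / s) ^ (K - l))) * ker a (x - y)"
        if "l \<le> K" for l
      proof -
        have "(1 / (2 * pi * \<i>)) ^ l * (- (2 * pi * \<i> * of_real ((x - y) $ i / s))) ^ l = of_real ((- ((x - y) $ i) / s) ^ l)"
          by (simp add: power_mult_distrib[symmetric] del: of_real_diff vector_minus_component)
        then have *: "(1 / (2 * pi * \<i>)) ^ l * ((- (2 * pi * \<i> * of_real ((x - y) $ i / s))) ^ l * ker a (x - y)) = of_real ((- ((x - y) $ i) / s) ^ l) * ker a (x - y)"
          by (simp only: mult.assoc[symmetric])
        have "co i l * ker (\<beta> i l) (x - y) = of_nat (K choose l) * of_real (((x $ i - c $ i) / s) ^ (K - l)) *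
            ((1 / (2 * pi * \<i>)) ^ l * ((- (2 * pi * \<i> * of_real ((x - y) $ i / s))) ^ l * ker a (x - y)))"
          unfolding co_def ker_\<beta>[OF that] by (rule mult.assoc)
        then show ?thesis unfolding * by (simp only: of_real_mult of_real_of_nat_eq mult_ac)
      qed
      then have "(\<Sum>l\<le>K. co i l * ker (\<beta> i l) (x - y)) = of_real (\<Sum>l\<le>K. of_nat (K choose l) * ((- ((x - y) $ i) / s) ^ l) * (((x $ i - c $ i) / s) ^ (K - l))) * ker a (x - y)"
        by (simp only: of_real_sum sum_distrib_right) (rule sum.cong, auto)
      also have "(\<Sum>l\<le>K. of_nat (K choose l) * ((- ((x - y) $ i) / s) ^ l) * (((x $ i - c $ i) / s) ^ (K - l)))
          = (- ((x - y) $ i) / s + (x $ i - c $ i) / s) ^ K"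
        by (simp only: binomial_ring)
      also have "- ((x - y) $ i) / s + (x $ i - c $ i) / s = (y $ i - c $ i) / s"
        by (simp add: add_divide_distrib[symmetric])
      finally show ?thesis .
    qed
    then have "(\<Sum>i\<in>UNIV. \<Sum>l\<le>K. co i l * (?g y * ker (\<beta> i l) (x - y)))
       = ?g y * (of_real (\<Sum>i\<in>UNIV. ((y $ i - c $ i) / s) ^ K) * ker a (x - y))"
      by (simp add: sum_distrib_left[symmetric] sum_distrib_right[symmetric] mult.left_commute[of _ "?g y"])
    \<comment> \<open>Dividing by the weight is multiplication by a polynomial, the reason for
      choosing \<open>wt\<close> as the reciprocal of one.\<close>
    moreover have "f y = ?g y * of_real (1 + (\<Sum>i\<in>UNIV. ((y $ i - c $ i) / s) ^ K))"
    proof -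
      have "wt ((1 / s) *\<^sub>R (y - c)) * (1 + (\<Sum>i\<in>UNIV. ((y $ i - c $ i) / s) ^ K)) = 1"
        using wt_inverse[of "(1 / s) *\<^sub>R (y - c)"] by (simp add: K_def)
      then show ?thesis unfolding loc_def mult.assoc of_real_mult[symmetric] by simp
    qed
    ultimately show ?thesis by (simp add: algebra_simps)
  qed
  have gi: "integrable lborel (\<lambda>y. co i l * (?g y * ker (\<beta> i l) (x - y)))" if "l \<le> K" for i l
    using integrable_mult_ker[OF g meas[OF that]] by simp
  have "op a f x = (\<integral>y. f y * ker a (x - y) \<partial>lborel)" by (rule op_eq_ker[OF ai f])
  also have "\<dots> = (\<integral>y. ?g y * ker a (x - y) \<partial>lborel)
      + (\<integral>y. (\<Sum>i\<in>UNIV. \<Sum>l\<le>K. co i l * (?g y * ker (\<beta> i l) (x - y))) \<partial>lborel)"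
    unfolding pt by (intro Bochner_Integration.integral_add integrable_mult_ker[OF g am]
        Bochner_Integration.integrable_sum gi) auto
  also have "(\<integral>y. (\<Sum>i\<in>UNIV. \<Sum>l\<le>K. co i l * (?g y * ker (\<beta> i l) (x - y))) \<partial>lborel)
      = (\<Sum>i\<in>UNIV. \<Sum>l\<le>K. co i l * (\<integral>y. ?g y * ker (\<beta> i l) (x - y) \<partial>lborel))"
  proof -
    have "(\<integral>y. (\<Sum>i\<in>UNIV. \<Sum>l\<le>K. co i l * (?g y * ker (\<beta> i l) (x - y))) \<partial>lborel)
       = (\<Sum>i\<in>UNIV. \<integral>y. (\<Sum>l\<le>K. co i l * (?g y * ker (\<beta> i l) (x - y))) \<partial>lborel)"
      by (rule Bochner_Integration.integral_sum) (intro Bochner_Integration.integrable_sum gi, simp)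
    also have "\<dots> = (\<Sum>i\<in>UNIV. \<Sum>l\<le>K. \<integral>y. co i l * (?g y * ker (\<beta> i l) (x - y)) \<partial>lborel)"
      by (intro sum.cong refl Bochner_Integration.integral_sum gi) simp
    finally show ?thesis by simp
  qed
  also have "\<dots> = (\<Sum>i\<in>UNIV. \<Sum>l\<le>K. co i l * op (\<beta> i l) ?g x)"
    by (intro sum.cong refl) (simp add: op_eq_ker[OF \<beta>i g])
  also have "(\<integral>y. ?g y * ker a (x - y) \<partial>lborel) = op a ?g x" by (rule op_eq_ker[OF ai g, symmetric])
  finally show ?thesis by (simp only: co_def)
qed

text \<open>The hypotheses speak of derivatives along the axes only, so x is moved to x' one
  coordinate at a time.\<close>

lemma coordinate_lipschitz:
  fixes F :: "real^'n \<Rightarrow> complex"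
  assumes der: "\<And>i x. ((\<lambda>t. F (x + t *\<^sub>R axis i 1)) has_vector_derivative F' i x) (at 0)"
    and bd: "\<And>i x. norm (F' i x) \<le> M"
  shows "norm (F x - F x') \<le> M * (\<Sum>i\<in>UNIV. \<bar>x $ i - x' $ i\<bar>)"
proof -
  have M0: "0 \<le> M" using bd norm_ge_zero order_trans by blast
  have step: "norm (F x - F (x + h *\<^sub>R axis i 1)) \<le> M * \<bar>h\<bar>" for x h i
  proof -
    note der' = directional_derivative_shift[OF der]
    have "norm (F (x + 0 *\<^sub>R axis i 1) - F (x + h *\<^sub>R axis i 1)) \<le> M * norm (0 - h)"
    proof (rule differentiable_bound[of UNIV])
      fix u
      show "((\<lambda>u. F (x + u *\<^sub>R axis i 1)) has_derivative (\<lambda>h. h *\<^sub>R F' i (x + u *\<^sub>R axis i 1))) (at u within UNIV)"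
        using der'[of x i u] by (auto simp: has_vector_derivative_def)
      show "onorm (\<lambda>h. h *\<^sub>R F' i (x + u *\<^sub>R axis i 1)) \<le> M"
        by (intro onorm_le) (simp add: mult.commute[of M] mult_left_mono bd)
    qed auto
    then show ?thesis by simp
  qed
  have "norm (F x - F x') \<le> M * (\<Sum>i\<in>S. \<bar>x $ i - x' $ i\<bar>)"
    if "finite S" "\<And>i. i \<notin> S \<Longrightarrow> x $ i = x' $ i" for S x
    using that
  proof (induction S arbitrary: x)
    case empty then have "x = x'" by (simp add: vec_eq_iff) then show ?case by simp
  next
    case (insert i S)
    define h where "h = x' $ i - x $ i"
    define y where "y = x + h *\<^sub>R axis i 1"
    have y: "y $ j = (if j = i then x' $ i else x $ j)" for j by (auto simp: y_def h_def axis_def)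
    have "norm (F y - F x') \<le> M * (\<Sum>j\<in>S. \<bar>y $ j - x' $ j\<bar>)"
      by (rule insert.IH) (use insert.prems y in auto)
    also have "(\<Sum>j\<in>S. \<bar>y $ j - x' $ j\<bar>) = (\<Sum>j\<in>S. \<bar>x $ j - x' $ j\<bar>)"
      using insert.hyps by (intro sum.cong) (auto simp: y)
    finally have 1: "norm (F y - F x') \<le> M * (\<Sum>j\<in>S. \<bar>x $ j - x' $ j\<bar>)" .
    have 2: "norm (F x - F y) \<le> M * \<bar>x $ i - x' $ i\<bar>"
      using step[of x h i] by (simp add: y_def h_def abs_minus_commute)
    have "norm (F x - F x') \<le> norm (F x - F y) + norm (F y - F x')"
      using norm_triangle_ineq[of "F x - F y" "F y - F x'"] by simp
    with 1 2 show ?case using insert.hyps by (simp add: distrib_left)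
  qed
  from this[of UNIV x] show ?thesis by simp
qed

section \<open>A single frequency piece\<close>

lemma norm_cis_diff_le: "norm (cis a - cis b) \<le> \<bar>a - b\<bar>"
proof -
  have "norm (cis a - cis b) \<le> 1 * norm (a - b)"
  proof (rule differentiable_bound[of UNIV])
    fix u show "(cis has_derivative (\<lambda>h. h *\<^sub>R (\<i> * cis u))) (at u within UNIV)"
      using cis_has_vector_derivative[of u] by (auto simp: has_vector_derivative_def)
    show "onorm (\<lambda>h. h *\<^sub>R (\<i> * cis u)) \<le> 1" by (intro onorm_le) (simp add: norm_mult)
  qed auto
  then show ?thesis by simp
qed

lemma norm_ch_diff_le:
  fixes x x' \<xi> :: "real^'n"
  assumes "\<And>i. \<bar>x $ i - x' $ i\<bar> \<le> h" "\<xi> \<in> sqbox 0 R"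
  shows "norm (ch x \<xi> - ch x' \<xi>) \<le> 2 * pi * (real CARD('n) * h * R)"
proof -
  have "norm (ch x \<xi> - ch x' \<xi>) \<le> \<bar>2 * pi * (x \<bullet> \<xi>) - 2 * pi * (x' \<bullet> \<xi>)\<bar>"
    unfolding ch_def by (rule norm_cis_diff_le)
  also have "\<dots> = 2 * pi * \<bar>(x - x') \<bullet> \<xi>\<bar>"
    by (simp add: inner_diff_left right_diff_distrib[symmetric] abs_mult)
  also have "\<bar>(x - x') \<bullet> \<xi>\<bar> \<le> (\<Sum>i\<in>(UNIV::'n set). h * R)"
    unfolding inner_vec_def
  proof (rule order_trans[OF sum_abs], rule sum_mono)
    fix i :: 'n
    have "\<bar>\<xi> $ i\<bar> \<le> R" "0 \<le> h" using assms order_trans[OF abs_ge_zero assms(1)[of i]] by (auto simp: sqbox_def)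
    then show "\<bar>(x - x') $ i \<bullet> \<xi> $ i\<bar> \<le> h * R"
      using assms(1)[of i] by (auto simp: abs_mult intro!: mult_mono)
  qed
  finally show ?thesis by (simp add: mult_left_mono mult.assoc)
qed

text \<open>Symbol and base point may change together: a zero second symbol gives the size estimate
  \<open>norm_op_le\<close>, and two nearby points give the oscillation estimate.\<close>

lemma norm_op_diff_le:
  fixes g :: "real^'n \<Rightarrow> complex"
  assumes g: "integrable lborel g"
    and [measurable]: "\<beta> \<in> borel_measurable borel" "\<beta>' \<in> borel_measurable borel"
    and \<beta>: "\<And>\<xi>. norm (\<beta> \<xi>) \<le> B" "\<And>\<xi>. norm (\<beta>' \<xi>) \<le> B"
    and supp: "\<And>\<xi>. \<xi> \<notin> sqbox 0 R \<Longrightarrow> \<beta> \<xi> = 0" "\<And>\<xi>. \<xi> \<notin> sqbox 0 R \<Longrightarrow> \<beta>' \<xi> = 0"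
    and D: "\<And>\<xi>. \<xi> \<in> sqbox 0 R \<Longrightarrow> norm (\<beta> \<xi> * ch x \<xi> - \<beta>' \<xi> * ch x' \<xi>) \<le> D" "0 \<le> D"
    and A: "(\<integral>\<^sup>+\<xi>. ennreal (norm (ft g \<xi>)) * indicator (sqbox 0 R) \<xi> \<partial>lborel) \<le> ennreal A" "0 \<le> A"
  shows "norm (op \<beta> g x - op \<beta>' g x') \<le> D * A"
proof -
  have [measurable]: "g \<in> borel_measurable borel" using borel_measurable_integrable[OF g] by simp
  define Ig where "Ig = (\<integral>y. norm (g y) \<partial>lborel)"
  have B0: "0 \<le> B" using \<beta>(1) norm_ge_zero order_trans by blast
  have int: "integrable lborel (\<lambda>\<xi>. b \<xi> * ft g \<xi> * ch z \<xi>)"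
    if [measurable]: "b \<in> borel_measurable borel" and "\<And>\<xi>. norm (b \<xi>) \<le> B" "\<And>\<xi>. \<xi> \<notin> sqbox 0 R \<Longrightarrow> b \<xi> = 0" for b z
    by (rule integrable_box[where D="B * Ig" and c=0 and R=R])
       (use that B0 in \<open>auto simp: norm_mult Ig_def intro!: mult_mono norm_ft_le\<close>)
  have eq: "op \<beta> g x - op \<beta>' g x' = (\<integral>\<xi>. (\<beta> \<xi> * ch x \<xi> - \<beta>' \<xi> * ch x' \<xi>) * ft g \<xi> \<partial>lborel)"
    unfolding op_def using int[of \<beta> x] int[of \<beta>' x'] \<beta> supp
    by (subst Bochner_Integration.integral_diff[symmetric]) (auto intro!: Bochner_Integration.integral_cong simp: algebra_simps)
  have "ennreal (norm (op \<beta> g x - op \<beta>' g x'))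
      \<le> (\<integral>\<^sup>+\<xi>. ennreal (norm ((\<beta> \<xi> * ch x \<xi> - \<beta>' \<xi> * ch x' \<xi>) * ft g \<xi>)) \<partial>lborel)"
    unfolding eq by (rule ennreal_norm_integral_le)
  also have "\<dots> \<le> (\<integral>\<^sup>+\<xi>. ennreal D * (ennreal (norm (ft g \<xi>)) * indicator (sqbox 0 R) \<xi>) \<partial>lborel)"
  proof (rule nn_integral_mono)
    fix \<xi>
    show "ennreal (norm ((\<beta> \<xi> * ch x \<xi> - \<beta>' \<xi> * ch x' \<xi>) * ft g \<xi>))
      \<le> ennreal D * (ennreal (norm (ft g \<xi>)) * indicator (sqbox 0 R) \<xi>)"
      using D(1)[of \<xi>] D(2) supp[of \<xi>]
      by (cases "\<xi> \<in> sqbox 0 R") (auto simp: norm_mult ennreal_mult'[symmetric] intro!: ennreal_leI mult_right_mono)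
  qed
  also have "\<dots> = ennreal D * (\<integral>\<^sup>+\<xi>. ennreal (norm (ft g \<xi>)) * indicator (sqbox 0 R) \<xi> \<partial>lborel)"
    by (rule nn_integral_cmult) simp
  also have "\<dots> \<le> ennreal D * ennreal A" by (intro mult_left_mono A) simp
  finally show ?thesis using D(2) A(2) by (simp add: ennreal_mult'[symmetric])
qed

lemma norm_op_le:
  fixes g :: "real^'n \<Rightarrow> complex"
  assumes g: "integrable lborel g"
    and meas: "\<beta> \<in> borel_measurable borel"
    and \<beta>: "\<And>\<xi>. norm (\<beta> \<xi>) \<le> B" and supp: "\<And>\<xi>. \<xi> \<notin> sqbox 0 R \<Longrightarrow> \<beta> \<xi> = 0"
    and A: "(\<integral>\<^sup>+\<xi>. ennreal (norm (ft g \<xi>)) * indicator (sqbox 0 R) \<xi> \<partial>lborel) \<le> ennreal A" "0 \<le> A"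
  shows "norm (op \<beta> g x) \<le> B * A"
proof -
  have B0: "0 \<le> B" using \<beta> norm_ge_zero order_trans by blast
  have "norm (op \<beta> g x - op (\<lambda>_. 0) g x) \<le> B * A"
    by (rule norm_op_diff_le[OF g meas _ \<beta> _ supp _ _ B0 A]) (use \<beta> B0 in \<open>auto simp: norm_mult\<close>)
  then show ?thesis by (simp add: op_def)
qed

lemma borel_measurable_op:
  fixes g :: "real^'n \<Rightarrow> complex"
  assumes [measurable]: "(\<lambda>z. b (fst z) (snd z)) \<in> borel_measurable (borel \<Otimes>\<^sub>M borel)"
    "g \<in> borel_measurable borel"
  shows "(\<lambda>x. op (b x) g x) \<in> borel_measurable borel"
  unfolding op_def
proof (rule lborel.borel_measurable_lebesgue_integral)
  have "(\<lambda>z. b (fst z) (snd z) * ft g (snd z) * ch (fst z) (snd z)) \<in> borel_measurable (borel \<Otimes>\<^sub>M borel)"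
    by measurable
  then show "(\<lambda>(x, \<xi>). b x \<xi> * ft g \<xi> * ch x \<xi>) \<in> borel_measurable (borel \<Otimes>\<^sub>M lborel)"
    by (simp add: split_beta')
qed

lemma abs_power_le_1: "\<bar>y\<bar> \<le> 1 \<Longrightarrow> \<bar>y ^ k\<bar> \<le> 1" for y :: real
  by (simp add: power_abs power_le_one)

context cutoff
begin

text \<open>Origin in \<open>local_l2_bound\<close>: binomial coefficients are at most 2^(4n), the
  factor 2 adds the unexpanded term, and the number n(4n + 1) of terms appears once from
  Cauchy-Schwarz and once from their sum.\<close>

definition CL :: real where "CL = (2 * 2 ^ (4 * CARD('n)))\<^sup>2 * (real (CARD('n) * Suc (4 * CARD('n))))\<^sup>2 * CT * CB"

text \<open>The summands n, 2 \<pi> n and 4n measure the variation of the symbol, of the character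
  and of the powers of (x_i - c_i)/s in \<open>local_oscillation_bound\<close>.\<close>

definition CO :: real where
  "CO = 2 * 2 ^ (4 * CARD('n)) * real (CARD('n) * Suc (4 * CARD('n))) * (real CARD('n) * (1 + 2 * pi) + real (4 * CARD('n))) * (CB + 2 ^ CARD('n))"

lemma CL_nonneg: "0 \<le> CL"
  using CT_nonneg CB_pos by (simp add: CL_def)

lemma CO_pos: "0 < CO"
proof -
  have "0 < CARD('n) * Suc (4 * CARD('n))" by simp
  then have "0 < real (CARD('n) * Suc (4 * CARD('n)))" by (simp only: of_nat_0_less_iff)
  then show ?thesis unfolding CO_def using CB_pos by (intro mult_pos_pos add_pos_nonneg add_pos_pos) auto
qed

end

text \<open>Here \<open>\<beta> i l\<close> stands for \<open>s\<^bsup>-l\<^esup> \<partial>\<^sub>\<xi>\<^sub>i\<^sup>l a\<close> and \<open>\<gamma> i l j k\<close> for \<open>\<partial>\<^sub>x\<^sub>j\<^sup>k (\<beta> i l)\<close>.\<close>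
locale piece = cutoff \<theta> L N for \<theta> L and N :: "'n::finite itself" +
  fixes a :: "real^'n \<Rightarrow> real^'n \<Rightarrow> complex"
    and \<beta> :: "'n \<Rightarrow> nat \<Rightarrow> real^'n \<Rightarrow> real^'n \<Rightarrow> complex"
    and \<gamma> :: "'n \<Rightarrow> nat \<Rightarrow> 'n \<Rightarrow> nat \<Rightarrow> real^'n \<Rightarrow> real^'n \<Rightarrow> complex"
    and B s R r :: real
  assumes s: "0 < s" and B: "0 \<le> B" and R: "0 < R" and sR: "1 / s \<le> R" and r: "1 < r" "r \<le> 2"
    and \<beta>0: "\<And>i x \<xi>. \<beta> i 0 x \<xi> = a x \<xi>"
    and \<gamma>0: "\<And>i l j x \<xi>. l \<le> 4 * CARD('n) \<Longrightarrow> \<gamma> i l j 0 x \<xi> = \<beta> i l x \<xi>"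
    and tow_\<xi>: "\<And>i x. tower (4 * CARD('n)) (axis i 1) (\<lambda>l \<xi>. of_real (s ^ l) * \<beta> i l x \<xi>)"
    and tow_x: "\<And>i l j \<xi>. l \<le> 4 * CARD('n) \<Longrightarrow> tower (4 * CARD('n)) (axis j 1) (\<lambda>k x. \<gamma> i l j k x \<xi>)"
    and bd: "\<And>i l j k x \<xi>. l \<le> 4 * CARD('n) \<Longrightarrow> k \<le> 4 * CARD('n) \<Longrightarrow> norm (\<gamma> i l j k x \<xi>) \<le> B * (1 / s) ^ k"
    and supp: "\<And>i l x \<xi>. l \<le> 4 * CARD('n) \<Longrightarrow> \<xi> \<notin> sqbox 0 R \<Longrightarrow> \<beta> i l x \<xi> = 0"
    and cont: "\<And>i l j k. l \<le> 4 * CARD('n) \<Longrightarrow> k \<le> 4 * CARD('n) \<Longrightarrow>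
                 continuous_on UNIV (\<lambda>z. \<gamma> i l j k (fst z) (snd z))"
begin

lemma \<beta>_bd: "l \<le> (4 * CARD('n)) \<Longrightarrow> norm (\<beta> i l x \<xi>) \<le> B"
  using bd[of l 0 i undefined x \<xi>] \<gamma>0 by simp

lemma \<gamma>_meas: "l \<le> (4 * CARD('n)) \<Longrightarrow> k \<le> (4 * CARD('n)) \<Longrightarrow> (\<lambda>z. \<gamma> i l j k (fst z) (snd z)) \<in> borel_measurable (borel \<Otimes>\<^sub>M borel)"
  unfolding borel_prod by (intro borel_measurable_continuous_onI cont)

lemma \<beta>_meas2: "l \<le> (4 * CARD('n)) \<Longrightarrow> (\<lambda>z. \<beta> i l (fst z) (snd z)) \<in> borel_measurable (borel \<Otimes>\<^sub>M borel)"
  using \<gamma>_meas[of l 0 i undefined] by (simp add: \<gamma>0)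

lemma \<beta>_meas: "l \<le> (4 * CARD('n)) \<Longrightarrow> \<beta> i l x \<in> borel_measurable borel"
  using measurable_compose[OF measurable_Pair1' \<beta>_meas2] by simp

lemma localise:
  assumes f: "integrable lborel f"
  shows "op (a x) f x = op (a x) (loc s c f) x + (\<Sum>i\<in>UNIV. \<Sum>l\<le>(4 * CARD('n)). of_nat ((4 * CARD('n)) choose l) *
      of_real (((x $ i - c $ i) / s) ^ ((4 * CARD('n)) - l)) * (1 / (2 * pi * \<i>)) ^ l * op (\<beta> i l x) (loc s c f) x)"
  by (rule op_localise[OF s f tow_\<xi> \<beta>_meas \<beta>_bd supp \<beta>0])

lemma coefficient_le:
  assumes "l \<le> (4 * CARD('n))"
  shows "norm (of_nat ((4 * CARD('n)) choose l) * (1 / (2 * pi * \<i>)) ^ l :: complex) \<le> 2 ^ (4 * CARD('n))"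
proof -
  have "real ((4 * CARD('n)) choose l) \<le> 2 ^ (4 * CARD('n))"
  proof -
    have "((4 * CARD('n)) choose l) \<le> (\<Sum>k\<le>4 * CARD('n). (4 * CARD('n)) choose k)"
      using assms by (intro member_le_sum) auto
    then have "((4 * CARD('n)) choose l) \<le> 2 ^ (4 * CARD('n))" by (simp only: choose_row_sum)
    then show ?thesis by (metis of_nat_le_iff of_nat_numeral of_nat_power)
  qed
  moreover have "(1 / (2 * pi)) ^ l \<le> 1" using pi_gt3 by (intro power_le_one) auto
  ultimately have "real ((4 * CARD('n)) choose l) * (1 / (2 * pi)) ^ l \<le> 2 ^ (4 * CARD('n)) * 1" by (intro mult_mono) auto
  then show ?thesis by (simp add: norm_mult norm_power norm_divide)
qed

lemma ratio_le_1: "x \<in> sqbox c s \<Longrightarrow> \<bar>(x $ i - c $ i) / s\<bar> \<le> 1"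
  using s by (auto simp: sqbox_def)

lemma loc_powr_le:
  assumes "(\<integral>\<^sup>+y. ennreal (norm (f y) powr r * wt ((1 / s) *\<^sub>R (y - c))) \<partial>lborel) \<le> ennreal X"
  shows "(\<integral>\<^sup>+y. ennreal (norm (loc s c f y) powr r) \<partial>lborel) \<le> ennreal X"
  by (rule order_trans[OF nn_integral_mono assms]) (intro ennreal_leI norm_loc_powr_le, use r in simp)

text \<open>On the box the ratios (x_i - c_i)/s are at most 1, so localisation costs a fixed
  constant. Each localised term is then bounded by \<open>tt_star\<close> in terms of its transform
  on the frequency box, and \<open>bernstein_l2\<close> returns from there to the weighted L^r norm
  of f.\<close>

theorem local_l2_bound:
  assumes f: "integrable lborel f" and X: "0 < X"
    and fX: "(\<integral>\<^sup>+y. ennreal (norm (f y) powr r * wt ((1 / s) *\<^sub>R (y - c))) \<partial>lborel) \<le> ennreal X"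
  shows "(\<integral>\<^sup>+x. ennreal ((norm (op (a x) f x))\<^sup>2) * indicator (sqbox c s) x \<partial>lborel)
    \<le> ennreal (CL * (B\<^sup>2 * ((R ^ CARD('n)) powr (2 / r - 1) * X powr (2 / r))))"
proof -
  let ?g = "loc s c f"
  have g: "integrable lborel ?g" by (rule integrable_loc[OF f])
  have [measurable]: "?g \<in> borel_measurable borel" using borel_measurable_integrable[OF g] by simp
  \<comment> \<open>Truncation to the frequency support of the symbols changes none of the operators
    below, makes G integrable and brings \<open>bernstein_l2\<close> into play.\<close>
  define G where "G \<xi> = indicator (sqbox 0 R) \<xi> *\<^sub>R ft ?g \<xi>" for \<xi>
  have Gi: "integrable lborel G"
    by (rule integrable_box[where D="\<integral>y. norm (?g y) \<partial>lborel" and c=0 and R=R])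
       (auto simp: G_def[abs_def] indicator_def norm_ft_le)
  define A where "A = (R ^ CARD('n)) powr (2 / r - 1) * X powr (2 / r)"
  have A0: "0 \<le> A" by (simp add: A_def)
  have GA: "(\<integral>\<^sup>+\<xi>. ennreal ((norm (G \<xi>))\<^sup>2) \<partial>lborel) \<le> ennreal (CB * A)"
  proof -
    have "ennreal ((norm (G \<xi>))\<^sup>2) = ennreal ((norm (ft ?g \<xi>))\<^sup>2) * indicator (sqbox 0 R) \<xi>" for \<xi>
      by (auto simp: G_def indicator_def)
    then show ?thesis using bernstein_l2[OF g r R X loc_powr_le[OF fX]] by (simp add: A_def mult.assoc)
  qed
  define F where "F p x = norm (op (\<beta> (fst p) (snd p) x) ?g x)" for p x
  define P where "P = (UNIV :: 'n set) \<times> {..(4 * CARD('n))}"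
  have P: "finite P" "card P = CARD('n) * Suc (4 * CARD('n))" by (auto simp: P_def card_cartesian_product)
  have FG: "op (\<beta> i l x) ?g x = (\<integral>\<xi>. \<beta> i l x \<xi> * G \<xi> * ch x \<xi> \<partial>lborel)" if "l \<le> (4 * CARD('n))" for i l x
    unfolding op_def using supp[OF that, of _ i x]
    by (intro Bochner_Integration.integral_cong refl) (auto simp: G_def indicator_def)
  have int: "(\<integral>\<^sup>+x. ennreal ((F p x)\<^sup>2) * indicator (sqbox c s) x \<partial>lborel) \<le> ennreal (CT * B\<^sup>2 * (CB * A))"
    if p: "p \<in> P" for p
  proof -
    obtain i l where pl: "p = (i, l)" "l \<le> (4 * CARD('n))" using p by (auto simp: P_def)
    have "(\<integral>\<^sup>+x. ennreal ((norm (\<integral>\<xi>. \<beta> i l x \<xi> * G \<xi> * ch x \<xi> \<partial>lborel))\<^sup>2) * indicator (sqbox c s) x \<partial>lborel)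
        \<le> ennreal (CT * B\<^sup>2) * (\<integral>\<^sup>+\<xi>. ennreal ((norm (G \<xi>))\<^sup>2) \<partial>lborel)"
    proof (rule tt_star[OF s B, where \<gamma>="\<gamma> i l"])
      show "(\<lambda>x. \<gamma> i l j k x \<xi>) \<in> borel_measurable borel" if "k \<le> (4 * CARD('n))" for j k \<xi>
        using measurable_compose[OF measurable_Pair2' \<gamma>_meas[OF pl(2) that]] by simp
    qed (use pl tow_x bd \<gamma>0 \<beta>_meas2 Gi in auto)
    also have "\<dots> \<le> ennreal (CT * B\<^sup>2) * ennreal (CB * A)" by (intro mult_left_mono GA) simp
    also have "\<dots> = ennreal (CT * B\<^sup>2 * (CB * A))" using CT_nonneg B by (simp add: ennreal_mult'[symmetric])
    finally show ?thesis by (simp add: F_def pl FG)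
  qed
  have Fm [measurable]: "(\<lambda>x. F p x) \<in> borel_measurable borel" if p: "p \<in> P" for p
  proof -
    obtain i l where pl: "p = (i, l)" "l \<le> (4 * CARD('n))" using p by (auto simp: P_def)
    have "(\<lambda>x. op (\<beta> i l x) ?g x) \<in> borel_measurable borel"
      by (rule borel_measurable_op[OF \<beta>_meas2[OF pl(2)]]) simp
    then show ?thesis by (simp add: F_def pl)
  qed
  define D :: real where "D = 2 * 2 ^ (4 * CARD('n))"
  have pt: "norm (op (a x) f x) \<le> D * (\<Sum>p\<in>P. F p x)" if x: "x \<in> sqbox c s" for x
  proof -
    have "norm (op (a x) f x) \<le> norm (op (a x) ?g x) + (\<Sum>i\<in>UNIV. \<Sum>l\<le>(4 * CARD('n)). 2 ^ (4 * CARD('n)) * F (i, l) x)"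
      unfolding localise[OF f, of x c]
    proof (rule order_trans[OF norm_triangle_ineq], rule add_left_mono,
        rule order_trans[OF norm_sum], rule sum_mono, rule order_trans[OF norm_sum], rule sum_mono)
      fix i :: 'n and l assume l: "l \<in> {..(4 * CARD('n))}"
      have "norm (((x $ i - c $ i) / s) ^ ((4 * CARD('n)) - l)) \<le> 1"
        unfolding real_norm_def by (intro abs_power_le_1 ratio_le_1 x)
      then have "norm (of_nat ((4 * CARD('n)) choose l) * (1 / (2 * pi * \<i>)) ^ l :: complex) * norm (((x $ i - c $ i) / s) ^ ((4 * CARD('n)) - l)) * F (i, l) x
         \<le> 2 ^ (4 * CARD('n)) * 1 * F (i, l) x"
        using coefficient_le[of l] l by (intro mult_mono) (auto simp: F_def)
      then show "norm (of_nat ((4 * CARD('n)) choose l) * of_real (((x $ i - c $ i) / s) ^ ((4 * CARD('n)) - l)) * (1 / (2 * pi * \<i>)) ^ l * op (\<beta> i l x) ?g x)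
         \<le> 2 ^ (4 * CARD('n)) * F (i, l) x"
        by (simp only: norm_mult norm_of_real real_norm_def F_def fst_conv snd_conv mult_1_right mult_ac)
    qed
    also have "(\<Sum>i\<in>UNIV. \<Sum>l\<le>(4 * CARD('n)). 2 ^ (4 * CARD('n)) * F (i, l) x) = 2 ^ (4 * CARD('n)) * (\<Sum>p\<in>P. F p x)"
      by (simp add: P_def sum.cartesian_product sum_distrib_left)
    also have "norm (op (a x) ?g x) \<le> 2 ^ (4 * CARD('n)) * (\<Sum>p\<in>P. F p x)"
    proof -
      have "op (a x) ?g x = op (\<beta> undefined 0 x) ?g x"
        using \<beta>0[of undefined x] by (simp add: op_def)
      then have "norm (op (a x) ?g x) = F (undefined, 0) x" by (simp add: F_def)
      also have "\<dots> \<le> (\<Sum>p\<in>P. F p x)" by (rule member_le_sum) (auto simp: P_def F_def)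
      also have "\<dots> = 1 * (\<Sum>p\<in>P. F p x)" by simp
      also have "\<dots> \<le> 2 ^ (4 * CARD('n)) * (\<Sum>p\<in>P. F p x)" by (intro mult_right_mono sum_nonneg) (auto simp: F_def)
      finally show ?thesis .
    qed
    finally show ?thesis by (simp add: D_def mult_ac)
  qed
  define m where "m = real (CARD('n) * Suc (4 * CARD('n)))"
  have pt2: "ennreal ((norm (op (a x) f x))\<^sup>2) * indicator (sqbox c s) x
     \<le> ennreal (D\<^sup>2 * m) * (\<Sum>p\<in>P. ennreal ((F p x)\<^sup>2) * indicator (sqbox c s) x)" for x
  proof (cases "x \<in> sqbox c s")
    case True
    have "(norm (op (a x) f x))\<^sup>2 \<le> (D * (\<Sum>p\<in>P. F p x))\<^sup>2"
      by (intro power_mono pt[OF True]) simp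
    also have "\<dots> = D\<^sup>2 * (\<Sum>p\<in>P. F p x)\<^sup>2" by (rule power_mult_distrib)
    also have "\<dots> \<le> D\<^sup>2 * (m * (\<Sum>p\<in>P. (F p x)\<^sup>2))"
      using sum_squared_le_sum_of_squares[of "\<lambda>p. F p x" P] P by (intro mult_left_mono) (auto simp: m_def mult.commute)
    finally have "(norm (op (a x) f x))\<^sup>2 \<le> D\<^sup>2 * m * (\<Sum>p\<in>P. (F p x)\<^sup>2)" by (simp only: mult.assoc)
    then have "ennreal ((norm (op (a x) f x))\<^sup>2) \<le> ennreal (D\<^sup>2 * m) * ennreal (\<Sum>p\<in>P. (F p x)\<^sup>2)"
      by (simp add: ennreal_mult'[symmetric] sum_nonneg ennreal_leI m_def)
    then show ?thesis using True by (simp add: sum_ennreal)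
  qed simp
  have "(\<integral>\<^sup>+x. ennreal ((norm (op (a x) f x))\<^sup>2) * indicator (sqbox c s) x \<partial>lborel)
      \<le> (\<integral>\<^sup>+x. ennreal (D\<^sup>2 * m) * (\<Sum>p\<in>P. ennreal ((F p x)\<^sup>2) * indicator (sqbox c s) x) \<partial>lborel)"
    by (rule nn_integral_mono[OF pt2])
  also have "\<dots> = ennreal (D\<^sup>2 * m) * (\<Sum>p\<in>P. \<integral>\<^sup>+x. ennreal ((F p x)\<^sup>2) * indicator (sqbox c s) x \<partial>lborel)"
    by (subst nn_integral_cmult, (simp; fail)?, subst nn_integral_sum) auto
  also have "\<dots> \<le> ennreal (D\<^sup>2 * m) * (\<Sum>p\<in>P. ennreal (CT * B\<^sup>2 * (CB * A)))"
    by (intro mult_left_mono sum_mono int) auto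
  also have "\<dots> = ennreal (D\<^sup>2 * m) * ennreal (m * (CT * B\<^sup>2 * (CB * A)))"
    using CT_nonneg CB_pos A0 P by (simp add: m_def ennreal_mult' ennreal_of_nat_eq_real_of_nat[symmetric])
  also have "\<dots> = ennreal (D\<^sup>2 * m * (m * (CT * B\<^sup>2 * (CB * A))))"
    by (simp add: ennreal_mult' m_def)
  also have "D\<^sup>2 * m * (m * (CT * B\<^sup>2 * (CB * A))) = CL * (B\<^sup>2 * A)"
    by (simp only: CL_def D_def m_def power2_eq_square mult_ac)
  finally show ?thesis by (simp add: A_def)
qed

text \<open>Both points are localised with the same centre c, so that only the symbol, the character
  and the powers of (x_i - c_i)/s vary between x and x'. Each varies by at most a constant times h
  R, and \<open>bernstein_l1\<close> integrates the transform absolutely over the frequency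
  box.\<close>

theorem local_oscillation_bound:
  assumes f: "integrable lborel f" and X: "0 < X"
    and fX: "(\<integral>\<^sup>+y. ennreal (norm (f y) powr r * wt ((1 / s) *\<^sub>R (y - c))) \<partial>lborel) \<le> ennreal X"
    and x: "x \<in> sqbox c s" "x' \<in> sqbox c s" and h: "\<And>i. \<bar>x $ i - x' $ i\<bar> \<le> h"
  shows "norm (op (a x) f x - op (a x') f x') \<le> CO * (B * (h * R) * ((R ^ CARD('n)) powr (1 / r) * X powr (1 / r)))"
proof -
  let ?g = "loc s c f" and ?n = "real CARD('n)"
  have g: "integrable lborel ?g" by (rule integrable_loc[OF f])
  have h0: "0 \<le> h" using h order_trans[OF abs_ge_zero] by blast
  define A where "A = (CB + 2 ^ CARD('n)) * (R ^ CARD('n)) powr (1 / r) * X powr (1 / r)"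
  have A0: "0 \<le> A" using CB_pos by (simp add: A_def)
  have A: "(\<integral>\<^sup>+\<xi>. ennreal (norm (ft ?g \<xi>)) * indicator (sqbox 0 R) \<xi> \<partial>lborel) \<le> ennreal A"
    unfolding A_def by (rule bernstein_l1[OF g r R X loc_powr_le[OF fX]])
  have opB: "norm (op (\<beta> i l z) ?g z) \<le> B * A" if "l \<le> (4 * CARD('n))" for i l z
    by (rule norm_op_le[OF g \<beta>_meas \<beta>_bd supp A A0]) (use that in auto)
  have dif: "norm (op (\<beta> i l x) ?g x - op (\<beta> i l x') ?g x') \<le> (B * (h * R) * (?n * (1 + 2 * pi))) * A" if l: "l \<le> (4 * CARD('n))" for i l
  proof (rule norm_op_diff_le[OF g \<beta>_meas \<beta>_meas \<beta>_bd \<beta>_bd supp supp _ _ A A0])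
    show "0 \<le> B * (h * R) * (?n * (1 + 2 * pi))" using B h0 R by simp
    fix \<xi> :: "real^'n" assume \<xi>: "\<xi> \<in> sqbox 0 R"
    have "norm (\<beta> i l x \<xi> - \<beta> i l x' \<xi>) \<le> B * (1 / s) * (\<Sum>j\<in>UNIV. \<bar>x $ j - x' $ j\<bar>)"
    proof (rule coordinate_lipschitz[where F'="\<lambda>j x. \<gamma> i l j 1 x \<xi>"])
      fix j z
      show "((\<lambda>t. \<beta> i l (z + t *\<^sub>R axis j 1) \<xi>) has_vector_derivative \<gamma> i l j 1 z \<xi>) (at 0)"
        using tow_x[OF l, of j i \<xi>, unfolded tower_def, rule_format, of 0 z] \<gamma>0[OF l] by simp
      show "norm (\<gamma> i l j 1 z \<xi>) \<le> B * (1 / s)"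
        using bd[OF l, of 1 i j z \<xi>] by (simp add: Suc_leI)
    qed
    \<comment> \<open>By 1/s <= R, moving x inside the symbol costs no more than moving it inside
      the character.\<close>
    also have "\<dots> \<le> B * R * (\<Sum>j\<in>(UNIV::'n set). h)"
      using B sR s h R by (intro mult_mono sum_mono mult_left_mono sum_nonneg) auto
    finally have 1: "norm (\<beta> i l x \<xi> - \<beta> i l x' \<xi>) \<le> B * (h * R) * ?n" by (simp add: mult_ac)
    have 2: "norm (\<beta> i l x' \<xi>) * norm (ch x \<xi> - ch x' \<xi>) \<le> B * (2 * pi * (?n * h * R))"
      by (intro mult_mono \<beta>_bd[OF l] norm_ch_diff_le[OF h \<xi>] B) simp
    have "\<beta> i l x \<xi> * ch x \<xi> - \<beta> i l x' \<xi> * ch x' \<xi> = (\<beta> i l x \<xi> - \<beta> i l x' \<xi>) * ch x \<xi> + \<beta> i l x' \<xi> * (ch x \<xi> - ch x' \<xi>)"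
      by (simp add: algebra_simps)
    then have "norm (\<beta> i l x \<xi> * ch x \<xi> - \<beta> i l x' \<xi> * ch x' \<xi>) \<le> norm (\<beta> i l x \<xi> - \<beta> i l x' \<xi>) + norm (\<beta> i l x' \<xi>) * norm (ch x \<xi> - ch x' \<xi>)"
      by (metis norm_triangle_ineq norm_mult norm_ch mult_1_right)
    also have "\<dots> \<le> B * (h * R) * ?n + B * (2 * pi * (?n * h * R))" by (intro add_mono 1 2)
    finally show "norm (\<beta> i l x \<xi> * ch x \<xi> - \<beta> i l x' \<xi> * ch x' \<xi>) \<le> B * (h * R) * (?n * (1 + 2 * pi))"
      by (simp add: algebra_simps)
  qed (use l in auto)
  define E where "E = B * (h * R) * (?n * (1 + 2 * pi) + real (4 * CARD('n))) * A"
  have E0: "0 \<le> E" using B h0 R A0 by (simp add: E_def)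
  \<comment> \<open>The power of (z_i - c_i)/s depends on the point as well, so it is kept together
    with the operator, and the product is differenced factor by factor.\<close>
  define u where "u z i l = of_real (((z $ i - c $ i) / s) ^ ((4 * CARD('n)) - l)) * op (\<beta> i l z) ?g z" for z :: "real^'n" and i l
  have ud: "norm (u x i l - u x' i l) \<le> E" if l: "l \<le> (4 * CARD('n))" for i l
  proof -
    define q where "q z = ((z $ i - c $ i) / s) ^ ((4 * CARD('n)) - l)" for z :: "real^'n"
    have q1: "norm (q x) \<le> 1"
      unfolding real_norm_def q_def by (intro abs_power_le_1 ratio_le_1 x)
    have "norm (q x - q x') \<le> real ((4 * CARD('n)) - l) * norm ((x $ i - c $ i) / s - (x' $ i - c $ i) / s)"
      unfolding q_def using ratio_le_1[OF x(1), of i] ratio_le_1[OF x(2), of i] by (intro norm_power_diff) auto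
    also have "\<dots> = real ((4 * CARD('n)) - l) * (\<bar>x $ i - x' $ i\<bar> * (1 / s))"
      using s by (simp add: diff_divide_distrib[symmetric])
    also have "\<dots> \<le> real (4 * CARD('n)) * (h * R)"
      using h[of i] sR s h0 by (intro mult_mono) auto
    finally have q2: "norm (q x - q x') \<le> real (4 * CARD('n)) * (h * R)" .
    have "u x i l - u x' i l = of_real (q x) * (op (\<beta> i l x) ?g x - op (\<beta> i l x') ?g x') + of_real (q x - q x') * op (\<beta> i l x') ?g x'"
      by (simp add: u_def q_def algebra_simps)
    then have "norm (u x i l - u x' i l) \<le> norm (q x) * norm (op (\<beta> i l x) ?g x - op (\<beta> i l x') ?g x') + norm (q x - q x') * norm (op (\<beta> i l x') ?g x')"
      by (metis norm_triangle_ineq norm_mult norm_of_real real_norm_def)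
    also have "\<dots> \<le> 1 * ((B * (h * R) * (?n * (1 + 2 * pi))) * A) + real (4 * CARD('n)) * (h * R) * (B * A)"
      using q1 q2 dif[OF l] opB[OF l] h0 R by (intro add_mono mult_mono) auto
    also have "\<dots> = E" by (simp add: E_def algebra_simps)
    finally show ?thesis .
  qed
  have a0: "norm (op (a x) ?g x - op (a x') ?g x') \<le> E"
  proof -
    have "op (a z) ?g z = op (\<beta> undefined 0 z) ?g z" for z using \<beta>0[of undefined z] by (simp add: op_def)
    then have "norm (op (a x) ?g x - op (a x') ?g x') \<le> (B * (h * R) * (?n * (1 + 2 * pi))) * A" using dif[of 0 undefined] by simp
    also have "\<dots> \<le> E" unfolding E_def using B h0 R A0 by (intro mult_right_mono mult_left_mono) auto
    finally show ?thesis .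
  qed
  have loc': "op (a z) f z = op (a z) ?g z + (\<Sum>i\<in>UNIV. \<Sum>l\<le>(4 * CARD('n)). (of_nat ((4 * CARD('n)) choose l) * (1 / (2 * pi * \<i>)) ^ l) * u z i l)" for z
    unfolding localise[OF f, of z c] u_def by (simp only: mult_ac)
  have "op (a x) f x - op (a x') f x' = (op (a x) ?g x - op (a x') ?g x') + (\<Sum>i\<in>UNIV. \<Sum>l\<le>(4 * CARD('n)). (of_nat ((4 * CARD('n)) choose l) * (1 / (2 * pi * \<i>)) ^ l) * (u x i l - u x' i l))"
    unfolding loc' by (simp add: sum_subtractf right_diff_distrib)
  also have "norm \<dots> \<le> E + (\<Sum>i\<in>(UNIV::'n set). \<Sum>l\<le>(4 * CARD('n)). 2 ^ (4 * CARD('n)) * E)"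
  proof (rule order_trans[OF norm_triangle_ineq], rule add_mono[OF a0],
      rule order_trans[OF norm_sum], rule sum_mono, rule order_trans[OF norm_sum], rule sum_mono)
    fix i :: 'n and l assume "l \<in> {..(4 * CARD('n))}"
    then show "norm ((of_nat ((4 * CARD('n)) choose l) * (1 / (2 * pi * \<i>)) ^ l) * (u x i l - u x' i l)) \<le> 2 ^ (4 * CARD('n)) * E"
      unfolding norm_mult[of _ "u x i l - u x' i l"] by (intro mult_mono coefficient_le ud) auto
  qed
  also have "(\<Sum>i\<in>(UNIV::'n set). \<Sum>l\<le>(4 * CARD('n)). 2 ^ (4 * CARD('n)) * E) = 2 ^ (4 * CARD('n)) * real (CARD('n) * Suc (4 * CARD('n))) * E"
    by (simp add: algebra_simps)
  also have "E + 2 ^ (4 * CARD('n)) * real (CARD('n) * Suc (4 * CARD('n))) * E \<le> 2 * (2 ^ (4 * CARD('n)) * real (CARD('n) * Suc (4 * CARD('n))) * E)"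
  proof -
    have "1 \<le> CARD('n) * Suc (4 * CARD('n))" by (simp add: Suc_leI)
    then have "1 \<le> real (CARD('n) * Suc (4 * CARD('n)))" by (metis of_nat_1 of_nat_mono)
    then have "1 * 1 \<le> (2::real) ^ (4 * CARD('n)) * real (CARD('n) * Suc (4 * CARD('n)))" by (intro mult_mono) auto
    then have "1 * E \<le> 2 ^ (4 * CARD('n)) * real (CARD('n) * Suc (4 * CARD('n))) * E" using E0 by (intro mult_right_mono) auto
    then show ?thesis by linarith
  qed
  also have "\<dots> = CO * (B * (h * R) * ((R ^ CARD('n)) powr (1 / r) * X powr (1 / r)))"
    by (simp only: CO_def E_def A_def mult_ac)
  finally show ?thesis .
qed

end

section \<open>Averaging the weight over cubes\<close>

lemma mem_cube: "x \<in> cube a l \<longleftrightarrow> (\<forall>i. a $ i \<le> x $ i \<and> x $ i \<le> a $ i + l)" for x a :: "real^'n"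
proof -
  have "(One :: real^'n) $ i = 1" for i
    using inner_sum_Basis[of "axis i 1 :: real^'n"] by (simp add: inner_axis)
  then show ?thesis
    by (simp only: cube_def mem_box_cart vector_add_component vector_scaleR_component real_scaleR_def mult_1_right)
qed

lemma cube_mono: "h \<le> H \<Longrightarrow> cube q h \<subseteq> cube q H"
  by (auto simp: mem_cube subset_iff intro: order_trans[OF _ add_left_mono])

lemma cube_eq_cbox: "cube a l = cbox a (\<chi> i. a $ i + l)"
  by (auto simp: set_eq_iff mem_cube mem_box_cart)

lemma sets_cube [measurable]: "cube a l \<in> sets borel"
  by (simp add: cube_eq_cbox)

lemma emeasure_cube: "0 \<le> l \<Longrightarrow> emeasure lborel (cube (a::real^'n) l) = ennreal (l ^ CARD('n))"
  by (simp add: cube_eq_cbox emeasure_cbox_vec)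

text \<open>\<open>M\<close> stands for the r-th power of the maximal function at x0. Nonnegative
  integrals give the averages a meaning without integrability conditions.\<close>

definition maxbound :: "real \<Rightarrow> (real^'n \<Rightarrow> complex) \<Rightarrow> real^'n \<Rightarrow> real \<Rightarrow> bool" where
  "maxbound r f x0 M \<longleftrightarrow> 0 \<le> M \<and> (\<forall>a l. 0 < l \<longrightarrow> x0 \<in> cube a l \<longrightarrow>
     (\<integral>\<^sup>+y. ennreal (norm (f y) powr r) * indicator (cube a l) y \<partial>lborel) \<le> ennreal (l ^ CARD('n) * M))"

definition wavg :: "real \<Rightarrow> real \<Rightarrow> (real^'n \<Rightarrow> complex) \<Rightarrow> real^'n \<Rightarrow> ennreal" where
  "wavg r s f c = (\<integral>\<^sup>+y. ennreal (norm (f y) powr r * wt ((1 / s) *\<^sub>R (y - c))) \<partial>lborel)"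

lemma borel_measurable_wavg [measurable]:
  assumes [measurable]: "f \<in> borel_measurable borel"
  shows "wavg r s f \<in> borel_measurable borel"
  unfolding wavg_def[abs_def] by measurable

text \<open>The cube translated by s z and the point x0 fit into one cube of side H + s|z|, which is
  at most H (1 + |z|) because s <= H.\<close>

lemma maxbound_shift:
  fixes f :: "real^'n \<Rightarrow> complex"
  assumes [measurable]: "f \<in> borel_measurable borel" and M: "maxbound r f x0 M"
    and s: "0 < s" "s \<le> H" and x0: "x0 \<in> cube a H"
  shows "(\<integral>\<^sup>+c. ennreal (norm (f (c + s *\<^sub>R z)) powr r) * indicator (cube a H) c \<partial>lborel)
    \<le> ennreal (H ^ CARD('n) * M * (1 + norm z) ^ CARD('n))"
proof -
  let ?n = "CARD('n)"
  define a' where "a' = (\<chi> i. min (a $ i) (a $ i + s * z $ i))"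
  define H' where "H' = H + s * norm z"
  have z: "\<bar>s * z $ i\<bar> \<le> s * norm z" for i
    using component_le_norm_cart[of z i] s by (simp add: abs_mult)
  have sub: "u \<in> cube a' H'" if "u - s *\<^sub>R z \<in> cube a H" for u
    unfolding mem_cube
  proof
    fix i
    have "a $ i \<le> u $ i - s * z $ i \<and> u $ i - s * z $ i \<le> a $ i + H" using that by (auto simp: mem_cube)
    then show "a' $ i \<le> u $ i \<and> u $ i \<le> a' $ i + H'" using z[of i] by (auto simp: a'_def H'_def)
  qed
  have x0': "x0 \<in> cube a' H'"
    unfolding mem_cube
  proof
    fix i
    have "a $ i \<le> x0 $ i \<and> x0 $ i \<le> a $ i + H" using x0 by (auto simp: mem_cube)
    then show "a' $ i \<le> x0 $ i \<and> x0 $ i \<le> a' $ i + H'" using z[of i] by (auto simp: a'_def H'_def)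
  qed
  have "(\<integral>\<^sup>+c. ennreal (norm (f (c + s *\<^sub>R z)) powr r) * indicator (cube a H) c \<partial>lborel)
      = (\<integral>\<^sup>+u. ennreal (norm (f u) powr r) * indicator (cube a H) (u - s *\<^sub>R z) \<partial>lborel)"
    by (subst nn_integral_lborel_affine[of "\<lambda>u. ennreal (norm (f u) powr r) * indicator (cube a H) (u - s *\<^sub>R z)" 1 "s *\<^sub>R z"])
       (auto simp: add.commute)
  also have "\<dots> \<le> (\<integral>\<^sup>+u. ennreal (norm (f u) powr r) * indicator (cube a' H') u \<partial>lborel)"
    using sub by (intro nn_integral_mono) (auto simp: indicator_def)
  also have "\<dots> \<le> ennreal (H' ^ ?n * M)"
  proof -
    have "0 < H'" using s by (auto simp: H'_def intro!: add_pos_nonneg)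
    then show ?thesis using M x0' unfolding maxbound_def by blast
  qed
  also have "\<dots> \<le> ennreal (H ^ ?n * M * (1 + norm z) ^ ?n)"
  proof (rule ennreal_leI)
    have "H' \<le> H * (1 + norm z)" unfolding H'_def using s by (simp add: distrib_left mult_right_mono)
    then have "H' ^ ?n \<le> (H * (1 + norm z)) ^ ?n" using s by (intro power_mono) (auto simp: H'_def)
    then have "H' ^ ?n * M \<le> (H * (1 + norm z)) ^ ?n * M" using M by (intro mult_right_mono) (auto simp: maxbound_def)
    then show "H' ^ ?n * M \<le> H ^ ?n * M * (1 + norm z) ^ ?n" by (simp add: power_mult_distrib mult_ac)
  qed
  finally show ?thesis .
qed

text \<open>Substituting y = c + s z turns the moving weight into the fixed weight
  \<open>wt z\<close>. After exchanging the integrals, \<open>maxbound_shift\<close> treats each z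
  at the price (1 + |z|)^n, for which \<open>wt_mass\<close> has room.\<close>

lemma wavg_cube_le:
  fixes f :: "real^'n \<Rightarrow> complex"
  assumes [measurable]: "f \<in> borel_measurable borel" and M: "maxbound r f x0 M"
    and s: "0 < s" "s \<le> H" and x0: "x0 \<in> cube a H"
  shows "(\<integral>\<^sup>+c. wavg r s f c * indicator (cube a H) c \<partial>lborel)
    \<le> ennreal (s ^ CARD('n)) * ennreal (wt_mass TYPE('n) * H ^ CARD('n) * M)"
proof -
  let ?n = "CARD('n)"
  have M0: "0 \<le> M" using M by (simp add: maxbound_def)
  have sub: "wavg r s f c = ennreal (s ^ ?n) * (\<integral>\<^sup>+z. ennreal (norm (f (c + s *\<^sub>R z)) powr r) * ennreal (wt z) \<partial>lborel)" for c
    unfolding wavg_def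
    by (subst nn_integral_lborel_affine[of _ s c]) (use s in \<open>auto simp: ennreal_mult less_imp_le[OF wt_pos]\<close>)
  have "(\<integral>\<^sup>+c. wavg r s f c * indicator (cube a H) c \<partial>lborel)
      = ennreal (s ^ ?n) * (\<integral>\<^sup>+c. (\<integral>\<^sup>+z. ennreal (norm (f (c + s *\<^sub>R z)) powr r) * ennreal (wt z) \<partial>lborel) * indicator (cube a H) c \<partial>lborel)"
    unfolding sub by (simp add: mult.assoc nn_integral_cmult)
  also have "(\<integral>\<^sup>+c. (\<integral>\<^sup>+z. ennreal (norm (f (c + s *\<^sub>R z)) powr r) * ennreal (wt z) \<partial>lborel) * indicator (cube a H) c \<partial>lborel)
      = (\<integral>\<^sup>+c. \<integral>\<^sup>+z. ennreal (wt z) * (ennreal (norm (f (c + s *\<^sub>R z)) powr r) * indicator (cube a H) c) \<partial>lborel \<partial>lborel)"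
    by (intro nn_integral_cong, subst nn_integral_multc[symmetric]) (auto simp: mult_ac)
  also have "\<dots> = (\<integral>\<^sup>+z. \<integral>\<^sup>+c. ennreal (wt z) * (ennreal (norm (f (c + s *\<^sub>R z)) powr r) * indicator (cube a H) c) \<partial>lborel \<partial>lborel)"
    by (rule lborel_pair.Fubini'[symmetric]) measurable
  also have "\<dots> = (\<integral>\<^sup>+z. ennreal (wt z) * (\<integral>\<^sup>+c. ennreal (norm (f (c + s *\<^sub>R z)) powr r) * indicator (cube a H) c \<partial>lborel) \<partial>lborel)"
    by (simp add: nn_integral_cmult)
  also have "\<dots> \<le> (\<integral>\<^sup>+(z::real^'n). ennreal (wt z) * ennreal (H ^ ?n * M * (1 + norm z) ^ ?n) \<partial>lborel)"
  proof (rule nn_integral_mono)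
    fix z :: "real^'n"
    show "ennreal (wt z) * (\<integral>\<^sup>+c. ennreal (norm (f (c + s *\<^sub>R z)) powr r) * indicator (cube a H) c \<partial>lborel)
        \<le> ennreal (wt z) * ennreal (H ^ ?n * M * (1 + norm z) ^ ?n)"
      by (rule mult_left_mono[OF maxbound_shift[OF _ M s x0]]) auto
  qed
  also have "\<dots> = (\<integral>\<^sup>+(z::real^'n). ennreal (H ^ ?n * M) * ennreal ((1 + norm z) ^ ?n * wt z) \<partial>lborel)"
    using s M0 by (intro nn_integral_cong) (auto simp: ennreal_mult[symmetric] less_imp_le[OF wt_pos] mult_ac)
  also have "\<dots> = ennreal (H ^ ?n * M) * ennreal (wt_mass TYPE('n))"
    by (subst nn_integral_cmult) (auto simp: nn_integral_growth_wt)
  also have "\<dots> = ennreal (wt_mass TYPE('n) * H ^ ?n * M)"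
    using s M0 wt_mass_nonneg[where 'n='n] by (simp add: ennreal_mult[symmetric] mult_ac)
  finally show ?thesis by (simp add: mult_left_mono)
qed

text \<open>Stands in for Hoelder's inequality between L^r and L^2 on a set of finite measure, with
  l tuned later to a root mean square.\<close>

lemma powr_le_square_split:
  fixes u l r :: real
  assumes "0 \<le> u" "0 < l" "0 < r" "r \<le> 2"
  shows "u powr r \<le> l powr (r - 2) * u\<^sup>2 + l powr r"
proof (cases "u \<le> l")
  case True
  then have "u powr r \<le> l powr r" using assms by (intro powr_mono2) auto
  also have "\<dots> \<le> l powr (r - 2) * u\<^sup>2 + l powr r" by simp
  finally show ?thesis .
next
  case False
  then have u: "0 < u" using assms by linarith
  have "u powr r = u powr (r - 2) * u\<^sup>2" using u by (simp add: powr_add[symmetric] powr_numeral[symmetric] del: powr_numeral)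
  also have "\<dots> \<le> l powr (r - 2) * u\<^sup>2" using False assms by (intro mult_right_mono powr_mono2') auto
  also have "\<dots> \<le> l powr (r - 2) * u\<^sup>2 + l powr r" by simp
  finally show ?thesis .
qed

text \<open>The local bounds are stated for positive finite X, while the weighted average at a given
  centre may be 0 or infinite.\<close>

lemma ennreal_le_cmult_limit:
  fixes A Y :: ennreal
  assumes C: "0 < C" and le: "\<And>X. 0 < X \<Longrightarrow> Y \<le> ennreal X \<Longrightarrow> A \<le> ennreal (C * X)"
  shows "A \<le> ennreal C * Y"
proof (cases "Y = \<infinity>")
  case True then show ?thesis using C by (simp add: ennreal_mult_top)
next
  case False
  then obtain y where y: "Y = ennreal y" "0 \<le> y" by (cases Y) auto
  have "A \<le> ennreal (C * y)"
  proof (rule ennreal_le_epsilon)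
    fix e :: real assume e: "0 < e"
    have "A \<le> ennreal (C * (y + e / C))" using e C y by (intro le) (auto intro!: ennreal_leI add_nonneg_pos)
    also have "C * (y + e / C) = C * y + e" using C by (simp add: distrib_left)
    also have "ennreal (C * y + e) = ennreal (C * y) + ennreal e" using e C y by (intro ennreal_plus) auto
    finally show "A \<le> ennreal (C * y) + ennreal e" .
  qed
  then show ?thesis using C y by (simp add: ennreal_mult')
qed

section \<open>From boxes at scale s to arbitrary cubes\<close>

context piece
begin

lemma local_lr_bound:
  assumes f: "integrable lborel f" and B: "0 < B" and Q [measurable]: "Q \<in> sets borel" and k: "0 < k"
    and meas: "emeasure lborel (Q \<inter> sqbox c s) \<le> ennreal ((2 * k) ^ CARD('n))"
  shows "(\<integral>\<^sup>+x. ennreal (norm (op (a x) f x) powr r) * indicator (Q \<inter> sqbox c s) x \<partial>lborel)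
    \<le> ennreal ((CL + 2 ^ CARD('n)) * (B powr r * (R ^ CARD('n) * k ^ CARD('n)) powr (1 - r / 2))) * wavg r s f c"
proof (rule ennreal_le_cmult_limit)
  let ?n = "CARD('n)"
  show "0 < (CL + 2 ^ ?n) * (B powr r * (R ^ ?n * k ^ ?n) powr (1 - r / 2))"
    using CL_nonneg B R k by (intro mult_pos_pos add_nonneg_pos) auto
  fix X :: real assume X: "0 < X" and fX: "wavg r s f c \<le> ennreal X"
  have [measurable]: "f \<in> borel_measurable borel" using borel_measurable_integrable[OF f] by simp
  have [measurable]: "(\<lambda>x. op (a x) f x) \<in> borel_measurable borel"
    using borel_measurable_op[OF \<beta>_meas2[of 0 undefined], of f] by (simp add: \<beta>0)
  define u where "u x = norm (op (a x) f x)" for x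
  have [measurable]: "u \<in> borel_measurable borel" unfolding u_def by measurable
  define N where "N = R ^ ?n"
  define V where "V = k ^ ?n"
  have NV: "0 < N" "0 < V" using R k by (auto simp: N_def V_def)
  \<comment> \<open>The square root of the L^2 bound divided by \<open>V\<close>, which balances the
    two terms of \<open>powr_le_square_split\<close> up to constants; \<open>V\<close> bounds the
    measure of the set up to the factor 2^n.\<close>
  define l where "l = B * N powr (1 / r - 1 / 2) * X powr (1 / r) * V powr (- 1 / 2)"
  have l: "0 < l" using B NV X by (simp add: l_def)
  have l2: "l\<^sup>2 * V = B\<^sup>2 * (N powr (2 / r - 1) * X powr (2 / r))"
  proof -
    have "(N powr (1 / r - 1 / 2))\<^sup>2 = N powr (2 / r - 1)" "(X powr (1 / r))\<^sup>2 = X powr (2 / r)" "(V powr (- 1 / 2))\<^sup>2 = V powr (-1)"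
      by (simp_all add: power2_eq_square powr_add[symmetric])
    moreover have "V powr (-1) * V = 1" using NV by (simp add: powr_minus)
    ultimately show ?thesis by (simp add: l_def power_mult_distrib mult_ac)
  qed
  have lr: "l powr r * V = B powr r * (N * V) powr (1 - r / 2) * X"
  proof -
    have "(1 / r - 1 / 2) * r = 1 - r / 2" using r by (simp add: field_simps)
    then have "l powr r = B powr r * N powr (1 - r / 2) * X * V powr (- (r / 2))"
      using B NV X r by (simp add: l_def powr_mult powr_powr)
    moreover have "V powr (- (r / 2)) * V = V powr (1 - r / 2)"
      using powr_add[of V "- (r / 2)" 1] NV by simp
    ultimately show ?thesis using NV by (simp add: powr_mult mult_ac)
  qed
  have "(\<integral>\<^sup>+x. ennreal (u x powr r) * indicator (Q \<inter> sqbox c s) x \<partial>lborel)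
     \<le> (\<integral>\<^sup>+x. ennreal (l powr (r - 2)) * (ennreal ((u x)\<^sup>2) * indicator (sqbox c s) x) + ennreal (l powr r) * indicator (Q \<inter> sqbox c s) x \<partial>lborel)"
  proof (rule nn_integral_mono)
    fix x
    have "ennreal (u x powr r) \<le> ennreal (l powr (r - 2) * (u x)\<^sup>2 + l powr r)"
      using l r by (intro ennreal_leI powr_le_square_split) (auto simp: u_def)
    also have "\<dots> = ennreal (l powr (r - 2)) * ennreal ((u x)\<^sup>2) + ennreal (l powr r)"
      by (simp add: ennreal_mult)
    finally show "ennreal (u x powr r) * indicator (Q \<inter> sqbox c s) x
      \<le> ennreal (l powr (r - 2)) * (ennreal ((u x)\<^sup>2) * indicator (sqbox c s) x) + ennreal (l powr r) * indicator (Q \<inter> sqbox c s) x"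
      by (auto simp: indicator_def)
  qed
  also have "\<dots> = ennreal (l powr (r - 2)) * (\<integral>\<^sup>+x. ennreal ((u x)\<^sup>2) * indicator (sqbox c s) x \<partial>lborel) + ennreal (l powr r) * emeasure lborel (Q \<inter> sqbox c s)"
    by (simp add: nn_integral_add nn_integral_cmult nn_integral_cmult_indicator)
  also have "\<dots> \<le> ennreal (l powr (r - 2)) * ennreal (CL * (l\<^sup>2 * V)) + ennreal (l powr r) * ennreal ((2 * k) ^ ?n)"
    using local_l2_bound[OF f X fX[unfolded wavg_def]] meas unfolding l2 N_def u_def
    by (intro add_mono mult_left_mono) auto
  also have "\<dots> = ennreal (l powr (r - 2) * (CL * (l\<^sup>2 * V)) + l powr r * (2 * k) ^ ?n)"
    using CL_nonneg NV k by (simp add: ennreal_mult[symmetric] ennreal_plus[symmetric] del: ennreal_plus)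
  also have "l powr (r - 2) * (CL * (l\<^sup>2 * V)) + l powr r * (2 * k) ^ ?n = (CL + 2 ^ ?n) * (l powr r * V)"
  proof -
    have "l powr (r - 2) * l\<^sup>2 = l powr r" using l by (simp add: powr_add[symmetric] powr_numeral[symmetric] del: powr_numeral)
    then have "l powr (r - 2) * (CL * (l\<^sup>2 * V)) = CL * (l powr r * V)" by (metis mult.assoc mult.left_commute)
    then show ?thesis by (simp add: power_mult_distrib V_def[symmetric] algebra_simps)
  qed
  also have "\<dots> = (CL + 2 ^ ?n) * (B powr r * (R ^ ?n * k ^ ?n) powr (1 - r / 2)) * X"
    unfolding lr by (simp only: N_def V_def mult.assoc)
  finally show "(\<integral>\<^sup>+x. ennreal (norm (op (a x) f x) powr r) * indicator (Q \<inter> sqbox c s) x \<partial>lborel)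
    \<le> ennreal ((CL + 2 ^ ?n) * (B powr r * (R ^ ?n * k ^ ?n) powr (1 - r / 2)) * X)"
    by (simp only: u_def)
qed

text \<open>\<open>local_lr_bound\<close> is integrated over centres c in the cube of side max h s.
  Each x is seen by centres of measure at least s^n, which cancels the factor s^n of
  \<open>wavg_cube_le\<close>.\<close>

theorem cube_lr_bound:
  assumes f: "integrable lborel f" and M: "maxbound r f x0 M" and B: "0 < B" and h: "0 < h" and x0: "x0 \<in> cube q h"
  shows "(\<integral>\<^sup>+x. ennreal (norm (op (a x) f x) powr r) * indicator (cube q h) x \<partial>lborel)
    \<le> ennreal ((CL + 2 ^ CARD('n)) * wt_mass TYPE('n) *
        (B powr r * (R ^ CARD('n) * min h s ^ CARD('n)) powr (1 - r / 2) * max h s ^ CARD('n) * M))"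
proof -
  let ?n = "CARD('n)"
  define H where "H = max h s"
  \<comment> \<open>Up to a factor 2, the side of the part of the cube that one box can see.\<close>
  define k where "k = min h s"
  have k: "0 < k" using h s by (simp add: k_def)
  have H: "h \<le> H" "s \<le> H" by (auto simp: H_def)
  have M0: "0 \<le> M" using M by (simp add: maxbound_def)
  have QQ: "cube q h \<subseteq> cube q H" using H by (intro cube_mono)
  have [measurable]: "f \<in> borel_measurable borel" using borel_measurable_integrable[OF f] by simp
  have [measurable]: "(\<lambda>x. op (a x) f x) \<in> borel_measurable borel"
    using borel_measurable_op[OF \<beta>_meas2[of 0 undefined], of f] by (simp add: \<beta>0)
  define u where "u x = ennreal (norm (op (a x) f x) powr r)" for x
  have [measurable]: "u \<in> borel_measurable borel" unfolding u_def by measurable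
  define C where "C = (CL + 2 ^ ?n) * (B powr r * (R ^ ?n * k ^ ?n) powr (1 - r / 2))"
  have C0: "0 \<le> C" using CL_nonneg by (simp add: C_def)
  have inner: "(\<integral>\<^sup>+x. u x * indicator (cube q h \<inter> sqbox c s) x \<partial>lborel) \<le> ennreal C * wavg r s f c" for c
    unfolding u_def C_def
  proof (rule local_lr_bound[OF f B _ k])
    show "emeasure lborel (cube q h \<inter> sqbox c s) \<le> ennreal ((2 * k) ^ ?n)"
    proof (cases "h \<le> s")
      case True
      have "emeasure lborel (cube q h \<inter> sqbox c s) \<le> emeasure lborel (cube q h)" by (intro emeasure_mono) auto
      also have "\<dots> = ennreal (h ^ ?n)" using h by (simp add: emeasure_cube)
      also have "\<dots> \<le> ennreal ((2 * k) ^ ?n)" using True h by (intro ennreal_leI power_mono) (auto simp: k_def)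
      finally show ?thesis .
    next
      case False
      have "emeasure lborel (cube q h \<inter> sqbox c s) \<le> emeasure lborel (sqbox c s)" by (intro emeasure_mono) auto
      also have "\<dots> = ennreal ((2 * s) ^ ?n)" using s by (simp add: emeasure_sqbox)
      also have "\<dots> = ennreal ((2 * k) ^ ?n)" using False by (simp add: k_def)
      finally show ?thesis .
    qed
  qed simp
  have vol: "ennreal (s ^ ?n) * indicator (cube q h) x \<le> (\<integral>\<^sup>+c. indicator (cube q H) c * indicator (cube q h \<inter> sqbox c s) x \<partial>lborel)" for x
  proof (cases "x \<in> cube q h")
    case True
    \<comment> \<open>Corner of a cube of side s of admissible centres: with the maximum it stays
      inside the large cube, and every coordinate remains within s of x.\<close>
    define q' where "q' = (\<chi> i. max (q $ i) (x $ i - s))"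
    have "indicator (cube q' s) c \<le> (indicator (cube q H) c * indicator (cube q h \<inter> sqbox c s) x :: ennreal)" for c
    proof (cases "c \<in> cube q' s")
      case c: True
      have "q $ i \<le> c $ i \<and> c $ i \<le> q $ i + H \<and> \<bar>x $ i - c $ i\<bar> \<le> s" for i
      proof -
        have "q $ i \<le> x $ i" "x $ i \<le> q $ i + h" using True by (auto simp: mem_cube)
        moreover have "max (q $ i) (x $ i - s) \<le> c $ i" "c $ i \<le> max (q $ i) (x $ i - s) + s" using c by (auto simp: mem_cube q'_def)
        ultimately show ?thesis using H by linarith
      qed
      then have "c \<in> cube q H" "x \<in> sqbox c s" by (auto simp: mem_cube sqbox_def)
      then show ?thesis using True c by simp
    qed simp
    then have "(\<integral>\<^sup>+c. indicator (cube q' s) c \<partial>lborel) \<le> (\<integral>\<^sup>+c. indicator (cube q H) c * indicator (cube q h \<inter> sqbox c s) x \<partial>lborel)"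
      by (rule nn_integral_mono)
    moreover have "(\<integral>\<^sup>+c. indicator (cube q' s) c \<partial>lborel) = ennreal (s ^ ?n)" using s by (simp add: emeasure_cube)
    ultimately show ?thesis using True by simp
  qed simp
  have smeas [measurable]: "(\<lambda>z::(real^'n) \<times> (real^'n). indicator (sqbox (fst z) s) (snd z) :: ennreal) \<in> borel_measurable (borel \<Otimes>\<^sub>M borel)"
  proof -
    have eq: "(\<lambda>z. indicator (sqbox (fst z) s) (snd z) :: ennreal)
        = indicator {z :: (real^'n) \<times> (real^'n). \<forall>i. \<bar>snd z $ i - fst z $ i\<bar> \<le> s}"
      by (auto simp: fun_eq_iff indicator_def sqbox_def)
    have "closed {z :: (real^'n) \<times> (real^'n). \<forall>i. \<bar>snd z $ i - fst z $ i\<bar> \<le> s}"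
      by (intro closed_Collect_all closed_Collect_le continuous_intros)
    then show ?thesis unfolding borel_prod eq by (intro borel_measurable_indicator borel_closed)
  qed
  have imeas [measurable]: "(\<lambda>(x, c). indicator (cube q h \<inter> sqbox c s) x :: ennreal) \<in> borel_measurable (lborel \<Otimes>\<^sub>M lborel)"
  proof -
    have "(\<lambda>z. indicator (cube q h) (fst z) * indicator (sqbox (snd z) s) (fst z) :: ennreal) \<in> borel_measurable (borel \<Otimes>\<^sub>M borel)"
      using measurable_compose[OF measurable_Pair[OF measurable_snd measurable_fst] smeas] by simp
    moreover have "(\<lambda>(x, c). indicator (cube q h \<inter> sqbox c s) x :: ennreal) = (\<lambda>z. indicator (cube q h) (fst z) * indicator (sqbox (snd z) s) (fst z))"
      by (auto simp: fun_eq_iff indicator_def)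
    ultimately show ?thesis by simp
  qed
  have "ennreal (s ^ ?n) * (\<integral>\<^sup>+x. u x * indicator (cube q h) x \<partial>lborel) = (\<integral>\<^sup>+x. u x * (ennreal (s ^ ?n) * indicator (cube q h) x) \<partial>lborel)"
    by (simp add: nn_integral_cmult[symmetric] mult_ac)
  also have "\<dots> \<le> (\<integral>\<^sup>+x. u x * (\<integral>\<^sup>+c. indicator (cube q H) c * indicator (cube q h \<inter> sqbox c s) x \<partial>lborel) \<partial>lborel)"
    by (intro nn_integral_mono mult_left_mono vol) simp
  also have "\<dots> = (\<integral>\<^sup>+x. \<integral>\<^sup>+c. u x * (indicator (cube q H) c * indicator (cube q h \<inter> sqbox c s) x) \<partial>lborel \<partial>lborel)"
  proof -
    have [measurable]: "(\<lambda>c. indicator (cube q h \<inter> sqbox c s) x :: ennreal) \<in> borel_measurable borel" for x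
      using measurable_compose[OF measurable_Pair1' imeas, of x] by simp
    show ?thesis by (simp add: nn_integral_cmult)
  qed
  also have "\<dots> = (\<integral>\<^sup>+c. \<integral>\<^sup>+x. u x * (indicator (cube q H) c * indicator (cube q h \<inter> sqbox c s) x) \<partial>lborel \<partial>lborel)"
  proof (rule lborel_pair.Fubini'[symmetric])
    show "(\<lambda>(x, c). u x * (indicator (cube q H) c * indicator (cube q h \<inter> sqbox c s) x)) \<in> borel_measurable (lborel \<Otimes>\<^sub>M lborel)"
      using imeas unfolding split_beta' by measurable
  qed
  also have "\<dots> = (\<integral>\<^sup>+c. (\<integral>\<^sup>+x. u x * indicator (cube q h \<inter> sqbox c s) x \<partial>lborel) * indicator (cube q H) c \<partial>lborel)"
    by (intro nn_integral_cong, subst nn_integral_multc[symmetric]) (auto simp: mult_ac)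
  also have "\<dots> \<le> (\<integral>\<^sup>+c. ennreal C * (wavg r s f c * indicator (cube q H) c) \<partial>lborel)"
    by (intro nn_integral_mono) (auto simp: mult.assoc[symmetric] intro!: mult_right_mono inner)
  also have "\<dots> = ennreal C * (\<integral>\<^sup>+c. wavg r s f c * indicator (cube q H) c \<partial>lborel)"
    by (rule nn_integral_cmult) simp
  also have "\<dots> \<le> ennreal C * (ennreal (s ^ ?n) * ennreal (wt_mass TYPE('n) * H ^ ?n * M))"
    using wavg_cube_le[OF _ M s H(2), of q] x0 QQ by (intro mult_left_mono) auto
  also have "\<dots> = ennreal (s ^ ?n) * ennreal (C * (wt_mass TYPE('n) * H ^ ?n * M))"
    using C0 by (simp add: ennreal_mult' mult_ac)
  finally have "ennreal (s ^ ?n) * (\<integral>\<^sup>+x. u x * indicator (cube q h) x \<partial>lborel) \<le> ennreal (s ^ ?n) * ennreal (C * (wt_mass TYPE('n) * H ^ ?n * M))" .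
  then have "(\<integral>\<^sup>+x. u x * indicator (cube q h) x \<partial>lborel) \<le> ennreal (C * (wt_mass TYPE('n) * H ^ ?n * M))"
    using s by (subst (asm) ennreal_mult_le_mult_iff) auto
  then show ?thesis by (simp add: u_def C_def k_def H_def mult_ac)
qed

text \<open>For h <= s the box about every centre c in \<open>cube q s\<close> contains the whole
  small cube, so the left side, which does not depend on c, can be averaged over c.\<close>

theorem cube_oscillation_bound:
  assumes f: "integrable lborel f" and M: "maxbound r f x0 M" and B: "0 < B" and h: "0 < h" "h \<le> s"
    and x0: "x0 \<in> cube q h" and x: "x \<in> cube q h" "x' \<in> cube q h"
  shows "norm (op (a x) f x - op (a x') f x') powr r
    \<le> CO powr r * wt_mass TYPE('n) * ((B * (h * R)) powr r * R ^ CARD('n) * s ^ CARD('n) * M)"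
proof -
  let ?n = "CARD('n)"
  define D where "D = norm (op (a x) f x - op (a x') f x') powr r"
  define C where "C = CO powr r * ((B * (h * R)) powr r * R ^ ?n)"
  have C: "0 < C" using CO_pos B h R by (simp add: C_def)
  have M0: "0 \<le> M" using M by (simp add: maxbound_def)
  have QQ: "cube q h \<subseteq> cube q s" using h by (intro cube_mono)
  have [measurable]: "f \<in> borel_measurable borel" using borel_measurable_integrable[OF f] by simp
  have inner: "ennreal D \<le> ennreal C * wavg r s f c" if c: "c \<in> cube q s" for c
  proof (rule ennreal_le_cmult_limit[OF C])
    fix X :: real assume X: "0 < X" and fX: "wavg r s f c \<le> ennreal X"
    have sq: "z \<in> sqbox c s" if "z \<in> cube q h" for z
      unfolding sqbox_def
    proof (intro CollectI allI)
      fix i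
      have "q $ i \<le> z $ i" "z $ i \<le> q $ i + h" "q $ i \<le> c $ i" "c $ i \<le> q $ i + s" using that c by (auto simp: mem_cube)
      then show "\<bar>z $ i - c $ i\<bar> \<le> s" using h by linarith
    qed
    have hh: "\<bar>x $ i - x' $ i\<bar> \<le> h" for i
    proof -
      have "q $ i \<le> x $ i" "x $ i \<le> q $ i + h" "q $ i \<le> x' $ i" "x' $ i \<le> q $ i + h" using x by (auto simp: mem_cube)
      then show ?thesis by linarith
    qed
    have "norm (op (a x) f x - op (a x') f x') \<le> CO * (B * (h * R) * ((R ^ ?n) powr (1 / r) * X powr (1 / r)))"
      by (rule local_oscillation_bound[OF f X fX[unfolded wavg_def] sq sq hh]) (use x in auto)
    then have "D \<le> (CO * (B * (h * R) * ((R ^ ?n) powr (1 / r) * X powr (1 / r)))) powr r"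
      unfolding D_def using r by (intro powr_mono2) auto
    also have "\<dots> = C * X"
      using CO_pos B h R X r by (simp add: C_def powr_mult powr_powr mult_ac)
    finally show "ennreal D \<le> ennreal (C * X)" by (rule ennreal_leI)
  qed
  have "ennreal (s ^ ?n) * ennreal D = (\<integral>\<^sup>+c. ennreal D * indicator (cube q s) c \<partial>lborel)"
    using s by (simp add: nn_integral_cmult_indicator emeasure_cube mult.commute)
  also have "\<dots> \<le> (\<integral>\<^sup>+c. ennreal C * (wavg r s f c * indicator (cube q s) c) \<partial>lborel)"
    using inner by (intro nn_integral_mono) (auto simp: indicator_def)
  also have "\<dots> = ennreal C * (\<integral>\<^sup>+c. wavg r s f c * indicator (cube q s) c \<partial>lborel)"
    by (rule nn_integral_cmult) simp
  also have "\<dots> \<le> ennreal C * (ennreal (s ^ ?n) * ennreal (wt_mass TYPE('n) * s ^ ?n * M))"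
    using wavg_cube_le[OF _ M s order_refl, of q] x0 QQ by (intro mult_left_mono) auto
  also have "\<dots> = ennreal (s ^ ?n) * ennreal (C * (wt_mass TYPE('n) * s ^ ?n * M))"
    using C by (simp add: ennreal_mult' mult_ac)
  finally have "ennreal (s ^ ?n) * ennreal D \<le> ennreal (s ^ ?n) * ennreal (C * (wt_mass TYPE('n) * s ^ ?n * M))" .
  then have "ennreal D \<le> ennreal (C * (wt_mass TYPE('n) * s ^ ?n * M))"
    using s by (subst (asm) ennreal_mult_le_mult_iff) auto
  moreover have "0 \<le> C * (wt_mass TYPE('n) * s ^ ?n * M)"
    using C M0 s wt_mass_nonneg[where 'n='n] by (intro mult_nonneg_nonneg) auto
  ultimately have "D \<le> C * (wt_mass TYPE('n) * s ^ ?n * M)" by simp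
  then show ?thesis by (simp add: D_def C_def mult_ac)
qed

end

section \<open>Dyadic decomposition of a symbol\<close>

text \<open>The x-derivatives are outermost, since \<open>ddlist\<close> applies the head of the
  list last. Towers in x therefore exist for every l, while the tower in \<xi> is taken with k = 0,
  and mixed derivatives never have to be interchanged.\<close>

definition dsym :: "(real^'n \<Rightarrow> real^'n \<Rightarrow> complex) \<Rightarrow> 'n \<Rightarrow> nat \<Rightarrow> 'n \<Rightarrow> nat \<Rightarrow> real^'n \<Rightarrow> real^'n \<Rightarrow> complex" where
  "dsym \<sigma> i l j k x \<xi> =
     ddlist (map pdir (replicate k (Inl j) @ replicate l (Inr i))) (\<lambda>z. \<sigma> (fst z) (snd z)) (x, \<xi>)"

lemma smooth_dirs_has_vector_derivative:
  assumes "smooth_dirs V g" "vs \<in> lists V" "v \<in> V"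
  shows "((\<lambda>t. ddlist vs g (z + t *\<^sub>R v)) has_vector_derivative ddlist (v # vs) g z) (at 0)"
  using assms unfolding smooth_dirs_def by (simp add: ddir_def vector_derivative_works[symmetric])

lemma map_pdir_lists: "map pdir ds \<in> lists (range pdir)"
  by (auto simp: lists_eq_set)

lemma dsym_00 [simp]: "dsym \<sigma> i 0 j 0 x \<xi> = \<sigma> x \<xi>"
  by (simp add: dsym_def)

lemma dsym_k0: "dsym \<sigma> i l j 0 x \<xi> = dsym \<sigma> i l j' 0 x \<xi>"
  by (simp add: dsym_def)

lemma tower_dsym_x:
  assumes "symbol_class m \<rho> \<delta> \<sigma>"
  shows "tower K (axis j 1) (\<lambda>k x. dsym \<sigma> i l j k x \<xi>)"
  unfolding tower_def
proof (intro allI impI)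
  fix k x
  let ?ds = "replicate k (Inl j) @ replicate l (Inr i)"
  have "((\<lambda>t. ddlist (map pdir ?ds) (\<lambda>z. \<sigma> (fst z) (snd z)) ((x, \<xi>) + t *\<^sub>R pdir (Inl j))) has_vector_derivative
      ddlist (pdir (Inl j) # map pdir ?ds) (\<lambda>z. \<sigma> (fst z) (snd z)) (x, \<xi>)) (at 0)"
    using assms map_pdir_lists by (intro smooth_dirs_has_vector_derivative) (auto simp: symbol_class_def)
  then show "((\<lambda>t. dsym \<sigma> i l j k (x + t *\<^sub>R axis j 1) \<xi>) has_vector_derivative dsym \<sigma> i l j (Suc k) x \<xi>) (at 0)"
    by (simp add: dsym_def pdir_def)
qed

lemma tower_dsym_\<xi>:
  assumes "symbol_class m \<rho> \<delta> \<sigma>"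
  shows "tower K (axis i 1) (\<lambda>l \<xi>. dsym \<sigma> i l j 0 x \<xi>)"
  unfolding tower_def
proof (intro allI impI)
  fix l \<xi>
  let ?ds = "replicate l (Inr i)"
  have "((\<lambda>t. ddlist (map pdir ?ds) (\<lambda>z. \<sigma> (fst z) (snd z)) ((x, \<xi>) + t *\<^sub>R pdir (Inr i))) has_vector_derivative
      ddlist (pdir (Inr i) # map pdir ?ds) (\<lambda>z. \<sigma> (fst z) (snd z)) (x, \<xi>)) (at 0)"
    using assms map_pdir_lists by (intro smooth_dirs_has_vector_derivative) (auto simp: symbol_class_def)
  then show "((\<lambda>t. dsym \<sigma> i l j 0 x (\<xi> + t *\<^sub>R axis i 1)) has_vector_derivative dsym \<sigma> i (Suc l) j 0 x \<xi>) (at 0)"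
    by (simp add: dsym_def pdir_def)
qed

lemma continuous_on_dsym:
  assumes "symbol_class m \<rho> \<delta> \<sigma>"
  shows "continuous_on UNIV (\<lambda>z. dsym \<sigma> i l j k (fst z) (snd z))"
proof -
  have "continuous_on UNIV (ddlist (map pdir (replicate k (Inl j) @ replicate l (Inr i))) (\<lambda>z. \<sigma> (fst z) (snd z)))"
    using assms map_pdir_lists unfolding symbol_class_def smooth_dirs_def by blast
  then show ?thesis by (simp add: dsym_def)
qed

lemma dsym_bound:
  fixes \<sigma> :: "real^'n \<Rightarrow> real^'n \<Rightarrow> complex"
  assumes "symbol_class m \<rho> \<delta> \<sigma>"
  obtains C where "0 < C" "\<And>i l j k x \<xi>. l \<le> K \<Longrightarrow> k \<le> K \<Longrightarrow>
    norm (dsym \<sigma> i l j k x \<xi>) \<le> C * (1 + norm \<xi>) powr (m + \<delta> * real k - \<rho> * real l)"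
proof -
  have "\<forall>ds :: ('n + 'n) list. \<exists>C. \<forall>x \<xi>.
        norm (ddlist (map pdir ds) (\<lambda>z. \<sigma> (fst z) (snd z)) (x, \<xi>))
          \<le> C * (1 + norm \<xi>) powr (m + \<delta> * real (length (filter isl ds)) - \<rho> * real (length (filter (\<lambda>d. \<not> isl d) ds)))"
    using assms unfolding symbol_class_def by blast
  from choice[OF this] obtain c where "\<forall>ds :: ('n + 'n) list. \<forall>x \<xi>.
        norm (ddlist (map pdir ds) (\<lambda>z. \<sigma> (fst z) (snd z)) (x, \<xi>))
          \<le> c ds * (1 + norm \<xi>) powr (m + \<delta> * real (length (filter isl ds)) - \<rho> * real (length (filter (\<lambda>d. \<not> isl d) ds)))"
    by blast
  then have c: "norm (ddlist (map pdir ds) (\<lambda>z. \<sigma> (fst z) (snd z)) (x, \<xi>))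
          \<le> c ds * (1 + norm \<xi>) powr (m + \<delta> * real (length (filter isl ds)) - \<rho> * real (length (filter (\<lambda>d. \<not> isl d) ds)))"
    for ds :: "('n + 'n) list" and x \<xi> by blast
  define d where "d = (\<lambda>(i :: 'n, l, j :: 'n, k). \<bar>c (replicate k (Inl j) @ replicate l (Inr i))\<bar>)"
  define S where "S = (UNIV :: 'n set) \<times> {..K} \<times> (UNIV :: 'n set) \<times> {..K}"
  have S: "finite S" by (simp add: S_def)
  show ?thesis
  \<comment> \<open>Finitely many derivatives occur, so the sum of their constants serves all of
    them; 1 is added for strict positivity.\<close>
  proof (rule that[of "1 + (\<Sum>q\<in>S. d q)"])
    show "0 < 1 + (\<Sum>q\<in>S. d q)" by (intro add_pos_nonneg sum_nonneg) (auto simp: d_def)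
    fix i l j k x \<xi> assume lk: "l \<le> K" "k \<le> K"
    let ?ds = "replicate k (Inl j) @ replicate l (Inr i) :: ('n + 'n) list"
    have len: "length (filter isl ?ds) = k" "length (filter (\<lambda>d. \<not> isl d) ?ds) = l" by simp_all
    have "d (i, l, j, k) \<le> (\<Sum>q\<in>S. d q)" using lk by (intro member_le_sum S) (auto simp: S_def d_def)
    then have "c ?ds \<le> 1 + (\<Sum>q\<in>S. d q)" by (simp add: d_def)
    then show "norm (dsym \<sigma> i l j k x \<xi>) \<le> (1 + (\<Sum>q\<in>S. d q)) * (1 + norm \<xi>) powr (m + \<delta> * real k - \<rho> * real l)"
      using c[of ?ds x \<xi>] unfolding dsym_def len
      by (elim order_trans) (rule mult_right_mono, auto)
  qed
qed

section \<open>A dyadic partition of unity in frequency\<close>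

context cutoff
begin

text \<open>Differences of consecutive dilates, so that partial sums telescope to one cutoff; p = 0
  keeps the whole low-frequency cutoff. The argument l is the order of differentiation along axis
  i.\<close>

definition \<Psi> :: "nat \<Rightarrow> 'n \<Rightarrow> nat \<Rightarrow> real^'n \<Rightarrow> complex" where
  "\<Psi> p i l \<xi> = \<Phi>s (1 / 2 ^ p) 0 i l \<xi> - (if p = 0 then 0 else \<Phi>s (1 / 2 ^ (p - 1)) 0 i l \<xi>)"

text \<open>The index \<open>undefined\<close> is harmless: \<open>\<Psi> p i 0\<close> does not depend on \<open>i\<close>.\<close>
definition \<psi> :: "nat \<Rightarrow> real^'n \<Rightarrow> complex" where
  "\<psi> p \<xi> = \<Psi> p undefined 0 \<xi>"

lemma \<Phi>s_0: "\<Phi>s q c i 0 \<xi> = \<Phi>s q c j 0 \<xi>"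
  by (simp add: \<Phi>s_def \<Phi>_0)

lemma \<Psi>_0: "\<Psi> p i 0 \<xi> = \<psi> p \<xi>"
  unfolding \<psi>_def \<Psi>_def by (simp only: \<Phi>s_0[of _ _ i _ undefined])

lemma tower_\<Psi>: "tower (4 * CARD('n)) (axis i 1) (\<Psi> p i)"
  using tower_\<Phi>s[of i "1 / 2 ^ p" 0] tower_\<Phi>s[of i "1 / 2 ^ (p - 1)" 0]
  by (cases "p = 0") (auto simp: tower_def \<Psi>_def intro!: has_vector_derivative_diff)

lemma continuous_on_\<Psi>: "l \<le> 4 * CARD('n) \<Longrightarrow> continuous_on UNIV (\<Psi> p i l)"
  unfolding \<Psi>_def by (cases "p = 0") (auto intro!: continuous_intros continuous_on_\<Phi>s)

text \<open>The narrower dilate has the larger rate 2/2^(p-1) = 4/2^p, and the factor 2 counts the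
  two dilates.\<close>

lemma norm_\<Psi>_le:
  assumes "l \<le> 4 * CARD('n)"
  shows "norm (\<Psi> p i l \<xi>) \<le> 2 * (4 / 2 ^ p) ^ l"
proof -
  have 1: "norm (\<Phi>s (1 / 2 ^ p) 0 i l \<xi>) \<le> (4 / 2 ^ p) ^ l"
    by (rule order_trans[OF norm_\<Phi>s_le[OF assms]]) (auto intro!: power_mono simp: divide_simps)
  have 2: "norm (if p = 0 then 0 else \<Phi>s (1 / 2 ^ (p - 1)) 0 i l \<xi>) \<le> (4 / 2 ^ p) ^ l"
  proof (cases p)
    case (Suc p')
    have "norm (\<Phi>s (1 / 2 ^ p') 0 i l \<xi>) \<le> 1 * (2 * (1 / 2 ^ p')) ^ l" by (rule norm_\<Phi>s_le[OF assms]) simp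
    then show ?thesis by (simp add: Suc)
  qed simp
  show ?thesis unfolding \<Psi>_def using norm_triangle_ineq4 1 2
    by (smt (verit) norm_triangle_ineq4)
qed

lemma \<Psi>_eq_0_outside:
  assumes "l \<le> 4 * CARD('n)" "\<xi> \<notin> sqbox 0 (L * 2 ^ p)"
  shows "\<Psi> p i l \<xi> = 0"
proof -
  have 1: "\<Phi>s (1 / 2 ^ p) 0 i l \<xi> = 0" using \<Phi>s_eq_0[of l "1 / 2 ^ p" \<xi> 0 i] assms by simp
  have "\<Phi>s (1 / 2 ^ (p - 1)) 0 i l \<xi> = 0" if "p \<noteq> 0"
  proof -
    have "L * 2 ^ (p - 1) \<le> L * 2 ^ p" using L_ge_1 by (intro mult_left_mono power_increasing) auto
    then have "\<xi> \<notin> sqbox 0 (L * 2 ^ (p - 1))" using assms(2) unfolding sqbox_def by (auto intro: order_trans)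
    then show ?thesis using \<Phi>s_eq_0[of l "1 / 2 ^ (p - 1)" \<xi> 0 i] assms by simp
  qed
  with 1 show ?thesis by (simp add: \<Psi>_def)
qed

lemma \<Psi>_eq_0_inside:
  assumes "l \<le> 4 * CARD('n)" "0 < p" "\<xi> \<in> sqbox 0 (2 ^ (p - 1))"
  shows "\<Psi> p i l \<xi> = 0"
proof -
  have "(2::real) ^ (p - 1) \<le> 2 ^ p" by (intro power_increasing) auto
  then have "\<xi> \<in> sqbox 0 (2 ^ p)" using assms(3) unfolding sqbox_def by (auto intro: order_trans)
  then show ?thesis using \<Phi>s_plateau[of \<xi> 0 "1 / 2 ^ p" l i] \<Phi>s_plateau[of \<xi> 0 "1 / 2 ^ (p - 1)" l i] assms
    by (simp add: \<Psi>_def)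
qed

lemma sum_\<psi>: "(\<Sum>p\<le>P. \<psi> p \<xi>) = \<Phi>s (1 / 2 ^ P) 0 undefined 0 \<xi>"
  by (induction P) (auto simp: \<psi>_def \<Psi>_def)

lemma norm_sum_\<psi>_le: "norm (\<Sum>p\<le>P. \<psi> p \<xi>) \<le> 1"
  using norm_\<Phi>s_le[of 0 "1 / 2 ^ P" 0 undefined \<xi>] by (simp add: sum_\<psi>)

lemma sum_\<psi>_tendsto: "(\<lambda>P. \<Sum>p\<le>P. \<psi> p \<xi>) \<longlonglongrightarrow> 1"
proof (rule tendsto_eventually)
  obtain P0 :: nat where P0: "norm \<xi> < 2 ^ P0" using real_arch_pow[of 2 "norm \<xi>"] by auto
  show "\<forall>\<^sub>F P in sequentially. (\<Sum>p\<le>P. \<psi> p \<xi>) = 1"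
    using eventually_ge_at_top[of P0]
  proof eventually_elim
    case (elim P)
    have "\<bar>\<xi> $ i\<bar> \<le> 2 ^ P" for i
    proof -
      have "\<bar>\<xi> $ i\<bar> \<le> norm \<xi>" by (rule component_le_norm_cart)
      also have "\<dots> \<le> 2 ^ P0" using P0 by simp
      also have "\<dots> \<le> (2::real) ^ P" using elim by (intro power_increasing) auto
      finally show ?thesis .
    qed
    then have "\<xi> \<in> sqbox 0 (1 / (1 / 2 ^ P))" by (simp add: sqbox_def)
    then show ?case unfolding sum_\<psi> by (subst \<Phi>s_plateau) auto
  qed
qed

lemma annulus_norm:
  fixes \<xi> :: "real^'n"
  assumes "\<xi> \<in> sqbox 0 (L * 2 ^ p)" "p = 0 \<or> \<xi> \<notin> sqbox 0 (2 ^ (p - 1))"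
  shows "1 / (2 + real CARD('n) * L) \<le> (1 + norm \<xi>) / 2 ^ p" "(1 + norm \<xi>) / 2 ^ p \<le> 2 + real CARD('n) * L"
proof -
  have L0: "0 \<le> real CARD('n) * L" using L_ge_1 by simp
  have "1 / 2 \<le> (1 + norm \<xi>) / 2 ^ p"
  proof (cases p)
    case (Suc p')
    then obtain i where "2 ^ p' < \<bar>\<xi> $ i\<bar>" using assms by (auto simp: sqbox_def not_le)
    then have "2 ^ p' \<le> 1 + norm \<xi>" using component_le_norm_cart[of \<xi> i] by linarith
    then show ?thesis by (simp add: Suc field_simps)
  qed (use norm_ge_zero[of \<xi>] in simp)
  moreover have "1 / (2 + real CARD('n) * L) \<le> 1 / 2" using L0 by (simp add: divide_simps)
  ultimately show "1 / (2 + real CARD('n) * L) \<le> (1 + norm \<xi>) / 2 ^ p" by linarith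
  have "norm \<xi> \<le> (\<Sum>i\<in>UNIV. \<bar>\<xi> $ i\<bar>)" by (rule norm_le_l1_cart)
  also have "\<dots> \<le> (\<Sum>i\<in>(UNIV::'n set). L * 2 ^ p)" using assms by (intro sum_mono) (auto simp: sqbox_def)
  finally have "norm \<xi> \<le> real CARD('n) * L * 2 ^ p" by simp
  moreover have "(1::real) \<le> 2 ^ p" by simp
  ultimately have "1 + norm \<xi> \<le> (2 + real CARD('n) * L) * 2 ^ p" unfolding distrib_right by linarith
  then show "(1 + norm \<xi>) / 2 ^ p \<le> 2 + real CARD('n) * L" by (simp add: divide_le_eq)
qed

text \<open>The exponent of 1 + |\<xi>| in the symbol estimates can have either sign, so
  comparability from both sides enters.\<close>

lemma powr_two_sided:
  fixes t E e F :: real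
  assumes "1 / E \<le> t" "t \<le> E" "1 \<le> E" "\<bar>e\<bar> \<le> F"
  shows "t powr e \<le> E powr F"
proof (cases "0 \<le> e")
  case True
  have t: "0 < t" using assms by (smt (verit) divide_pos_pos)
  have "t powr e \<le> E powr e" using True t assms by (intro powr_mono2) auto
  also have "\<dots> \<le> E powr F" using assms by (intro powr_mono) auto
  finally show ?thesis .
next
  case False
  have E0: "0 < 1 / E" using assms by simp
  have "t powr e \<le> (1 / E) powr e" using False assms E0 by (intro powr_mono2') auto
  also have "\<dots> = E powr (- e)" using assms by (simp add: powr_divide powr_minus_divide)
  also have "\<dots> \<le> E powr F" using assms by (intro powr_mono) auto
  finally show ?thesis .
qed

text \<open>On the support of the cutoff 1 + |\<xi>| is comparable with 2^p, which turns the symbol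
  estimate into one of the form B (1/s)^k s^l. Derivatives of the cutoff gain 4/2^p <= 4 s because
  \<rho> < 1, so they do no harm. The constant does not depend on p.\<close>

theorem symbol_piece:
  fixes \<sigma> :: "real^'n \<Rightarrow> real^'n \<Rightarrow> complex"
  assumes \<sigma>: "symbol_class m \<rho> \<rho> \<sigma>" and \<rho>: "0 < \<rho>" "\<rho> < 1" and r: "1 < r" "r \<le> 2"
  obtains C where "0 < C" "\<And>p. \<exists>\<beta> \<gamma>. piece \<theta> L (\<lambda>x \<xi>. \<sigma> x \<xi> * \<psi> p \<xi>) \<beta> \<gamma>
     (C * 2 powr (m * real p)) (2 powr (- \<rho> * real p)) (L * 2 ^ p) r"
proof -
  let ?K = "4 * CARD('n)"
  obtain C0 where C0: "0 < C0" "\<And>i l j k x \<xi>. l \<le> ?K \<Longrightarrow> k \<le> ?K \<Longrightarrow>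
    norm (dsym \<sigma> i l j k x \<xi>) \<le> C0 * (1 + norm \<xi>) powr (m + \<rho> * real k - \<rho> * real l)"
    using dsym_bound[OF \<sigma>, of ?K] by blast
  define E where "E = 2 + real CARD('n) * L"
  have E: "1 \<le> E" using L_ge_1 by (simp add: E_def)
  define F where "F = \<bar>m\<bar> + real ?K"
  \<comment> \<open>The symbol constant, the comparability of 1 + |\<xi>| with 2^p, the bound 2 for
    the cutoff, and 5 = 1 + 4 from the Leibniz rates s and 4 s.\<close>
  define C where "C = C0 * E powr F * 2 * 5 ^ ?K"
  have C: "0 < C" using C0 E by (simp add: C_def)
  show ?thesis
  proof (rule that[OF C])
    fix p :: nat
    define s where "s = 2 powr (- \<rho> * real p)"
    have s: "0 < s" by (simp add: s_def)
    have sp: "1 / s = 2 powr (\<rho> * real p)" by (simp add: s_def powr_minus_divide)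
    have s1: "1 / 2 ^ p \<le> s"
    proof -
      have "(1::real) / 2 ^ p = 2 powr (- real p)" by (simp add: powr_minus_divide powr_realpow)
      also have "\<dots> \<le> s" unfolding s_def using \<rho> by (intro powr_mono) (auto simp: mult_left_le_one_le)
      finally show ?thesis .
    qed
    \<comment> \<open>Leibniz' formula in \<xi> only, as the cutoff does not depend on x; the factor
      (1/s)^l normalises, so that all l obey the same bound.\<close>
    define \<gamma> where "\<gamma> i l j k x \<xi> = of_real ((1 / s) ^ l) * tmult (\<lambda>l \<xi>. dsym \<sigma> i l j k x \<xi>) (\<Psi> p i) l \<xi>" for i l j k x \<xi>
    \<comment> \<open>For k = 0 the direction of the x-derivative is immaterial, and i is a
      placeholder.\<close>
    define \<beta> where "\<beta> i l x \<xi> = \<gamma> i l i 0 x \<xi>" for i l x \<xi>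
    have dsym_annulus: "norm (dsym \<sigma> i l j k x \<xi>) \<le> C0 * E powr F * 2 powr (m * real p) * (1 / s) ^ k * s ^ l"
      if "l \<le> ?K" "k \<le> ?K" "\<xi> \<in> sqbox 0 (L * 2 ^ p)" "p = 0 \<or> \<xi> \<notin> sqbox 0 (2 ^ (p - 1))" for i l j k x \<xi>
    proof -
      define e where "e = m + \<rho> * real k - \<rho> * real l"
      have "\<bar>e\<bar> \<le> F"
      proof -
        have "\<rho> * real k \<le> real ?K" "\<rho> * real l \<le> real ?K" "0 \<le> \<rho> * real k" "0 \<le> \<rho> * real l"
          using that \<rho> mult_mono[of \<rho> 1 "real k" "real ?K"] mult_mono[of \<rho> 1 "real l" "real ?K"] by auto
        then show ?thesis unfolding e_def F_def by linarith
      qed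
      then have 1: "((1 + norm \<xi>) / 2 ^ p) powr e \<le> E powr F"
        using annulus_norm[OF that(3,4)] E unfolding E_def by (intro powr_two_sided) auto
      have "(1 + norm \<xi>) powr e = ((1 + norm \<xi>) / 2 ^ p) powr e * (2 ^ p) powr e"
        by (simp add: powr_mult[symmetric] add_nonneg_nonneg)
      also have "\<dots> \<le> E powr F * (2 ^ p) powr e" by (rule mult_right_mono[OF 1]) simp
      also have "(2 ^ p) powr e = 2 powr (m * real p) * (1 / s) ^ k * s ^ l"
      proof -
        have "(2 ^ p) powr e = 2 powr (real p * e)" by (simp add: powr_realpow[symmetric] powr_powr)
        also have "real p * e = m * real p + \<rho> * real p * real k + (- \<rho> * real p) * real l"
          by (simp add: e_def algebra_simps)
        also have "2 powr \<dots> = 2 powr (m * real p) * 2 powr (\<rho> * real p * real k) * 2 powr ((- \<rho> * real p) * real l)"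
          by (simp only: powr_add)
        also have "2 powr (\<rho> * real p * real k) = (1 / s) ^ k" unfolding sp by (subst powr_powr[symmetric], subst powr_realpow) auto
        also have "2 powr ((- \<rho> * real p) * real l) = s ^ l" unfolding s_def by (subst powr_powr[symmetric], subst powr_realpow) auto
        finally show ?thesis .
      qed
      finally have "(1 + norm \<xi>) powr e \<le> E powr F * (2 powr (m * real p) * (1 / s) ^ k * s ^ l)" .
      then have "C0 * (1 + norm \<xi>) powr e \<le> C0 * (E powr F * (2 powr (m * real p) * (1 / s) ^ k * s ^ l))"
        using C0 by (intro mult_left_mono) auto
      then show ?thesis using C0(2)[OF that(1,2), of i j x \<xi>] unfolding e_def by (simp add: mult.assoc)
    qed
    have \<gamma>0: "\<gamma> i l j 0 x \<xi> = \<beta> i l x \<xi>" for i l j x \<xi>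
      unfolding \<gamma>_def \<beta>_def dsym_k0[of \<sigma> i _ j _ _ i] ..
    have bd: "norm (\<gamma> i l j k x \<xi>) \<le> C * 2 powr (m * real p) * (1 / s) ^ k" if lk: "l \<le> ?K" "k \<le> ?K" for i l j k x \<xi>
    proof (cases "\<xi> \<in> sqbox 0 (L * 2 ^ p) \<and> (p = 0 \<or> \<xi> \<notin> sqbox 0 (2 ^ (p - 1)))")
      case True
      have "norm (tmult (\<lambda>l \<xi>. dsym \<sigma> i l j k x \<xi>) (\<Psi> p i) l \<xi>)
          \<le> (C0 * E powr F * 2 powr (m * real p) * (1 / s) ^ k) * 2 * (s + 4 * s) ^ l"
      proof (rule norm_tmult_le)
        fix l' assume "l' \<le> l"
        then have l': "l' \<le> ?K" using lk by simp
        show "norm (dsym \<sigma> i l' j k x \<xi>) \<le> C0 * E powr F * 2 powr (m * real p) * (1 / s) ^ k * s ^ l'"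
          using dsym_annulus[OF l' lk(2)] True by blast
        have "norm (\<Psi> p i l' \<xi>) \<le> 2 * (4 / 2 ^ p) ^ l'" by (rule norm_\<Psi>_le[OF l'])
        also have "\<dots> \<le> 2 * (4 * s) ^ l'" using s1 by (intro mult_left_mono power_mono) auto
        finally show "norm (\<Psi> p i l' \<xi>) \<le> 2 * (4 * s) ^ l'" .
      qed
      then have "norm (\<gamma> i l j k x \<xi>) \<le> (1 / s) ^ l * ((C0 * E powr F * 2 powr (m * real p) * (1 / s) ^ k) * 2 * (s + 4 * s) ^ l)"
        unfolding \<gamma>_def norm_mult norm_of_real using s by (intro mult_mono) auto
      also have "\<dots> = (C0 * E powr F * 2 powr (m * real p) * (1 / s) ^ k) * 2 * 5 ^ l"
      proof -
        have "(1 / s) ^ l * (s + 4 * s) ^ l = 5 ^ l" 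
          using s by (subst power_mult_distrib[symmetric]) (simp add: distrib_left)
        then show ?thesis by (simp add: mult_ac)
      qed
      also have "\<dots> \<le> (C0 * E powr F * 2 powr (m * real p) * (1 / s) ^ k) * 2 * 5 ^ ?K"
        using lk C0 s by (intro mult_left_mono power_increasing) auto
      finally show ?thesis by (simp add: C_def mult_ac)
    next
      case False
      have "\<Psi> p i l' \<xi> = 0" if "l' \<le> l" for l'
        using False \<Psi>_eq_0_outside[of l' \<xi> p i] \<Psi>_eq_0_inside[of l' p \<xi> i] that lk by auto
      then have "\<gamma> i l j k x \<xi> = 0" unfolding \<gamma>_def tmult_def by simp
      then show ?thesis using C s by simp
    qed
    have "piece \<theta> L (\<lambda>x \<xi>. \<sigma> x \<xi> * \<psi> p \<xi>) \<beta> \<gamma> (C * 2 powr (m * real p)) s (L * 2 ^ p) r"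
    proof unfold_locales
      show "0 < s" by (rule s)
      show "0 \<le> C * 2 powr (m * real p)" using C by simp
      show "0 < L * 2 ^ p" using L_ge_1 by simp
      have "1 / s \<le> 2 ^ p" using s1 s by (simp add: field_simps)
      also have "\<dots> \<le> L * 2 ^ p" using L_ge_1 by simp
      finally show "1 / s \<le> L * 2 ^ p" .
      show "1 < r" "r \<le> 2" by (fact r)+
      show "\<beta> i 0 x \<xi> = \<sigma> x \<xi> * \<psi> p \<xi>" for i x \<xi> by (simp add: \<beta>_def \<gamma>_def tmult_def \<Psi>_0)
      show "\<gamma> i l j 0 x \<xi> = \<beta> i l x \<xi>" for i l j x \<xi> by (rule \<gamma>0)
      show "norm (\<gamma> i l j k x \<xi>) \<le> C * 2 powr (m * real p) * (1 / s) ^ k" if "l \<le> ?K" "k \<le> ?K" for i l j k x \<xi>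
        by (rule bd[OF that])
      show "tower ?K (axis i 1) (\<lambda>l \<xi>. of_real (s ^ l) * \<beta> i l x \<xi>)" for i x
      proof -
        have "of_real (s ^ l) * \<beta> i l x \<xi> = tmult (\<lambda>l \<xi>. dsym \<sigma> i l i 0 x \<xi>) (\<Psi> p i) l \<xi>" for l \<xi>
          using s by (simp add: \<beta>_def \<gamma>_def power_divide)
        then show ?thesis using tower_mult[OF tower_dsym_\<xi>[OF \<sigma>] tower_\<Psi>] by simp
      qed
      show "tower ?K (axis j 1) (\<lambda>k x. \<gamma> i l j k x \<xi>)" for i l j \<xi>
        unfolding tower_def
      proof (intro allI impI)
        fix k x assume k: "k < ?K"
        have d: "((\<lambda>t. dsym \<sigma> i l' j k (x + t *\<^sub>R axis j 1) \<xi>) has_vector_derivative dsym \<sigma> i l' j (Suc k) x \<xi>) (at 0)" for l'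
          using tower_dsym_x[OF \<sigma>, of ?K j i l' \<xi>] k by (auto simp: tower_def)
        show "((\<lambda>t. \<gamma> i l j k (x + t *\<^sub>R axis j 1) \<xi>) has_vector_derivative \<gamma> i l j (Suc k) x \<xi>) (at 0)"
          unfolding \<gamma>_def tmult_def
          by (intro has_vector_derivative_mult_right has_vector_derivative_sum has_vector_derivative_mult_left d)
      qed
      show "\<beta> i l x \<xi> = 0" if "l \<le> ?K" "\<xi> \<notin> sqbox 0 (L * 2 ^ p)" for i l x \<xi>
      proof -
        have "\<Psi> p i l' \<xi> = 0" if "l' \<le> l" for l'
          using \<Psi>_eq_0_outside[of l' \<xi> p i] that \<open>l \<le> ?K\<close> \<open>\<xi> \<notin> _\<close> by auto
        then show ?thesis unfolding \<beta>_def \<gamma>_def tmult_def by simp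
      qed
      show "continuous_on UNIV (\<lambda>z. \<gamma> i l j k (fst z) (snd z))" if "l \<le> ?K" for i l j k
      proof -
        have "continuous_on UNIV (\<lambda>z::(real^'n) \<times> (real^'n). \<Psi> p i l' (snd z))" if "l' \<le> l" for l'
          using that \<open>l \<le> ?K\<close> by (intro continuous_on_compose2[OF continuous_on_\<Psi>[of l' p i]] continuous_intros) auto
        then show ?thesis unfolding \<gamma>_def tmult_def
          by (intro continuous_intros continuous_on_dsym[OF \<sigma>]) auto
      qed
    qed
    then show "\<exists>\<beta> \<gamma>. piece \<theta> L (\<lambda>x \<xi>. \<sigma> x \<xi> * \<psi> p \<xi>) \<beta> \<gamma>
        (C * 2 powr (m * real p)) (2 powr (- \<rho> * real p)) (L * 2 ^ p) r"
      unfolding s_def by blast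
  qed
qed

end

section \<open>Schwartz functions\<close>

lemma wt_lower: "1 \<le> (1 + real CARD('n)) * (1 + norm x) ^ (4 * CARD('n)) * wt x" for x :: "real^'n"
proof -
  let ?K = "4 * CARD('n)"
  have "(\<Sum>i\<in>UNIV. (x $ i) ^ ?K) \<le> (\<Sum>i\<in>(UNIV::'n set). (1 + norm x) ^ ?K)"
  proof (rule sum_mono)
    fix i
    have "(x $ i) ^ ?K = \<bar>x $ i\<bar> ^ ?K" by (simp add: power_even_abs)
    also have "\<dots> \<le> (1 + norm x) ^ ?K" using component_le_norm_cart[of x i] by (intro power_mono) auto
    finally show "(x $ i) ^ ?K \<le> (1 + norm x) ^ ?K" .
  qed
  also have "\<dots> = real CARD('n) * (1 + norm x) ^ ?K" by simp
  finally have "(\<Sum>i\<in>UNIV. (x $ i) ^ ?K) \<le> real CARD('n) * (1 + norm x) ^ ?K" .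
  moreover have "1 \<le> (1 + norm x) ^ ?K" by (intro one_le_power) simp
  ultimately have "1 + (\<Sum>i\<in>UNIV. (x $ i) ^ ?K) \<le> (1 + real CARD('n)) * (1 + norm x) ^ ?K"
    unfolding distrib_right mult_1 by linarith
  then have "wt x * (1 + (\<Sum>i\<in>UNIV. (x $ i) ^ ?K)) \<le> wt x * ((1 + real CARD('n)) * (1 + norm x) ^ ?K)"
    by (rule mult_left_mono) (rule less_imp_le[OF wt_pos])
  then show ?thesis unfolding wt_inverse by (simp add: mult_ac)
qed

text \<open>Decay that is uniform under unit shifts is what \<open>tower_integral_ch\<close> demands
  of its dominating function.\<close>

lemma schwartz_decay:
  fixes f :: "real^'n \<Rightarrow> complex"
  assumes f: "schwartz f" and vs: "vs \<in> lists coord_dirs"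
  obtains C where "0 \<le> C" "\<And>x y. norm y \<le> 1 \<Longrightarrow> norm (ddlist vs f (x + y)) \<le> C * wt x"
proof -
  let ?K = "4 * CARD('n)"
  obtain C0 where C0: "\<And>x. (1 + norm x) ^ ?K * norm (ddlist vs f x) \<le> C0"
    using f vs unfolding schwartz_def by blast
  have C00: "0 \<le> C0" using C0[of 0] by (simp add: order_trans[OF norm_ge_zero])
  show ?thesis
  proof (rule that[of "(1 + real CARD('n)) * 2 ^ ?K * C0"])
    show "0 \<le> (1 + real CARD('n)) * 2 ^ ?K * C0" using C00 by simp
    fix x y :: "real^'n" assume y: "norm y \<le> 1"
    let ?g = "norm (ddlist vs f (x + y))"
    have "norm x \<le> norm (x + y) + norm y" using norm_triangle_ineq4[of "x + y" y] by simp
    then have "1 + norm x \<le> 2 * (1 + norm (x + y))" using y norm_ge_zero[of "x + y"] by (smt (verit))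
    then have "(1 + norm x) ^ ?K \<le> (2 * (1 + norm (x + y))) ^ ?K" by (intro power_mono) auto
    then have 1: "(1 + norm x) ^ ?K \<le> 2 ^ ?K * (1 + norm (x + y)) ^ ?K" by (simp only: power_mult_distrib)
    have "?g * 1 \<le> ?g * ((1 + real CARD('n)) * (1 + norm x) ^ ?K * wt x)"
      by (intro mult_left_mono wt_lower) simp
    also have "\<dots> \<le> ?g * ((1 + real CARD('n)) * (2 ^ ?K * (1 + norm (x + y)) ^ ?K) * wt x)"
      by (intro mult_left_mono mult_right_mono 1) (auto simp: less_imp_le[OF wt_pos])
    also have "\<dots> = ((1 + real CARD('n)) * 2 ^ ?K * ((1 + norm (x + y)) ^ ?K * ?g)) * wt x" by (simp only: mult_ac)
    also have "\<dots> \<le> ((1 + real CARD('n)) * 2 ^ ?K * C0) * wt x"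
      by (intro mult_right_mono mult_left_mono C0) (auto simp: less_imp_le[OF wt_pos])
    finally show "?g \<le> (1 + real CARD('n)) * 2 ^ ?K * C0 * wt x" by simp
  qed
qed

lemma schwartz_continuous: "schwartz f \<Longrightarrow> vs \<in> lists coord_dirs \<Longrightarrow> continuous_on UNIV (ddlist vs f)"
  unfolding schwartz_def smooth_dirs_def by blast

lemma schwartz_integrable:
  fixes f :: "real^'n \<Rightarrow> complex"
  assumes f: "schwartz f"
  shows "integrable lborel f"
proof -
  obtain C where C: "0 \<le> C" "\<And>x y. norm y \<le> 1 \<Longrightarrow> norm (ddlist [] f (x + y)) \<le> C * wt x"
    using schwartz_decay[OF f, of "[]"] by blast
  have c: "continuous_on UNIV f" using schwartz_continuous[OF f, of "[]"] by simp
  show ?thesis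
  proof (rule Bochner_Integration.integrable_bound)
    show "integrable lborel (\<lambda>x::real^'n. C * wt x)" using integrable_wt[where 'n='n] by simp
    show "f \<in> borel_measurable lborel" using borel_measurable_continuous_onI[OF c] by simp
    show "AE x in lborel. norm (f x) \<le> norm (C * wt x)"
      using C(2)[of 0] C(1) by (auto simp: abs_mult less_imp_le[OF wt_pos])
  qed
qed

text \<open>Integration by parts, 4n times along each axis. The bound is qualitative: its constant
  depends on f and serves integrability and passages to the limit, not the final estimate.\<close>

lemma schwartz_ft_decay:
  fixes f :: "real^'n \<Rightarrow> complex"
  assumes f: "schwartz f"
  obtains C where "0 \<le> C" "\<And>\<xi>. norm (ft f \<xi>) \<le> C * wt \<xi>"
proof -
  let ?K = "4 * CARD('n)"
  have ax: "replicate k (axis i 1) \<in> lists coord_dirs" for k and i :: 'n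
    by (auto simp: coord_dirs_def lists_eq_set)
  have "\<exists>A\<ge>0. \<forall>\<xi>. (\<xi> $ i) ^ ?K * norm (ft f \<xi>) \<le> A" for i
  proof -
    define p where "p k = ddlist (replicate k (axis i 1)) f" for k
    have "\<exists>C\<ge>0. \<forall>x y. norm y \<le> 1 \<longrightarrow> norm (p k (x + y)) \<le> C * wt x" for k
      using schwartz_decay[OF f ax, of k i] unfolding p_def by metis
    then obtain c where c: "\<And>k. 0 \<le> c k" "\<And>k x y. norm y \<le> 1 \<Longrightarrow> norm (p k (x + y)) \<le> c k * wt x"
      by metis
    define D where "D = (\<Sum>k\<le>?K. c k)"
    have cD: "c k \<le> D" if "k \<le> ?K" for k unfolding D_def using that c by (intro member_le_sum) auto
    have tow: "tower ?K (axis i 1) p"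
      unfolding tower_def p_def
    proof (intro allI impI)
      fix k x
      show "((\<lambda>t. ddlist (replicate k (axis i 1)) f (x + t *\<^sub>R axis i 1)) has_vector_derivative
          ddlist (replicate (Suc k) (axis i 1)) f x) (at 0)"
        using f smooth_dirs_has_vector_derivative[OF _ ax, of f "axis i 1" k i x]
        by (simp add: schwartz_def coord_dirs_def)
    qed
    have pm: "p k \<in> borel_measurable borel" for k
      unfolding p_def by (intro borel_measurable_continuous_onI schwartz_continuous[OF f ax])
    have H: "norm (p k (x + t *\<^sub>R axis i 1)) \<le> D * wt x" if "k \<le> ?K" "\<bar>t\<bar> \<le> 1" for k x t
    proof -
      have "norm (p k (x + t *\<^sub>R axis i 1)) \<le> c k * wt x" using that by (intro c) simp
      also have "\<dots> \<le> D * wt x" using cD[OF that(1)] by (intro mult_right_mono) (auto simp: less_imp_le[OF wt_pos])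
      finally show ?thesis .
    qed
    have HI: "integrable lborel (\<lambda>x::real^'n. D * wt x)" using integrable_wt[where 'n='n] by simp
    have "(\<xi> $ i) ^ ?K * norm (ft f \<xi>) \<le> (\<integral>x. D * wt (x::real^'n) \<partial>lborel)" for \<xi>
    proof -
      have "(\<integral>x. p ?K x * ch x (- \<xi>) \<partial>lborel)
         = (- (2 * pi * \<i> * of_real (axis i 1 \<bullet> (- \<xi>)))) ^ ?K * (\<integral>x. p 0 x * ch x (- \<xi>) \<partial>lborel)"
        by (rule tower_integral_ch[OF tow pm HI H]) auto
      then have eq: "(\<integral>x. p ?K x * ch x (- \<xi>) \<partial>lborel) = (2 * pi * \<i> * of_real (\<xi> $ i)) ^ ?K * ft f \<xi>"
        by (simp add: ft_def p_def ch_uminus inner_axis')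
      have b: "norm (p ?K x * ch x (- \<xi>)) \<le> D * wt x" for x
        using H[of ?K 0 x] by (simp add: norm_mult)
      have "integrable lborel (\<lambda>x. p ?K x * ch x (- \<xi>))"
        by (rule Bochner_Integration.integrable_bound[OF HI])
           (use pm[of ?K] b in \<open>auto intro!: AE_I2 intro: order_trans[OF _ abs_ge_self]\<close>)
      then have "norm (\<integral>x. p ?K x * ch x (- \<xi>) \<partial>lborel) \<le> (\<integral>x. D * wt (x::real^'n) \<partial>lborel)"
        by (rule Bochner_Integration.integral_norm_bound_integral[OF _ HI b])
      then have 1: "(2 * pi * \<bar>\<xi> $ i\<bar>) ^ ?K * norm (ft f \<xi>) \<le> (\<integral>x. D * wt (x::real^'n) \<partial>lborel)"
        unfolding eq by (simp add: norm_mult norm_power)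
      have "(\<xi> $ i) ^ ?K = \<bar>\<xi> $ i\<bar> ^ ?K" by (simp add: power_even_abs)
      also have "\<dots> \<le> (2 * pi * \<bar>\<xi> $ i\<bar>) ^ ?K"
        using pi_gt3 by (intro power_mono) (auto intro!: mult_le_cancel_right1[THEN iffD2])
      finally show ?thesis using 1 by (meson mult_right_mono norm_ge_zero order_trans)
    qed
    moreover have "0 \<le> (\<integral>x. D * wt (x::real^'n) \<partial>lborel)"
      using c by (intro Bochner_Integration.integral_nonneg) (auto simp: D_def less_imp_le[OF wt_pos] intro!: mult_nonneg_nonneg sum_nonneg)
    ultimately show ?thesis by blast
  qed
  then obtain A where A: "\<And>i. 0 \<le> A i" "\<And>i \<xi>. (\<xi> $ i) ^ ?K * norm (ft f \<xi>) \<le> A i" by metis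
  define A0 where "A0 = (\<integral>y. norm (f y) \<partial>lborel)"
  show ?thesis
  proof (rule that[of "A0 + (\<Sum>i\<in>UNIV. A i)"])
    show "0 \<le> A0 + (\<Sum>i\<in>UNIV. A i)" using A by (auto simp: A0_def intro!: add_nonneg_nonneg sum_nonneg)
    fix \<xi> :: "real^'n"
    let ?W = "1 + (\<Sum>i\<in>UNIV. (\<xi> $ i) ^ ?K)"
    have "norm (ft f \<xi>) = wt \<xi> * ?W * norm (ft f \<xi>)" by (simp only: wt_inverse mult_1)
    also have "\<dots> = wt \<xi> * (norm (ft f \<xi>) + (\<Sum>i\<in>UNIV. (\<xi> $ i) ^ ?K * norm (ft f \<xi>)))"
      by (simp only: mult.assoc distrib_right mult_1 sum_distrib_right)
    also have "\<dots> \<le> wt \<xi> * (A0 + (\<Sum>i\<in>UNIV. A i))"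
      unfolding A0_def by (intro mult_left_mono add_mono sum_mono A norm_ft_le less_imp_le[OF wt_pos])
    finally show "norm (ft f \<xi>) \<le> (A0 + (\<Sum>i\<in>UNIV. A i)) * wt \<xi>" by (simp only: mult.commute)
  qed
qed

lemma schwartz_integrable_ft:
  fixes f :: "real^'n \<Rightarrow> complex"
  assumes f: "schwartz f"
  shows "integrable lborel (ft f)"
proof -
  obtain C where C: "0 \<le> C" "\<And>\<xi>. norm (ft f \<xi>) \<le> C * wt \<xi>" using schwartz_ft_decay[OF f] by blast
  have [measurable]: "f \<in> borel_measurable borel" using borel_measurable_integrable[OF schwartz_integrable[OF f]] by simp
  show ?thesis
    by (rule Bochner_Integration.integrable_bound[where f="\<lambda>\<xi>::real^'n. C * wt \<xi>"])
       (use C integrable_wt[where 'n='n] in \<open>auto simp: abs_mult less_imp_le[OF wt_pos]\<close>)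
qed

lemma fourier_eq_ft:
  assumes f: "integrable lborel f"
  shows "fourier f = ft f"
proof
  fix \<xi>
  have "integrable lborel (\<lambda>y. f y * cnj (ch y \<xi>))"
    by (rule Bochner_Integration.integrable_bound[OF f])
       (use borel_measurable_integrable[OF f] in \<open>auto simp: norm_mult\<close>)
  then show "fourier f \<xi> = ft f \<xi>"
    unfolding fourier_def ft_def exp_eq_ch by (rule integral_lborel)
qed

lemma symbol_class_bounded:
  assumes \<sigma>: "symbol_class m \<rho> \<delta> \<sigma>" and m: "m \<le> 0"
  obtains C where "0 < C" "\<And>x \<xi>. norm (\<sigma> x \<xi>) \<le> C"
proof -
  obtain C where C: "0 < C" "\<And>i l j k x \<xi>. l \<le> 0 \<Longrightarrow> k \<le> 0 \<Longrightarrow>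
    norm (dsym \<sigma> i l j k x \<xi>) \<le> C * (1 + norm \<xi>) powr (m + \<delta> * real k - \<rho> * real l)"
    using dsym_bound[OF \<sigma>, of 0] by blast
  show ?thesis
  proof (rule that[OF C(1)])
    fix x \<xi>
    have "norm (\<sigma> x \<xi>) \<le> C * (1 + norm \<xi>) powr m" using C(2)[of 0 0 undefined undefined x \<xi>] by simp
    also have "\<dots> \<le> C * (1 + norm \<xi>) powr 0" using C m by (intro mult_left_mono powr_mono) auto
    also have "(1 + norm \<xi>) powr 0 = 1" 
    proof -
      have "1 + norm \<xi> \<noteq> 0" using norm_ge_zero[of \<xi>] by linarith
      then show ?thesis by simp
    qed
    finally show "norm (\<sigma> x \<xi>) \<le> C" by simp
  qed
qed

lemma symbol_class_measurable:
  assumes \<sigma>: "symbol_class m \<rho> \<delta> \<sigma>"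
  shows "(\<lambda>z. \<sigma> (fst z) (snd z)) \<in> borel_measurable (borel \<Otimes>\<^sub>M borel)" "\<sigma> x \<in> borel_measurable borel"
proof -
  have "continuous_on UNIV (\<lambda>z. \<sigma> (fst z) (snd z))"
    using continuous_on_dsym[OF \<sigma>, of undefined 0 undefined 0] by simp
  then show 1: "(\<lambda>z. \<sigma> (fst z) (snd z)) \<in> borel_measurable (borel \<Otimes>\<^sub>M borel)"
    unfolding borel_prod by (rule borel_measurable_continuous_onI)
  show "\<sigma> x \<in> borel_measurable borel" using measurable_compose[OF measurable_Pair1' 1] by simp
qed

text \<open>m <= 0 makes the symbol bounded and hence the integrand absolutely integrable, where the
  gauge integral of \<open>psido\<close> agrees with the Lebesgue integral.\<close>

lemma psido_eq_op:
  assumes \<sigma>: "symbol_class m \<rho> \<delta> \<sigma>" and m: "m \<le> 0" and f: "schwartz f"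
  shows "psido \<sigma> f x = op (\<sigma> x) f x"
proof -
  obtain C where C: "0 < C" "\<And>x \<xi>. norm (\<sigma> x \<xi>) \<le> C" using symbol_class_bounded[OF \<sigma> m] by blast
  have [measurable]: "\<sigma> x \<in> borel_measurable borel" by (rule symbol_class_measurable[OF \<sigma>])
  have [measurable]: "f \<in> borel_measurable borel" using borel_measurable_integrable[OF schwartz_integrable[OF f]] by simp
  have "integrable lborel (\<lambda>\<xi>. \<sigma> x \<xi> * ft f \<xi> * ch x \<xi>)"
    by (rule Bochner_Integration.integrable_bound[where f="\<lambda>\<xi>. C * norm (ft f \<xi>)"])
       (use C schwartz_integrable_ft[OF f] in \<open>auto simp: norm_mult intro!: AE_I2 mult_right_mono\<close>)
  then show ?thesis
    unfolding psido_def op_def exp_eq_ch fourier_eq_ft[OF schwartz_integrable[OF f]] by (rule integral_lborel)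
qed

text \<open>The partial sums of the partition telescope to a cutoff of modulus at most 1 that is
  eventually 1 at each \<xi>; dominated convergence against a multiple of |\<open>ft f\<close>| does
  the rest.\<close>

lemma (in cutoff) dyadic_sum_tendsto:
  fixes \<sigma> :: "real^'n \<Rightarrow> real^'n \<Rightarrow> complex"
  assumes \<sigma>: "symbol_class m \<rho> \<delta> \<sigma>" and m: "m \<le> 0" and f: "schwartz f"
  shows "(\<lambda>P. \<Sum>p\<le>P. op (\<lambda>\<xi>. \<sigma> x \<xi> * \<psi> p \<xi>) f x) \<longlonglongrightarrow> psido \<sigma> f x"
proof -
  obtain C where C: "0 < C" "\<And>x \<xi>. norm (\<sigma> x \<xi>) \<le> C" using symbol_class_bounded[OF \<sigma> m] by blast
  have [measurable]: "\<sigma> x \<in> borel_measurable borel" by (rule symbol_class_measurable[OF \<sigma>])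
  have [measurable]: "f \<in> borel_measurable borel" using borel_measurable_integrable[OF schwartz_integrable[OF f]] by simp
  have [measurable]: "\<psi> p \<in> borel_measurable borel" for p
    unfolding \<psi>_def by (intro borel_measurable_continuous_onI continuous_on_\<Psi>) simp
  have fi: "integrable lborel (\<lambda>\<xi>. C * norm (ft f \<xi>))" using schwartz_integrable_ft[OF f] by simp
  have int: "integrable lborel (\<lambda>\<xi>. \<sigma> x \<xi> * \<psi> p \<xi> * ft f \<xi> * ch x \<xi>)" for p
  proof (rule Bochner_Integration.integrable_bound)
    show "integrable lborel (\<lambda>\<xi>. C * 2 * norm (ft f \<xi>))" using schwartz_integrable_ft[OF f] by simp
    have "norm (\<psi> p \<xi>) \<le> 2" for \<xi> using norm_\<Psi>_le[of 0 p undefined \<xi>] by (simp add: \<psi>_def)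
    then show "AE \<xi> in lborel. norm (\<sigma> x \<xi> * \<psi> p \<xi> * ft f \<xi> * ch x \<xi>) \<le> norm (C * 2 * norm (ft f \<xi>))"
      using C by (auto simp: norm_mult intro!: AE_I2 mult_right_mono mult_mono)
  qed measurable
  have eq: "(\<Sum>p\<le>P. op (\<lambda>\<xi>. \<sigma> x \<xi> * \<psi> p \<xi>) f x) = (\<integral>\<xi>. \<sigma> x \<xi> * (\<Sum>p\<le>P. \<psi> p \<xi>) * ft f \<xi> * ch x \<xi> \<partial>lborel)" for P
  proof -
    have "(\<Sum>p\<le>P. op (\<lambda>\<xi>. \<sigma> x \<xi> * \<psi> p \<xi>) f x) = (\<integral>\<xi>. (\<Sum>p\<le>P. \<sigma> x \<xi> * \<psi> p \<xi> * ft f \<xi> * ch x \<xi>) \<partial>lborel)"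
      unfolding op_def by (rule Bochner_Integration.integral_sum[symmetric]) (rule int)
    also have "\<dots> = (\<integral>\<xi>. \<sigma> x \<xi> * (\<Sum>p\<le>P. \<psi> p \<xi>) * ft f \<xi> * ch x \<xi> \<partial>lborel)"
      by (simp only: sum_distrib_left sum_distrib_right)
    finally show ?thesis .
  qed
  have "(\<lambda>P. \<integral>\<xi>. \<sigma> x \<xi> * (\<Sum>p\<le>P. \<psi> p \<xi>) * ft f \<xi> * ch x \<xi> \<partial>lborel) \<longlonglongrightarrow> (\<integral>\<xi>. \<sigma> x \<xi> * ft f \<xi> * ch x \<xi> \<partial>lborel)"
  proof (rule integral_dominated_convergence[OF _ _ fi])
    have "(\<lambda>P. \<sigma> x \<xi> * (\<Sum>p\<le>P. \<psi> p \<xi>) * ft f \<xi> * ch x \<xi>) \<longlonglongrightarrow> \<sigma> x \<xi> * 1 * ft f \<xi> * ch x \<xi>" for \<xi>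
      by (intro tendsto_intros sum_\<psi>_tendsto)
    then show "AE \<xi> in lborel. (\<lambda>P. \<sigma> x \<xi> * (\<Sum>p\<le>P. \<psi> p \<xi>) * ft f \<xi> * ch x \<xi>) \<longlonglongrightarrow> \<sigma> x \<xi> * ft f \<xi> * ch x \<xi>"
      by simp
    show "AE \<xi> in lborel. norm (\<sigma> x \<xi> * (\<Sum>p\<le>P. \<psi> p \<xi>) * ft f \<xi> * ch x \<xi>) \<le> C * norm (ft f \<xi>)" for P
    proof (intro AE_I2)
      fix \<xi>
      have "norm (\<sigma> x \<xi>) * norm (\<Sum>p\<le>P. \<psi> p \<xi>) \<le> C * 1" by (intro mult_mono C norm_sum_\<psi>_le) (use C in auto)
      then show "norm (\<sigma> x \<xi> * (\<Sum>p\<le>P. \<psi> p \<xi>) * ft f \<xi> * ch x \<xi>) \<le> C * norm (ft f \<xi>)"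
        by (simp add: norm_mult mult_right_mono)
    qed
  qed measurable
  moreover have "psido \<sigma> f x = (\<integral>\<xi>. \<sigma> x \<xi> * ft f \<xi> * ch x \<xi> \<partial>lborel)"
    by (simp only: psido_eq_op[OF \<sigma> m f] op_def)
  ultimately show ?thesis unfolding eq by (simp only:)
qed

section \<open>Summation over the dyadic scales\<close>

text \<open>Jensen's inequality for t^r at the points u_p / w_p with weights proportional to w_p. It
  stands in for Minkowski's inequality when the terms are expected to have size w_p.\<close>

lemma weighted_power_mean:
  fixes w u :: "nat \<Rightarrow> real"
  assumes S: "finite S" and w: "\<And>p. p \<in> S \<Longrightarrow> 0 < w p" and u: "\<And>p. p \<in> S \<Longrightarrow> 0 \<le> u p" and r: "1 \<le> r"
  shows "(\<Sum>p\<in>S. u p) powr r \<le> (\<Sum>p\<in>S. w p) powr (r - 1) * (\<Sum>p\<in>S. w p powr (1 - r) * u p powr r)"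
proof -
  \<comment> \<open>Vanishing terms are dropped so that the convexity of t^r is applied at positive
    points only.\<close>
  define T where "T = {p \<in> S. 0 < u p}"
  have T: "finite T" "T \<subseteq> S" using S by (auto simp: T_def)
  have rhs0: "0 \<le> (\<Sum>p\<in>S. w p) powr (r - 1) * (\<Sum>p\<in>S. w p powr (1 - r) * u p powr r)"
    by (intro mult_nonneg_nonneg sum_nonneg) auto
  have sumT: "(\<Sum>p\<in>S. u p) = (\<Sum>p\<in>T. u p)"
    by (rule sum.mono_neutral_right) (use S T u in \<open>auto simp: T_def not_less intro: antisym\<close>)
  show ?thesis
  proof (cases "T = {}")
    case True
    then have "(\<Sum>p\<in>S. u p) = 0" using sumT by simp
    then show ?thesis using rhs0 by simp
  next
    case False
    define W where "W = (\<Sum>p\<in>T. w p)"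
    have wT: "0 < w p" "0 < u p" if "p \<in> T" for p using that w by (auto simp: T_def)
    have W: "0 < W" unfolding W_def by (intro sum_pos T False wT)
    have "(\<Sum>p\<in>T. (w p / W) *\<^sub>R (u p / w p)) powr r \<le> (\<Sum>p\<in>T. (w p / W) * (u p / w p) powr r)"
    proof (rule convex_on_sum[OF T(1) False powr_convex[OF r]])
      show "(\<Sum>p\<in>T. w p / W) = 1" using W by (simp add: sum_divide_distrib[symmetric] W_def)
    qed (use wT W in \<open>auto intro: less_imp_le\<close>)
    also have "(\<Sum>p\<in>T. (w p / W) *\<^sub>R (u p / w p)) = (\<Sum>p\<in>T. u p) / W"
      unfolding sum_divide_distrib by (intro sum.cong refl) (use wT in \<open>force\<close>)
    also have "(\<Sum>p\<in>T. (w p / W) * (u p / w p) powr r) = (\<Sum>p\<in>T. w p powr (1 - r) * u p powr r) / W"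
      unfolding sum_divide_distrib
    proof (intro sum.cong refl)
      fix p assume "p \<in> T"
      note * = wT[OF this]
      have "w p * (u p / w p) powr r = w p powr 1 * (u p powr r / w p powr r)" using * by (simp add: powr_divide)
      also have "\<dots> = w p powr (1 - r) * u p powr r" by (simp add: powr_diff)
      finally show "w p / W * (u p / w p) powr r = w p powr (1 - r) * u p powr r / W" by simp
    qed
    finally have "((\<Sum>p\<in>T. u p) / W) powr r \<le> (\<Sum>p\<in>T. w p powr (1 - r) * u p powr r) / W" .
    then have "W powr r * ((\<Sum>p\<in>T. u p) / W) powr r \<le> W powr r * ((\<Sum>p\<in>T. w p powr (1 - r) * u p powr r) / W)"
      by (rule mult_left_mono) simp
    moreover have "W powr r * ((\<Sum>p\<in>T. u p) / W) powr r = (\<Sum>p\<in>T. u p) powr r"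
      using W wT by (simp add: powr_mult[symmetric] sum_nonneg less_imp_le)
    moreover have "W powr r * ((\<Sum>p\<in>T. w p powr (1 - r) * u p powr r) / W) = W powr (r - 1) * (\<Sum>p\<in>T. w p powr (1 - r) * u p powr r)"
      using W by (simp add: powr_diff)
    ultimately have "(\<Sum>p\<in>T. u p) powr r \<le> W powr (r - 1) * (\<Sum>p\<in>T. w p powr (1 - r) * u p powr r)" by simp
    also have "\<dots> \<le> (\<Sum>p\<in>S. w p) powr (r - 1) * (\<Sum>p\<in>S. w p powr (1 - r) * u p powr r)"
    proof (intro mult_mono powr_mono2)
      show "W \<le> (\<Sum>p\<in>S. w p)" unfolding W_def by (intro sum_mono2 S T) (use w in \<open>auto intro: less_imp_le\<close>)
      show "(\<Sum>p\<in>T. w p powr (1 - r) * u p powr r) \<le> (\<Sum>p\<in>S. w p powr (1 - r) * u p powr r)"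
        by (intro sum_mono2 S T) auto
    qed (use r W in \<open>auto intro: sum_nonneg\<close>)
    finally show ?thesis by (simp only: sumT)
  qed
qed

text \<open>A triangle inequality in L^r: terms of norm A^(1/r) w_p add up to at most A^(1/r) S.
  Jensen with the weights w_p handles partial sums, and Fatou's lemma the limit.\<close>

lemma lr_sum_bound:
  fixes u :: "nat \<Rightarrow> real^'n \<Rightarrow> complex"
  assumes [measurable]: "\<And>p. u p \<in> borel_measurable borel" "Q \<in> sets borel"
    and w: "\<And>p. 0 < w p" and wS: "\<And>P. (\<Sum>p\<le>P. w p) \<le> S" and r: "1 < r" and A: "0 \<le> A"
    and bd: "\<And>p. (\<integral>\<^sup>+x. ennreal (norm (u p x) powr r) * indicator Q x \<partial>lborel) \<le> ennreal (A * w p powr r)"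
    and lim: "\<And>x. (\<lambda>P. \<Sum>p\<le>P. u p x) \<longlonglongrightarrow> v x"
  shows "(\<integral>\<^sup>+x. ennreal (norm (v x) powr r) * indicator Q x \<partial>lborel) \<le> ennreal (A * S powr r)"
proof -
  have S0: "0 < S" using wS[of 0] w[of 0] by simp
  have part: "(\<integral>\<^sup>+x. ennreal (norm (\<Sum>p\<le>P. u p x) powr r) * indicator Q x \<partial>lborel) \<le> ennreal (A * S powr r)" for P
  proof -
    define W where "W = (\<Sum>p\<le>P. w p)"
    have W0: "0 < W" unfolding W_def by (intro sum_pos w) auto
    have "(\<integral>\<^sup>+x. ennreal (norm (\<Sum>p\<le>P. u p x) powr r) * indicator Q x \<partial>lborel)
      \<le> (\<integral>\<^sup>+x. ennreal (W powr (r - 1)) * (\<Sum>p\<le>P. ennreal (w p powr (1 - r)) * (ennreal (norm (u p x) powr r) * indicator Q x)) \<partial>lborel)"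
    proof (rule nn_integral_mono)
      fix x
      have "norm (\<Sum>p\<le>P. u p x) powr r \<le> (\<Sum>p\<le>P. norm (u p x)) powr r"
        using r by (intro powr_mono2 norm_sum) auto
      also have "\<dots> \<le> W powr (r - 1) * (\<Sum>p\<le>P. w p powr (1 - r) * norm (u p x) powr r)"
        unfolding W_def using r w by (intro weighted_power_mean) auto
      finally have "ennreal (norm (\<Sum>p\<le>P. u p x) powr r) \<le> ennreal (W powr (r - 1) * (\<Sum>p\<le>P. w p powr (1 - r) * norm (u p x) powr r))"
        by (rule ennreal_leI)
      also have "\<dots> = ennreal (W powr (r - 1)) * (\<Sum>p\<le>P. ennreal (w p powr (1 - r)) * ennreal (norm (u p x) powr r))"
        by (simp add: ennreal_mult sum_nonneg sum_ennreal[symmetric])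
      finally have "ennreal (norm (\<Sum>p\<le>P. u p x) powr r) * indicator Q x \<le> \<dots> * indicator Q x"
        by (rule mult_right_mono) simp
      then show "ennreal (norm (\<Sum>p\<le>P. u p x) powr r) * indicator Q x
        \<le> ennreal (W powr (r - 1)) * (\<Sum>p\<le>P. ennreal (w p powr (1 - r)) * (ennreal (norm (u p x) powr r) * indicator Q x))"
        by (simp only: mult.assoc sum_distrib_right)
    qed
    also have "\<dots> = ennreal (W powr (r - 1)) * (\<Sum>p\<le>P. ennreal (w p powr (1 - r)) * (\<integral>\<^sup>+x. ennreal (norm (u p x) powr r) * indicator Q x \<partial>lborel))"
      by (simp add: nn_integral_cmult nn_integral_sum)
    also have "\<dots> \<le> ennreal (W powr (r - 1)) * (\<Sum>p\<le>P. ennreal (w p powr (1 - r)) * ennreal (A * w p powr r))"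
      by (intro mult_left_mono sum_mono bd) auto
    also have "\<dots> = ennreal (W powr (r - 1) * (\<Sum>p\<le>P. w p powr (1 - r) * (A * w p powr r)))"
      using A by (simp add: ennreal_mult sum_nonneg sum_ennreal[symmetric])
    also have "(\<Sum>p\<le>P. w p powr (1 - r) * (A * w p powr r)) = A * W"
    proof -
      have "w p powr (1 - r) * w p powr r = w p" for p using w[of p] by (simp add: powr_add[symmetric])
      then have e: "w p powr (1 - r) * (A * w p powr r) = A * w p" for p by (metis mult.left_commute)
      show ?thesis unfolding W_def sum_distrib_left e ..
    qed
    also have "W powr (r - 1) * (A * W) = A * W powr r" using W0 by (simp add: powr_diff)
    also have "ennreal (A * W powr r) \<le> ennreal (A * S powr r)"
      using A W0 wS[of P] r by (intro ennreal_leI mult_left_mono powr_mono2) (auto simp: W_def)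
    finally show ?thesis .
  qed
  have "(\<integral>\<^sup>+x. ennreal (norm (v x) powr r) * indicator Q x \<partial>lborel)
     = (\<integral>\<^sup>+x. liminf (\<lambda>P. ennreal (norm (\<Sum>p\<le>P. u p x) powr r) * indicator Q x) \<partial>lborel)"
  proof (rule nn_integral_cong)
    fix x
    have "(\<lambda>P. ennreal (norm (\<Sum>p\<le>P. u p x) powr r) * indicator Q x) \<longlonglongrightarrow> ennreal (norm (v x) powr r) * indicator Q x"
    proof (cases "x \<in> Q")
      case True
      have "(\<lambda>P. norm (\<Sum>p\<le>P. u p x) powr r) \<longlonglongrightarrow> norm (v x) powr r"
        using r by (intro tendsto_powr' tendsto_norm lim tendsto_const) auto
      then show ?thesis using True by (simp add: tendsto_ennrealI)
    qed simp
    then show "ennreal (norm (v x) powr r) * indicator Q x = liminf (\<lambda>P. ennreal (norm (\<Sum>p\<le>P. u p x) powr r) * indicator Q x)"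
      by (simp add: lim_imp_Liminf)
  qed
  also have "\<dots> \<le> liminf (\<lambda>P. \<integral>\<^sup>+x. ennreal (norm (\<Sum>p\<le>P. u p x) powr r) * indicator Q x \<partial>lborel)"
    by (rule nn_integral_liminf) measurable
  also have "\<dots> \<le> ennreal (A * S powr r)"
    using part by (intro Liminf_le) auto
  finally show ?thesis .
qed

text \<open>The terms grow geometrically until 2^p h reaches 1 and decay geometrically afterwards,
  which makes the bound independent of h.\<close>

lemma two_sided_geometric_sum:
  fixes h :: real
  assumes h: "0 < h"
  defines "y \<equiv> 2 powr (- 1 / 2)"
  defines "t \<equiv> \<lambda>p::nat. if 2 ^ p * h < 1 then 2 ^ p * h else (2 ^ p * h) powr (- 1 / 2)"
  shows "(\<Sum>p\<le>P. t p) \<le> 3 + y / (1 - y)"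
proof -
  have y: "0 < y" "y < 1" unfolding y_def by (auto simp: powr_less_one)
  \<comment> \<open>The solution of (1 + D) y = D: \<open>D\<close> times a term of the decaying
    part is the sum of all later terms, so the induction below reproduces its own invariant.\<close>
  define D where "D = y / (1 - y)"
  have D: "0 \<le> D" "(1 + D) * y = D" using y by (auto simp: D_def field_simps)
  have t1: "t p \<le> 1" for p
  proof (cases "2 ^ p * h < 1")
    case False
    then have "(2 ^ p * h) powr (- 1 / 2) \<le> (2 ^ p * h) powr 0" by (intro powr_mono) auto
    then show ?thesis using False h by (simp add: t_def)
  qed (simp add: t_def)
  \<comment> \<open>Before the threshold the sum is at most twice its last term. After it, a reserve
    for the whole tail is carried along; 3 is 2 for the rising part plus 1 for the first term past
    the threshold.\<close>
  have "(2 ^ P * h < 1 \<longrightarrow> (\<Sum>p\<le>P. t p) \<le> 2 * (2 ^ P * h)) \<and>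
    (\<not> 2 ^ P * h < 1 \<longrightarrow> (\<Sum>p\<le>P. t p) + D * (2 ^ P * h) powr (- 1 / 2) \<le> 3 + D)"
  proof (induction P)
    case 0
    have "h powr (- 1 / 2) \<le> 1" if "\<not> h < 1"
      using that powr_mono[of "- 1 / 2" 0 h] by simp
    then have "D * h powr (- 1 / 2) \<le> D * 1" if "\<not> h < 1" using that D by (intro mult_left_mono) auto
    then show ?case using h t1[of 0] by (auto simp: t_def)
  next
    case (Suc P)
    have x: "0 < 2 ^ P * h" using h by simp
    have eq: "2 ^ Suc P * h = 2 * (2 ^ P * h)" by simp
    show ?case
    proof (intro conjI impI)
      assume a: "2 ^ Suc P * h < 1"
      then have "2 ^ P * h < 1" using x unfolding eq by linarith
      then have "(\<Sum>p\<le>P. t p) \<le> 2 * (2 ^ P * h)" using Suc by blast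
      moreover have "t (Suc P) = 2 ^ Suc P * h" using a by (simp add: t_def)
      ultimately show "(\<Sum>p\<le>Suc P. t p) \<le> 2 * (2 ^ Suc P * h)" unfolding sum.atMost_Suc eq by linarith
    next
      assume a: "\<not> 2 ^ Suc P * h < 1"
      define z where "z = (2 ^ Suc P * h) powr (- 1 / 2)"
      have tz: "t (Suc P) = z" using a by (simp add: t_def z_def)
      show "(\<Sum>p\<le>Suc P. t p) + D * (2 ^ Suc P * h) powr (- 1 / 2) \<le> 3 + D"
      proof (cases "2 ^ P * h < 1")
        case True
        then have "(\<Sum>p\<le>P. t p) \<le> 2" using Suc by linarith
        moreover have "z \<le> 1" using t1[of "Suc P"] tz by simp
        moreover have "D * z \<le> D * 1" using \<open>z \<le> 1\<close> D by (intro mult_left_mono) auto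
        ultimately show ?thesis unfolding sum.atMost_Suc tz z_def[symmetric] by linarith
      next
        case False
        have "z = y * (2 ^ P * h) powr (- 1 / 2)" unfolding z_def eq y_def by (rule powr_mult)
        then have "z + D * z = ((1 + D) * y) * (2 ^ P * h) powr (- 1 / 2)" by (simp add: algebra_simps)
        then have "z + D * z = D * (2 ^ P * h) powr (- 1 / 2)" by (simp only: D)
        moreover have "(\<Sum>p\<le>P. t p) + D * (2 ^ P * h) powr (- 1 / 2) \<le> 3 + D" using Suc False by blast
        ultimately show ?thesis unfolding sum.atMost_Suc tz z_def[symmetric] by linarith
      qed
    qed
  qed
  moreover have pos: "0 \<le> D * (2 ^ P * h) powr (- 1 / 2)" using D by (intro mult_nonneg_nonneg) auto
  ultimately have "(\<Sum>p\<le>P. t p) \<le> 3 + D" using D(1) by linarith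
  then show ?thesis by (simp add: D_def)
qed

lemma powr_geometric_sum:
  fixes e :: real
  assumes e: "0 < e"
  shows "(\<Sum>p\<le>P. 2 powr (- e * real p)) \<le> 1 / (1 - 2 powr (- e))"
proof -
  define x where "x = 2 powr (- e)"
  have x: "0 < x" "x < 1" using e by (auto simp: x_def powr_less_one)
  have "2 powr (- e * real p) = x ^ p" for p
    unfolding x_def by (subst powr_powr[symmetric], subst powr_realpow) auto
  then have "(1 - x) * (\<Sum>p\<le>P. 2 powr (- e * real p)) = 1 - x ^ Suc P"
    by (simp only: sum_gp_basic)
  also have "\<dots> \<le> 1" using x by simp
  finally show ?thesis using x by (simp add: x_def[symmetric] field_simps)
qed

section \<open>The critical order and the sum over all pieces\<close>

context cutoff
begin

text \<open>The identity behind the critical order: m r = - n (1 - \<rho>), while 2^p s = 2^((1 -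
  \<rho>) p).\<close>

lemma piece_scaling:
  fixes m \<rho> r :: real and p :: nat
  assumes r: "1 < r" and m: "m = - (real CARD('n) / r) * (1 - \<rho>)"
  shows "(2 powr (m * real p)) powr r * ((2 ^ p) ^ CARD('n) * (2 powr (- \<rho> * real p)) ^ CARD('n)) = 1"
proof -
  let ?n = "real CARD('n)"
  have "(2::real) ^ p = 2 powr real p" by (simp add: powr_realpow)
  then have "((2::real) ^ p) ^ CARD('n) = 2 powr (real p * ?n)"
    by (simp add: powr_powr[symmetric] powr_realpow)
  moreover have "(2 powr (- \<rho> * real p)) ^ CARD('n) = 2 powr (- \<rho> * real p * ?n)"
    by (subst powr_powr[symmetric], subst powr_realpow) auto
  moreover have "(2 powr (m * real p)) powr r = 2 powr (- ?n * (1 - \<rho>) * real p)"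
    using r by (simp add: powr_powr m)
  ultimately show ?thesis by (simp add: powr_add[symmetric] algebra_simps)
qed

text \<open>\<open>piece_scaling\<close> removes all powers of 2^p and s from
  \<open>cube_lr_bound\<close> except for the decay in 2^p min h s.\<close>

lemma piece_lr:
  fixes a :: "real^'n \<Rightarrow> real^'n \<Rightarrow> complex"
  assumes pc: "piece \<theta> L a \<beta> \<gamma> (C * 2 powr (m * real p)) (2 powr (- \<rho> * real p)) (L * 2 ^ p) r"
    and C: "0 < C" and m: "m = - (real CARD('n) / r) * (1 - \<rho>)"
    and f: "integrable lborel f" and M: "maxbound r f x0 M" and h: "0 < h" and x0: "x0 \<in> cube q h"
  shows "(\<integral>\<^sup>+x. ennreal (norm (op (a x) f x) powr r) * indicator (cube q h) x \<partial>lborel)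
    \<le> ennreal ((CL + 2 ^ CARD('n)) * wt_mass TYPE('n) * (C powr r * (L ^ CARD('n)) powr (1 - r / 2)) *
        (h ^ CARD('n) * M) * (2 ^ p * min h (2 powr (- \<rho> * real p))) powr (- (real CARD('n) * r / 2)))"
proof -
  let ?n = "CARD('n)"
  define s where "s = 2 powr (- \<rho> * real p)"
  define k where "k = min h s"
  define H where "H = max h s"
  define y :: real where "y = 2 ^ p"
  define B where "B = 2 powr (m * real p)"
  have r: "1 < r" "r \<le> 2" using pc by (auto simp: piece_def piece_axioms_def)
  have pos: "0 < s" "0 < k" "0 < H" "0 < y" "0 < B" "0 < L"
    using h L_ge_1 by (auto simp: s_def k_def H_def y_def B_def)
  have Z: "B powr r * (y ^ ?n * s ^ ?n) = 1"
    unfolding B_def y_def s_def by (rule piece_scaling[OF r(1) m])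
  \<comment> \<open>The product of minimum and maximum merges the cases h <= s and h > s into one
    formula.\<close>
  have kH: "k * H = h * s" by (auto simp: k_def H_def min_def max_def)
  have "((L * y) ^ ?n * k ^ ?n) powr (1 - r / 2) = (L ^ ?n) powr (1 - r / 2) * ((y * k) ^ ?n * (y * k) powr (- (real ?n * r / 2)))"
  proof -
    have "((L * y) ^ ?n * k ^ ?n) = L ^ ?n * (y * k) ^ ?n" by (simp add: power_mult_distrib)
    then have "((L * y) ^ ?n * k ^ ?n) powr (1 - r / 2) = (L ^ ?n) powr (1 - r / 2) * ((y * k) ^ ?n) powr (1 - r / 2)"
      by (simp only: powr_mult)
    also have "((y * k) ^ ?n) powr (1 - r / 2) = (y * k) powr (real ?n + - (real ?n * r / 2))"
    proof -
      have "(y * k) ^ ?n = (y * k) powr real ?n" using pos by (simp only: powr_realpow mult_pos_pos)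
      moreover have "real ?n * (1 - r / 2) = real ?n + - (real ?n * r / 2)" by (simp add: algebra_simps)
      ultimately show ?thesis by (simp only: powr_powr)
    qed
    also have "\<dots> = (y * k) ^ ?n * (y * k) powr (- (real ?n * r / 2))"
      using pos by (simp only: powr_add powr_realpow mult_pos_pos)
    finally show ?thesis .
  qed
  then have "(C * B) powr r * ((L * y) ^ ?n * k ^ ?n) powr (1 - r / 2) * H ^ ?n * M
     = (C powr r * (L ^ ?n) powr (1 - r / 2)) * (B powr r * ((y * k) ^ ?n * H ^ ?n)) * M * (y * k) powr (- (real ?n * r / 2))"
    by (simp only: powr_mult mult_ac)
  also have "B powr r * ((y * k) ^ ?n * H ^ ?n) = (B powr r * (y ^ ?n * s ^ ?n)) * h ^ ?n"
  proof -
    have "(y * k) ^ ?n * H ^ ?n = y ^ ?n * (h * s) ^ ?n"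
      unfolding kH[symmetric] by (simp only: power_mult_distrib mult_ac)
    then show ?thesis by (simp only: power_mult_distrib mult_ac)
  qed
  finally have "(C * B) powr r * ((L * y) ^ ?n * k ^ ?n) powr (1 - r / 2) * H ^ ?n * M
     = (C powr r * (L ^ ?n) powr (1 - r / 2)) * (h ^ ?n * M) * (y * k) powr (- (real ?n * r / 2))"
    by (simp add: Z)
  moreover have "(\<integral>\<^sup>+x. ennreal (norm (op (a x) f x) powr r) * indicator (cube q h) x \<partial>lborel)
    \<le> ennreal ((CL + 2 ^ ?n) * wt_mass TYPE('n) *
        ((C * B) powr r * ((L * y) ^ ?n * k ^ ?n) powr (1 - r / 2) * H ^ ?n * M))"
    unfolding B_def y_def k_def H_def s_def by (rule piece.cube_lr_bound[OF pc f M _ h x0]) (use C in simp)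
  ultimately show ?thesis by (simp only: y_def k_def s_def mult.assoc)
qed

lemma piece_oscillation:
  fixes a :: "real^'n \<Rightarrow> real^'n \<Rightarrow> complex"
  assumes pc: "piece \<theta> L a \<beta> \<gamma> (C * 2 powr (m * real p)) (2 powr (- \<rho> * real p)) (L * 2 ^ p) r"
    and C: "0 < C" and m: "m = - (real CARD('n) / r) * (1 - \<rho>)" and \<rho>: "\<rho> < 1"
    and f: "integrable lborel f" and M: "maxbound r f x0 M" and h: "0 < h" "2 ^ p * h < 1"
    and x0: "x0 \<in> cube q h" and x: "x \<in> cube q h" "x' \<in> cube q h"
  shows "norm (op (a x) f x - op (a x') f x') powr r
    \<le> CO powr r * wt_mass TYPE('n) * (C powr r * L powr r * L ^ CARD('n)) * M * (2 ^ p * h) powr r"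
proof -
  let ?n = "CARD('n)"
  define s where "s = 2 powr (- \<rho> * real p)"
  define y :: real where "y = 2 ^ p"
  define B where "B = 2 powr (m * real p)"
  have r: "1 < r" "r \<le> 2" using pc by (auto simp: piece_def piece_axioms_def)
  have Z: "B powr r * (y ^ ?n * s ^ ?n) = 1"
    unfolding B_def y_def s_def by (rule piece_scaling[OF r(1) m])
  \<comment> \<open>2^p h < 1 forces h <= 2^(-p) <= s because \<rho> < 1, so the cube fits into a
    box at scale s.\<close>
  have hs: "h \<le> s"
  proof -
    have "h \<le> 1 / 2 ^ p" using h by (simp add: field_simps)
    also have "(1::real) / 2 ^ p = 2 powr (- real p)" by (simp add: powr_minus_divide powr_realpow)
    also have "\<dots> \<le> s" unfolding s_def 
      using \<rho> mult_right_mono[of \<rho> 1 "real p"] by (intro powr_mono) auto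
    finally show ?thesis .
  qed
  have "norm (op (a x) f x - op (a x') f x') powr r
     \<le> CO powr r * wt_mass TYPE('n) * (((C * B) * (h * (L * y))) powr r * (L * y) ^ ?n * s ^ ?n * M)"
    unfolding B_def y_def s_def
    by (rule piece.cube_oscillation_bound[OF pc f M _ h(1) _ x0 x]) (use C hs in \<open>auto simp: s_def\<close>)
  also have "((C * B) * (h * (L * y))) powr r * (L * y) ^ ?n * s ^ ?n * M
     = (B powr r * (y ^ ?n * s ^ ?n)) * (C powr r * L powr r * L ^ ?n) * M * (y * h) powr r"
    by (simp only: powr_mult power_mult_distrib mult_ac)
  finally show ?thesis unfolding Z by (simp only: y_def mult_1 mult.assoc)
qed

text \<open>The constant is produced together with the estimate and vanishes for h >= 1, so that one
  statement serves both suprema of the sharp function.\<close>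

theorem cube_estimate:
  fixes \<sigma> :: "real^'n \<Rightarrow> real^'n \<Rightarrow> complex"
  assumes \<sigma>: "symbol_class m \<rho> \<rho> \<sigma>" and \<rho>: "0 < \<rho>" "\<rho> < 1" and r: "1 < r" "r \<le> 2"
    and m: "m = - (real CARD('n) / r) * (1 - \<rho>)"
  obtains C where "0 < C" "\<And>f x0 M q h. schwartz f \<Longrightarrow> maxbound r f x0 M \<Longrightarrow> 0 < h \<Longrightarrow> x0 \<in> cube q h \<Longrightarrow>
    \<exists>\<kappa>. (1 \<le> h \<longrightarrow> \<kappa> = 0) \<and>
      (\<integral>\<^sup>+x. ennreal (norm (psido \<sigma> f x - \<kappa>) powr r) * indicator (cube q h) x \<partial>lborel) \<le> ennreal (C * (h ^ CARD('n) * M))"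
proof -
  let ?n = "CARD('n)"
  have m0: "m \<le> 0" unfolding m using r \<rho> by (simp add: mult_nonneg_nonneg)
  obtain C where C: "0 < C" "\<And>p. \<exists>\<beta> \<gamma>. piece \<theta> L (\<lambda>x \<xi>. \<sigma> x \<xi> * \<psi> p \<xi>) \<beta> \<gamma>
     (C * 2 powr (m * real p)) (2 powr (- \<rho> * real p)) (L * 2 ^ p) r"
    using symbol_piece[OF \<sigma> \<rho> r] by blast
  define C3 where "C3 = (CL + 2 ^ ?n) * wt_mass TYPE('n) * (C powr r * (L ^ ?n) powr (1 - r / 2))"
  define C4 where "C4 = CO powr r * wt_mass TYPE('n) * (C powr r * L powr r * L ^ ?n)"
  have C34: "0 \<le> C3" "0 \<le> C4"
    using CL_nonneg wt_mass_nonneg[where 'n='n] L_ge_1 by (auto simp: C3_def C4_def)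
  \<comment> \<open>Chosen so that (2^p s)^(-1/2) = 2^(-e p), the decay that takes over once h
    exceeds s and that no longer depends on h.\<close>
  define e where "e = (1 - \<rho>) / 2"
  have e: "0 < e" using \<rho> by (simp add: e_def)
  define y :: real where "y = 2 powr (- 1 / 2)"
  define S where "S = 3 + y / (1 - y) + 1 / (1 - 2 powr (- e))"
  define CC where "CC = (C3 + C4) * S powr r + 1"
  have CC: "0 < CC" unfolding CC_def using C34 by (intro add_nonneg_pos mult_nonneg_nonneg) auto
  show ?thesis
  proof (rule that[OF CC])
    fix f :: "real^'n \<Rightarrow> complex" and x0 q :: "real^'n" and M h :: real
    assume f: "schwartz f" and M: "maxbound r f x0 M" and h: "0 < h" and x0: "x0 \<in> cube q h"
    have fi: "integrable lborel f" by (rule schwartz_integrable[OF f])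
    have M0: "0 \<le> M" using M by (simp add: maxbound_def)
    have [measurable]: "f \<in> borel_measurable borel" using borel_measurable_integrable[OF fi] by simp
    define T where "T p x = op (\<lambda>\<xi>. \<sigma> x \<xi> * \<psi> p \<xi>) f x" for p x
    have Tm [measurable]: "T p \<in> borel_measurable borel" for p
    proof -
      have [measurable]: "(\<lambda>z. \<sigma> (fst z) (snd z)) \<in> borel_measurable (borel \<Otimes>\<^sub>M borel)"
        by (rule symbol_class_measurable[OF \<sigma>])
      have [measurable]: "\<psi> p \<in> borel_measurable borel"
        unfolding \<psi>_def by (intro borel_measurable_continuous_onI continuous_on_\<Psi>) simp
      show ?thesis unfolding T_def by (rule borel_measurable_op) measurable
    qed
    define t where "t p = (if 2 ^ p * h < 1 then 2 ^ p * h else (2 ^ p * h) powr (- 1 / 2))" for p :: nat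
    \<comment> \<open>A piece obeys a bound governed by \<open>t p\<close> or by 2^(-e p); the sum
      of both covers either case and is summable uniformly in h.\<close>
    define w where "w p = t p + 2 powr (- e * real p)" for p :: nat
    \<comment> \<open>Pieces that barely oscillate over the cube are compared with their value at
      x0; the others are controlled on average without a subtraction.\<close>
    define \<kappa> where "\<kappa> p = (if 2 ^ p * h < 1 then T p x0 else 0)" for p :: nat
    have t0: "0 \<le> t p" for p using h by (simp add: t_def)
    have w0: "0 < w p" for p unfolding w_def by (intro add_nonneg_pos t0) simp
    have wS: "(\<Sum>p\<le>P. w p) \<le> S" for P
      using two_sided_geometric_sum[OF h, of P] powr_geometric_sum[OF e, of P]
      by (simp add: w_def t_def S_def y_def sum.distrib)
    define A where "A = (C3 + C4) * (h ^ ?n * M)"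
    have A0: "0 \<le> A" using C34 h M0 by (simp add: A_def)
    have bd: "(\<integral>\<^sup>+x. ennreal (norm (T p x - \<kappa> p) powr r) * indicator (cube q h) x \<partial>lborel) \<le> ennreal (A * w p powr r)" for p
    proof -
      obtain \<beta> \<gamma> where pc: "piece \<theta> L (\<lambda>x \<xi>. \<sigma> x \<xi> * \<psi> p \<xi>) \<beta> \<gamma> (C * 2 powr (m * real p)) (2 powr (- \<rho> * real p)) (L * 2 ^ p) r"
        using C(2) by blast
      show ?thesis
      proof (cases "2 ^ p * h < 1")
        case True
        have "norm (T p x - \<kappa> p) powr r \<le> C4 * M * (2 ^ p * h) powr r" if "x \<in> cube q h" for x
          using piece_oscillation[OF pc C(1) m \<rho>(2) fi M h True x0 that x0] True
          by (simp add: T_def \<kappa>_def C4_def)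
        then have "(\<integral>\<^sup>+x. ennreal (norm (T p x - \<kappa> p) powr r) * indicator (cube q h) x \<partial>lborel)
            \<le> (\<integral>\<^sup>+x. ennreal (C4 * M * (2 ^ p * h) powr r) * indicator (cube q h) x \<partial>lborel)"
          by (intro nn_integral_mono) (auto simp: indicator_def intro!: ennreal_leI)
        also have "\<dots> = ennreal (C4 * M * (2 ^ p * h) powr r) * ennreal (h ^ ?n)"
          using h by (simp add: nn_integral_cmult_indicator emeasure_cube)
        also have "\<dots> = ennreal (C4 * (h ^ ?n * M) * (2 ^ p * h) powr r)"
          using C34 M0 h by (simp add: ennreal_mult[symmetric] mult_ac)
        also have "\<dots> \<le> ennreal (A * w p powr r)"
        proof (intro ennreal_leI mult_mono)
          show "(2 ^ p * h) powr r \<le> w p powr r"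
            using True h r by (intro powr_mono2) (auto simp: w_def t_def)
          show "C4 * (h ^ ?n * M) \<le> A" unfolding A_def using C34 h M0 by (intro mult_right_mono) auto
        qed (use A0 in auto)
        finally show ?thesis .
      next
        case False
        define k where "k = min h (2 powr (- \<rho> * real p))"
        have k: "0 < k" using h by (simp add: k_def)
        have ys: "2 ^ p * 2 powr (- \<rho> * real p) = 2 powr (2 * e * real p)"
        proof -
          have "2 ^ p * 2 powr (- \<rho> * real p) = 2 powr (real p + - \<rho> * real p)"
            by (simp only: powr_add powr_realpow zero_less_numeral)
          also have "real p + - \<rho> * real p = 2 * e * real p" by (simp add: e_def algebra_simps)
          finally show ?thesis .
        qed
        have "1 \<le> 2 powr (2 * e * real p)" using e by (intro ge_one_powr_ge_zero) auto
        then have yk1: "1 \<le> 2 ^ p * k" using False ys by (auto simp: k_def min_def)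
        have yk: "(2 ^ p * k) powr (- 1 / 2) \<le> w p"
        proof (cases "h \<le> 2 powr (- \<rho> * real p)")
          case True
          then have "(2 ^ p * k) powr (- 1 / 2) = t p" using False by (simp add: k_def t_def)
          then show ?thesis by (simp add: w_def)
        next
          case F: False
          then have "(2 ^ p * k) powr (- 1 / 2) = (2 powr (2 * e * real p)) powr (- 1 / 2)" using ys by (simp add: k_def)
          also have "\<dots> = 2 powr (- e * real p)" by (simp add: powr_powr)
          finally show ?thesis using t0[of p] by (simp add: w_def)
        qed
        \<comment> \<open>Since n >= 1 and the base is at least 1, the decay exponent n/2 may be
          weakened to 1/2, the one used in \<open>t\<close>.\<close>
        have "(2 ^ p * k) powr (- (real ?n * r / 2)) \<le> (2 ^ p * k) powr (- 1 / 2 * r)"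
        proof (rule powr_mono[OF _ yk1])
          have "1 * r \<le> real ?n * r" using r by (intro mult_right_mono) (auto simp: Suc_leI)
          then show "- (real ?n * r / 2) \<le> - 1 / 2 * r" by simp
        qed
        also have "\<dots> = ((2 ^ p * k) powr (- 1 / 2)) powr r" by (simp add: powr_powr)
        also have "\<dots> \<le> w p powr r" using yk r by (intro powr_mono2) auto
        finally have kw: "(2 ^ p * k) powr (- (real ?n * r / 2)) \<le> w p powr r" .
        have "(\<integral>\<^sup>+x. ennreal (norm (T p x - \<kappa> p) powr r) * indicator (cube q h) x \<partial>lborel)
           \<le> ennreal (C3 * (h ^ ?n * M) * (2 ^ p * k) powr (- (real ?n * r / 2)))"
          using piece_lr[OF pc C(1) m fi M h x0] False by (simp add: T_def \<kappa>_def C3_def k_def)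
        also have "\<dots> \<le> ennreal (A * w p powr r)"
        proof (intro ennreal_leI mult_mono kw)
          show "C3 * (h ^ ?n * M) \<le> A" unfolding A_def using C34 h M0 by (intro mult_right_mono) auto
        qed (use A0 in auto)
        finally show ?thesis .
      qed
    qed
    \<comment> \<open>Only finitely many pieces satisfy 2^p h < 1, so the subtracted constants form
      a finite sum \<open>k0\<close>.\<close>
    obtain P0 :: nat where "1 / h < 2 ^ P0" using real_arch_pow[of 2 "1 / h"] by auto
    then have P0: "1 \<le> 2 ^ P0 * h" using h by (simp add: field_simps)
    have \<kappa>0: "\<kappa> p = 0" if "P0 \<le> p" for p
    proof -
      have "2 ^ P0 * h \<le> 2 ^ p * h" using that h by (intro mult_right_mono power_increasing) auto
      then show ?thesis using P0 by (simp add: \<kappa>_def)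
    qed
    define k0 where "k0 = (\<Sum>p\<le>P0. \<kappa> p)"
    have "(\<lambda>P. \<Sum>p\<le>P. T p x - \<kappa> p) \<longlonglongrightarrow> psido \<sigma> f x - k0" for x
    proof -
      have "(\<lambda>P. \<Sum>p\<le>P. \<kappa> p) \<longlonglongrightarrow> k0"
      proof (rule tendsto_eventually)
        show "\<forall>\<^sub>F P in sequentially. (\<Sum>p\<le>P. \<kappa> p) = k0"
          using eventually_ge_at_top[of P0]
        proof eventually_elim
          case (elim P)
          show ?case unfolding k0_def by (rule sum.mono_neutral_right) (use elim \<kappa>0 in auto)
        qed
      qed
      from tendsto_diff[OF dyadic_sum_tendsto[OF \<sigma> m0 f, of x] this]
      show ?thesis by (simp add: T_def sum_subtractf)
    qed
    then have "(\<integral>\<^sup>+x. ennreal (norm (psido \<sigma> f x - k0) powr r) * indicator (cube q h) x \<partial>lborel) \<le> ennreal (A * S powr r)"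
      by (intro lr_sum_bound[OF _ _ w0 wS r(1) A0 bd]) auto
    also have "\<dots> \<le> ennreal (CC * (h ^ ?n * M))"
    proof (rule ennreal_leI)
      have "A * S powr r = ((C3 + C4) * S powr r) * (h ^ ?n * M)" by (simp only: A_def mult_ac)
      also have "\<dots> \<le> CC * (h ^ ?n * M)" unfolding CC_def using h M0 by (intro mult_right_mono) auto
      finally show "A * S powr r \<le> CC * (h ^ ?n * M)" .
    qed
    finally have "(\<integral>\<^sup>+x. ennreal (norm (psido \<sigma> f x - k0) powr r) * indicator (cube q h) x \<partial>lborel) \<le> ennreal (CC * (h ^ ?n * M))" .
    moreover have "k0 = 0" if "1 \<le> h"
    proof -
      have "\<kappa> p = 0" for p
      proof -
        have "1 * 1 \<le> 2 ^ p * h" using that by (intro mult_mono) auto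
        then show ?thesis by (simp add: \<kappa>_def)
      qed
      then show ?thesis by (simp add: k0_def)
    qed
    ultimately show "\<exists>\<kappa>. (1 \<le> h \<longrightarrow> \<kappa> = 0) \<and>
      (\<integral>\<^sup>+x. ennreal (norm (psido \<sigma> f x - \<kappa>) powr r) * indicator (cube q h) x \<partial>lborel) \<le> ennreal (CC * (h ^ ?n * M))"
      by blast
  qed
qed

end

section \<open>The sharp maximal function estimate\<close>

text \<open>Since 1 + |\<xi>| >= 1, a larger order is a weaker condition; this reduces the theorem
  to the critical order.\<close>

lemma symbol_class_mono:
  assumes "symbol_class m \<rho> \<delta> \<sigma>" "m \<le> m'"
  shows "symbol_class m' \<rho> \<delta> \<sigma>"
  unfolding symbol_class_def
proof (intro conjI allI)
  show "smooth_dirs (range pdir) (\<lambda>z. \<sigma> (fst z) (snd z))" using assms by (simp add: symbol_class_def)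
  fix ds :: "('a + 'a) list"
  let ?e = "\<delta> * real (length (filter isl ds))" and ?d = "\<rho> * real (length (filter (\<lambda>d. \<not> isl d) ds))"
  obtain C where C: "\<And>x \<xi>. norm (ddlist (map pdir ds) (\<lambda>z. \<sigma> (fst z) (snd z)) (x, \<xi>)) \<le> C * (1 + norm \<xi>) powr (m + ?e - ?d)"
    using assms(1) unfolding symbol_class_def by blast
  have "norm (ddlist (map pdir ds) (\<lambda>z. \<sigma> (fst z) (snd z)) (x, \<xi>)) \<le> \<bar>C\<bar> * (1 + norm \<xi>) powr (m' + ?e - ?d)" for x \<xi>
  proof -
    have "C * (1 + norm \<xi>) powr (m + ?e - ?d) \<le> \<bar>C\<bar> * (1 + norm \<xi>) powr (m' + ?e - ?d)"
      using assms(2) by (intro mult_mono powr_mono) auto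
    then show ?thesis using C[of x \<xi>] by linarith
  qed
  then show "\<exists>C. \<forall>x \<xi>. norm (ddlist (map pdir ds) (\<lambda>z. \<sigma> (fst z) (snd z)) (x, \<xi>)) \<le> C * (1 + norm \<xi>) powr (m' + ?e - ?d)"
    by blast
qed

text \<open>The gauge integral in \<open>avg_r\<close> has the value 0 when it does not exist, so
  the bound holds in that case as well and integrability of g need not be discussed.\<close>

lemma avg_r_le:
  fixes g :: "real^'n \<Rightarrow> complex"
  assumes l: "0 < l" and r: "1 < r" and A: "0 \<le> A"
    and le: "(\<integral>\<^sup>+x. ennreal (norm (g x) powr r) * indicator (cube a l) x \<partial>lborel) \<le> ennreal (l ^ CARD('n) * A)"
  shows "avg_r r g a l \<le> A powr (1 / r)"
proof -
  let ?I = "integral (cube a l) (\<lambda>y. norm (g y) powr r)"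
  have "?I \<le> l ^ CARD('n) * A"
  proof (cases "(\<lambda>y. norm (g y) powr r) integrable_on cube a l")
    case True
    then have "(\<integral>\<^sup>+x. ennreal (norm (g x) powr r) * indicator (cube a l) x \<partial>lborel) = ennreal ?I"
      by (intro nn_integral_has_integral_lebesgue' integrable_integral) auto
    then show ?thesis using le l A by simp
  next
    case False
    then show ?thesis using l A by (simp add: not_integrable_integral)
  qed
  moreover have "0 \<le> ?I"
  proof (cases "(\<lambda>y. norm (g y) powr r) integrable_on cube a l")
    case True then show ?thesis by (intro Henstock_Kurzweil_Integration.integral_nonneg) auto
  qed (simp add: not_integrable_integral)
  ultimately show ?thesis unfolding avg_r_def using l r by (intro powr_mono2) (auto simp: field_simps)
qed

text \<open>Continuity of f ensures that the integrals in \<open>max_r\<close> exist, so that a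
  bound on their values controls the nonnegative integrals. The unit cube at x0 shows 0 <=
  M.\<close>

lemma maxbound_of_max_r:
  fixes f :: "real^'n \<Rightarrow> complex"
  assumes f: "continuous_on UNIV f" and r: "1 < r" and M: "max_r r f x0 = ereal M"
  shows "0 \<le> M" "maxbound r f x0 (M powr r)"
proof -
  have avg: "avg_r r f a l \<le> M" if "0 < l" "x0 \<in> cube a l" for a l
  proof -
    have "ereal (avg_r r f (fst (a, l)) (snd (a, l))) \<le> max_r r f x0"
      unfolding max_r_def by (rule SUP_upper) (use that in auto)
    then show ?thesis using M by simp
  qed
  have "x0 \<in> cube x0 1" by (simp add: mem_cube)
  then have "avg_r r f x0 1 \<le> M" using avg by simp
  moreover have "0 \<le> avg_r r f x0 1" by (simp add: avg_r_def)
  ultimately show M0: "0 \<le> M" by linarith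
  have "(\<integral>\<^sup>+y. ennreal (norm (f y) powr r) * indicator (cube a l) y \<partial>lborel) \<le> ennreal (l ^ CARD('n) * M powr r)"
    if l: "0 < l" "x0 \<in> cube a l" for a l
  proof -
    let ?I = "integral (cube a l) (\<lambda>y. norm (f y) powr r)"
    have int: "(\<lambda>y. norm (f y) powr r) integrable_on cube a l"
      unfolding cube_def using r
      by (intro integrable_continuous continuous_intros continuous_on_powr' continuous_on_subset[OF f]) auto
    then have I: "(\<integral>\<^sup>+y. ennreal (norm (f y) powr r) * indicator (cube a l) y \<partial>lborel) = ennreal ?I"
      by (intro nn_integral_has_integral_lebesgue' integrable_integral) auto
    have I0: "0 \<le> ?I" by (intro Henstock_Kurzweil_Integration.integral_nonneg int) auto
    have "((?I / l ^ CARD('n)) powr (1 / r)) powr r \<le> M powr r"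
      using avg[OF l] r unfolding avg_r_def by (intro powr_mono2) auto
    then have "?I / l ^ CARD('n) \<le> M powr r" using r l I0 by (simp add: powr_powr)
    then show ?thesis unfolding I using l by (intro ennreal_leI) (simp add: field_simps)
  qed
  then show "maxbound r f x0 (M powr r)" unfolding maxbound_def by simp
qed

theorem theorem1p1:
  fixes \<sigma> :: "real^'n \<Rightarrow> real^'n \<Rightarrow> complex" and r \<rho> m :: real
  assumes "1 < r" and "r \<le> 2" and "0 < \<rho>" and "\<rho> < 1"
    and "m \<le> - (real CARD('n) / r) * (1 - \<rho>)"
    and "symbol_class m \<rho> \<rho> \<sigma>"
  shows "\<exists>C>0. \<forall>f x. schwartz f \<longrightarrow>
           sharp_r r (psido \<sigma> f) x \<le> ereal C * max_r r f x"
proof -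
  let ?n = "CARD('n)"
  obtain \<theta> where "is_cutoff (4 * ?n) 1 (1 + 2 * real (4 * ?n) + 1) \<theta>"
    using is_cutoff_exists[of 1 "4 * ?n"] by auto
  then interpret cutoff \<theta> "1 + 2 * real (4 * ?n) + 1" "TYPE('n)"
    by unfold_locales auto
  define m' where "m' = - (real ?n / r) * (1 - \<rho>)"
  have \<sigma>: "symbol_class m' \<rho> \<rho> \<sigma>" using symbol_class_mono[OF assms(6)] assms(5) by (simp add: m'_def)
  obtain C where C: "0 < C" "\<And>f x0 M q h. schwartz f \<Longrightarrow> maxbound r f x0 M \<Longrightarrow> 0 < h \<Longrightarrow> x0 \<in> cube q h \<Longrightarrow>
    \<exists>\<kappa>. (1 \<le> h \<longrightarrow> \<kappa> = 0) \<and>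
      (\<integral>\<^sup>+x. ennreal (norm (psido \<sigma> f x - \<kappa>) powr r) * indicator (cube q h) x \<partial>lborel) \<le> ennreal (C * (h ^ ?n * M))"
    using cube_estimate[OF \<sigma> assms(3,4,1,2) m'_def] by blast
  define D where "D = C powr (1 / r)"
  have D: "0 < D" using C by (simp add: D_def)
  show ?thesis
  \<comment> \<open>One \<open>D\<close> for each of the two suprema in
    \<open>sharp_r\<close>.\<close>
  proof (intro exI[of _ "2 * D"] conjI allI impI)
    show "0 < 2 * D" using D by simp
    fix f :: "real^'n \<Rightarrow> complex" and x :: "real^'n" assume f: "schwartz f"
    show "sharp_r r (psido \<sigma> f) x \<le> ereal (2 * D) * max_r r f x"
    proof (cases "max_r r f x")
      case (real M)
      have cf: "continuous_on UNIV f" using schwartz_continuous[OF f, of "[]"] by simp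
      have M0: "0 \<le> M" and MB: "maxbound r f x (M powr r)" using maxbound_of_max_r[OF cf assms(1) real] by auto
      have DM: "(C * M powr r) powr (1 / r) = D * M"
        using C M0 assms(1) by (simp add: D_def powr_mult powr_powr)
      have est: "\<exists>\<kappa>. (1 \<le> l \<longrightarrow> \<kappa> = 0) \<and> avg_r r (\<lambda>y. psido \<sigma> f y - \<kappa>) a l \<le> D * M" if l: "0 < l" "x \<in> cube a l" for a l
      proof -
        obtain \<kappa> where \<kappa>: "1 \<le> l \<longrightarrow> \<kappa> = 0"
          "(\<integral>\<^sup>+y. ennreal (norm (psido \<sigma> f y - \<kappa>) powr r) * indicator (cube a l) y \<partial>lborel) \<le> ennreal (C * (l ^ ?n * M powr r))"
          using C(2)[OF f MB l] by blast
        have "avg_r r (\<lambda>y. psido \<sigma> f y - \<kappa>) a l \<le> (C * M powr r) powr (1 / r)"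
          using \<kappa>(2) C by (intro avg_r_le[OF l(1) assms(1)]) (auto simp: mult_ac)
        then show ?thesis using \<kappa>(1) DM by auto
      qed
      have "(SUP al \<in> {(a, l). 1 \<le> l \<and> x \<in> cube a l}. ereal (avg_r r (psido \<sigma> f) (fst al) (snd al))) \<le> ereal (D * M)"
      proof (rule SUP_least)
        fix al assume "al \<in> {(a, l). 1 \<le> l \<and> x \<in> cube a l}"
        then obtain a l where al: "al = (a, l)" "1 \<le> l" "x \<in> cube a l" by auto
        \<comment> \<open>For 1 <= l the constant delivered by \<open>est\<close> is 0.\<close>
        then show "ereal (avg_r r (psido \<sigma> f) (fst al) (snd al)) \<le> ereal (D * M)" using est[of l a] by auto
      qed
      moreover have "(SUP al \<in> {(a, l). 0 < l \<and> l < 1 \<and> x \<in> cube a l}.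
          ereal (INF c. avg_r r (\<lambda>y. psido \<sigma> f y - c) (fst al) (snd al))) \<le> ereal (D * M)"
      proof (rule SUP_least)
        fix al assume "al \<in> {(a, l). 0 < l \<and> l < 1 \<and> x \<in> cube a l}"
        then obtain a l where al: "al = (a, l)" "0 < l" "x \<in> cube a l" by auto
        obtain \<kappa> where \<kappa>: "avg_r r (\<lambda>y. psido \<sigma> f y - \<kappa>) a l \<le> D * M" using est[OF al(2,3)] by blast
        have "(INF c. avg_r r (\<lambda>y. psido \<sigma> f y - c) a l) \<le> avg_r r (\<lambda>y. psido \<sigma> f y - \<kappa>) a l"
          by (rule cINF_lower) (auto intro!: bdd_belowI[of _ 0] simp: avg_r_def)
        with \<kappa> show "ereal (INF c. avg_r r (\<lambda>y. psido \<sigma> f y - c) (fst al) (snd al)) \<le> ereal (D * M)" by (simp add: al)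
      qed
      ultimately have "sharp_r r (psido \<sigma> f) x \<le> ereal (D * M) + ereal (D * M)"
        unfolding sharp_r_def by (rule add_mono)
      also have "\<dots> = ereal (2 * D) * max_r r f x" by (simp add: real)
      finally show ?thesis .
    next
      case PInf
      then show ?thesis using D by simp
    next
      case MInf
      \<comment> \<open>One finite average already bounds \<open>max_r\<close> from below, so this
        case is void.\<close>
      have "ereal (avg_r r f x 1) \<le> max_r r f x"
        using SUP_upper[of "(x, 1)" "{(a, l). 0 < l \<and> x \<in> cube a l}" "\<lambda>al. ereal (avg_r r f (fst al) (snd al))"]
        by (simp add: max_r_def mem_cube)
      then show ?thesis using MInf by simp
    qed
  qed
qed

end
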